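(* Let $p$ be an odd prime such that $p=x^2+y^2$ with integers $x,y$ satisfying $4\mid x-1$ and $2\mid y$. Then $$\sum_{k=0}^{p-1}\frac{(k+1)\binom{2k}{k}^2}{8^k}+\sum_{k=0}^{(p-1)/2}\frac{(2k+1)\binom{2k}{k}^2}{(-16)^k}\equiv 2\left(\frac{2}{p}\right)x\pmod{p^3}.$$
   Context: $\left(\frac{\cdot}{p}\right)$ denotes the Legendre symbol. For rational numbers $a,b$ with denominators prime to $p$, $a\equiv b\pmod{p^m}$ means $(a-b)/p^m$ is a rational number with denominator prime to $p$. *)

theory Defs
  imports "HOL-Number_Theory.Number_Theory"
begin

definition rat_cong_pow :: "rat \<Rightarrow> rat \<Rightarrow> int \<Rightarrow> nat \<Rightarrow> bool" where
  "rat_cong_pow a b p m \<longleftrightarrow> coprime (snd (quotient_of ((a - b) / of_int (p ^ m)))) p"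

end

theory Submission
  imports Defs "HOL-Computational_Algebra.Formal_Power_Series"
begin

text \<open>
  Write \<open>p = 4 M + 1\<close>, \<open>n = 2 M\<close>, \<open>a\<^sub>k = C(2 k, k) / 4\<^sup>k\<close>, \<open>m = C(n, M) / 2\<^sup>n\<close>, and let \<open>e\<close> be the sum of \<open>1 / i\<^sup>2\<close>
  over \<open>1 \<le> i \<le> M\<close>. As \<open>k + 1\<close> and \<open>2 k + 1\<close> are the means of \<open>1\<close> with \<open>2 k + 1\<close> and \<open>4 k + 1\<close>, twice the left-hand
  side is the sum of the two series with weights \<open>1\<close>, namely \<open>a\<^sub>k\<^sup>2 2\<^sup>k\<close> over \<open>k \<le> 2 n\<close> and \<open>(-1)\<^sup>k a\<^sub>k\<^sup>2\<close> over \<open>k \<le> n\<close>,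
  and of the two series with the linear weights. Each series equals an explicit product times a terminating sum whose
  only term of order \<open>p\<^sup>0\<close> is the leading one, so it can be expanded modulo \<open>p\<^sup>3\<close>. The two expansions share
  an intractable term (\<open>W\<close>, resp. a value of \<open>G\<close>) with opposite signs, and the pairs add up to
  \<open>m (2 - p\<^sup>2 e / 8)\<close> and \<open>2 p / m\<close>. Hence the left-hand side is \<open>m (1 - p\<^sup>2 e / 16) + p / m\<close>.

  On the other side, let \<open>J\<close> be the Jacobsthal sum of the Legendre symbols of \<open>u - u\<^sup>3\<close>. Then
  \<open>J = - 2 (2/p) x\<close>. Let \<open>u\<close> run through the powers \<open>u\<^bsup>p\<^sup>2\<^esup>\<close>, which are roots of unity modulo \<open>p\<^sup>3\<close>, and
  write the Legendre symbol of \<open>f\<close> modulo \<open>p\<^sup>3\<close> as a polynomial in \<open>f\<^sup>n\<close>: this turns \<open>8 J\<close> into a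
  combination of binomial coefficients, and expanding them shows that \<open>- J\<close> is the same
  expression in \<open>m\<close> and \<open>e\<close>.
\<close>

section \<open>Terminating hypergeometric sums\<close>

text \<open>The weights are split as they are because \<open>1\<close> and \<open>2 k + 1\<close>
  turn the square of \<open>half_choose k\<close> into C(-1/2, k) C(-2 y, k) with y = 1/4 and y =
  3/4, while \<open>1\<close> and \<open>4 k + 1\<close> lead to series at -1 that are well-poised
  and very well-poised, hence summable as products. Both transformations are Lagrange interpolation:
  a series is the value at a fraction of a polynomial whose values at integers are known. The
  fractions suit p because 1/2 = p/2 - n and 1/4 = p/4 - M, so the Pochhammer symbols are factorials
  perturbed by multiples of p and expand in harmonic sums. On the Jacobsthal side, roots of unity
  are needed to full precision so that their power sums vanish modulo p^3 and not only modulo p. The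
  polynomial (15 w - 10 w^3 + 3 w^5)/8 is the unique one of degree at most 5 with value w and
  vanishing first and second derivatives at w = 1 and w = -1; its exponents are why binomial
  coefficients from rows 2 M, 6 M and 10 M occur.\<close>

lemma alternating_binomial_sum_Suc:
  fixes f :: "nat \<Rightarrow> 'a::comm_ring_1"
  shows "(\<Sum>i\<le>Suc n. (-1)^i * of_nat (Suc n choose i) * f i)
       = (\<Sum>i\<le>n. (-1)^i * of_nat (n choose i) * (f i - f (Suc i)))"
proof -
  have "(\<Sum>i\<le>Suc n. (-1)^i * of_nat (Suc n choose i) * f i)
      = f 0 + (\<Sum>i\<le>n. (-1)^(Suc i) * of_nat (n choose Suc i) * f (Suc i))
            - (\<Sum>i\<le>n. (-1)^i * of_nat (n choose i) * f (Suc i))"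
    by (subst sum.atMost_Suc_shift) (simp add: algebra_simps sum.distrib sum_negf sum_subtractf)
  also have "f 0 + (\<Sum>i\<le>n. (-1)^(Suc i) * of_nat (n choose Suc i) * f (Suc i))
      = (\<Sum>i\<le>Suc n. (-1)^i * of_nat (n choose i) * f i)"
    by (subst sum.atMost_Suc_shift) (simp add: binomial_eq_0)
  also have "\<dots> = (\<Sum>i\<le>n. (-1)^i * of_nat (n choose i) * f i)"
    by (simp add: binomial_eq_0)
  finally show ?thesis
    by (simp add: sum_subtractf algebra_simps)
qed

text \<open>This is the partial fraction decomposition of n!/(y (y + 1) ... (y + n)).\<close>

lemma alternating_binomial_reciprocal:
  fixes y :: "'a::field_char_0"
  assumes "pochhammer y (Suc n) \<noteq> 0"
  shows "(\<Sum>i\<le>n. (-1)^i * of_nat (n choose i) / (y + of_nat i)) = fact n / pochhammer y (Suc n)"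
  using assms
proof (induction n arbitrary: y)
  case 0
  then show ?case by simp
next
  case (Suc n)
  have nz: "pochhammer y (Suc n) \<noteq> 0" "y + of_nat (Suc n) \<noteq> 0"
    using Suc.prems by (auto simp: pochhammer_Suc)
  have nz2: "y \<noteq> 0" "pochhammer (y + 1) (Suc n) \<noteq> 0"
    using Suc.prems by (auto simp: pochhammer_rec)
  have "(\<Sum>i\<le>Suc n. (-1)^i * of_nat (Suc n choose i) / (y + of_nat i))
      = (\<Sum>i\<le>Suc n. (-1)^i * of_nat (Suc n choose i) * (1 / (y + of_nat i)))"
    by simp
  also have "\<dots> = (\<Sum>i\<le>n. (-1)^i * of_nat (n choose i) * (1 / (y + of_nat i) - 1 / (y + of_nat (Suc i))))"
    by (rule alternating_binomial_sum_Suc)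
  also have "\<dots> = (\<Sum>i\<le>n. (-1)^i * of_nat (n choose i) / (y + of_nat i))
      - (\<Sum>i\<le>n. (-1)^i * of_nat (n choose i) / (y + 1 + of_nat i))"
    by (simp add: right_diff_distrib sum_subtractf add.assoc)
  also have "\<dots> = fact n / pochhammer y (Suc n) - fact n / pochhammer (y + 1) (Suc n)"
    using Suc.IH nz(1) nz2(2) by simp
  also have "\<dots> = fact (Suc n) / pochhammer y (Suc (Suc n))"
  proof -
    have a: "pochhammer y (Suc (Suc n)) = pochhammer y (Suc n) * (y + of_nat (Suc n))"
      by (simp add: pochhammer_Suc)
    have b: "pochhammer y (Suc (Suc n)) = y * pochhammer (y + 1) (Suc n)"
      by (rule pochhammer_rec)
    have "fact n / pochhammer y (Suc n) = fact n * (y + of_nat (Suc n)) / pochhammer y (Suc (Suc n))"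
      unfolding a using nz by simp
    moreover have "fact n / pochhammer (y + 1) (Suc n) = fact n * y / pochhammer y (Suc (Suc n))"
      unfolding b using nz2 by simp
    ultimately show ?thesis
      by (simp add: diff_divide_distrib[symmetric] algebra_simps)
  qed
  finally show ?case .
qed

text \<open>Partial fractions again: C(-y, j) has degree at most n in y, so its product with n!/(y
  (y + 1) ... (y + n)) is a proper fraction, and at the pole y = -i the extra factor takes the value
  C(i, j).\<close>

lemma alternating_binomial_choose_reciprocal:
  fixes y :: "'a::field_char_0"
  assumes nz: "pochhammer y (Suc n) \<noteq> 0" and jn: "j \<le> n"
  shows "(\<Sum>i\<le>n. (-1)^i * of_nat (n choose i) * of_nat (i choose j) / (y + of_nat i))
       = fact n / pochhammer y (Suc n) * (- y gchoose j)"
proof -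
  have split: "pochhammer y (Suc n) = pochhammer y j * pochhammer (y + of_nat j) (Suc (n - j))"
    using pochhammer_product[of j "Suc n" y] jn by (simp add: Suc_diff_le)
  have "(\<Sum>i\<le>n. (-1)^i * of_nat (n choose i) * of_nat (i choose j) / (y + of_nat i))
      = (\<Sum>i\<in>{j..n}. (-1)^i * of_nat (n choose i) * of_nat (i choose j) / (y + of_nat i))"
    by (rule sum.mono_neutral_right) (auto simp: binomial_eq_0)
  also have "\<dots> = (\<Sum>l\<le>n - j. (-1)^(l + j) * of_nat (n choose (l + j)) * of_nat ((l + j) choose j) / (y + of_nat (l + j)))"
    using jn by (intro sum.reindex_bij_witness[of _ "\<lambda>l. l + j" "\<lambda>i. i - j"]) auto
  also have "\<dots> = (\<Sum>l\<le>n - j. (-1)^j * of_nat (n choose j) * ((-1)^l * of_nat ((n - j) choose l) / (y + of_nat j + of_nat l)))"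
  proof (rule sum.cong[OF refl])
    fix l assume "l \<in> {..n - j}"
    then have "(n choose (l + j)) * ((l + j) choose j) = (n choose j) * ((n - j) choose l)"
      using choose_mult[of j "l + j" n] jn by simp
    then have "(of_nat (n choose (l + j)) * of_nat ((l + j) choose j) :: 'a) = of_nat (n choose j) * of_nat ((n - j) choose l)"
      by (metis of_nat_mult)
    then show "(-1)^(l + j) * of_nat (n choose (l + j)) * of_nat ((l + j) choose j) / (y + of_nat (l + j))
      = (-1)^j * of_nat (n choose j) * ((-1)^l * of_nat ((n - j) choose l) / (y + of_nat j + of_nat l))"
      by (simp add: power_add algebra_simps)
  qed
  also have "\<dots> = (-1)^j * of_nat (n choose j) * (fact (n - j) / pochhammer (y + of_nat j) (Suc (n - j)))"
    using nz unfolding split sum_distrib_left[symmetric]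
    by (subst alternating_binomial_reciprocal) auto
  also have "\<dots> = fact n / pochhammer y (Suc n) * (- y gchoose j)"
    using nz jn unfolding split
    by (simp add: gbinomial_pochhammer binomial_fact field_simps)
  finally show ?thesis .
qed

text \<open>Lagrange's formula: the polynomial with Newton coefficients \<open>a\<close> is
  recovered at -y from its values at 0, ..., n. It is used to trade one set of Newton coefficients
  for another.\<close>

lemma alternating_binomial_newton_reciprocal:
  fixes y :: "'a::field_char_0"
  assumes nz: "pochhammer y (Suc n) \<noteq> 0"
  shows "(\<Sum>i\<le>n. (-1)^i * of_nat (n choose i) * (\<Sum>j\<le>n. a j * of_nat (i choose j)) / (y + of_nat i))
       = fact n / pochhammer y (Suc n) * (\<Sum>j\<le>n. a j * (- y gchoose j))"
proof -
  have "(\<Sum>i\<le>n. (-1)^i * of_nat (n choose i) * (\<Sum>j\<le>n. a j * of_nat (i choose j)) / (y + of_nat i))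
     = (\<Sum>j\<le>n. a j * (\<Sum>i\<le>n. (-1)^i * of_nat (n choose i) * of_nat (i choose j) / (y + of_nat i)))"
    unfolding sum_distrib_left sum_divide_distrib
    by (subst sum.swap) (intro sum.cong refl, simp add: algebra_simps)
  also have "\<dots> = (\<Sum>j\<le>n. a j * (fact n / pochhammer y (Suc n) * (- y gchoose j)))"
    using alternating_binomial_choose_reciprocal[OF nz] by (intro sum.cong) auto
  also have "\<dots> = fact n / pochhammer y (Suc n) * (\<Sum>j\<le>n. a j * (- y gchoose j))"
    by (simp add: sum_distrib_left mult_ac)
  finally show ?thesis .
qed

lemma gbinomial_add_of_nat:
  fixes z :: "'a::field_char_0"
  assumes "i \<le> n"
  shows "(of_nat i + z) gchoose r = (\<Sum>j\<le>r. of_nat (i choose j) * (z gchoose (r - j)))"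
  by (simp add: gbinomial_Vandermonde[symmetric] atLeast0AtMost binomial_gbinomial)

lemma sum_atMost_telescope:
  fixes G :: "nat \<Rightarrow> 'a::ab_group_add"
  shows "(\<Sum>k\<le>n. G (Suc k) - G k) = G (Suc n) - G 0"
  using sum_lessThan_telescope[of G "Suc n"] by (simp add: lessThan_Suc_atMost)

section \<open>The series with powers of 2\<close>

definition half_choose :: "nat \<Rightarrow> 'a::field_char_0" where
  "half_choose k = of_nat ((2 * k) choose k) / 4 ^ k"

lemma half_choose_0 [simp]: "half_choose 0 = 1"
  by (simp add: half_choose_def)

lemma half_choose_eq_pochhammer: "half_choose k = pochhammer (1/2) k / (fact k :: 'a::field_char_0)"
proof -
  have "of_nat ((2 * k) choose k) = (fact (2 * k) / (fact k * fact k) :: 'a)"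
    by (simp add: binomial_fact)
  also have "fact (2 * k) = (4 ^ k * pochhammer (1/2) k * fact k :: 'a)"
    by (simp add: fact_double power_mult)
  finally show ?thesis by (simp add: half_choose_def)
qed

lemma gbinomial_minus_half: "(- 1/2 gchoose k) = (-1)^k * (half_choose k :: 'a::field_char_0)"
  by (simp add: half_choose_eq_pochhammer gbinomial_pochhammer)

lemma half_choose_Suc:
  "half_choose (Suc k) = half_choose k * (of_nat (2 * k + 1) / of_nat (2 * k + 2) :: 'a::field_char_0)"
proof -
  have "of_nat (2 * k + 2) = (2 * of_nat (Suc k) :: 'a)" by simp
  moreover have "(of_nat (Suc k) :: 'a) \<noteq> 0" by (rule of_nat_neq_0)
  ultimately show ?thesis
    by (simp only: half_choose_eq_pochhammer pochhammer_Suc fact_Suc) (simp add: field_simps)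
qed

text \<open>Creative telescoping: the recurrence applied to the summand is a difference in
  \<open>k\<close>, once multiplied by \<open>N + 2\<close>.\<close>

lemma sum_choose_minus_half_Suc_Suc:
  fixes d :: "nat \<Rightarrow> 'a::field_char_0"
  defines "d \<equiv> \<lambda>N. \<Sum>k\<le>N. of_nat (N choose k) * (- 1/2 gchoose k) * 2 ^ k"
  shows "of_nat (N + 2) * d (N + 2) = of_nat (N + 1) * d N"
proof -
  define X :: "nat \<Rightarrow> 'a" where "X k = (- 1/2 gchoose k) * 2 ^ k" for k
  define B :: "nat \<Rightarrow> 'a" where "B k = of_nat ((N + 2) choose k)" for k
  define z :: 'a where "z = of_nat N"
  \<comment> \<open>The telescoping certificate. It vanishes at 0 through its factor k^2 and beyond
    \<open>N + 2\<close> through \<open>B\<close>, so both boundary terms disappear.\<close>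
  define G where "G k = - ((of_nat k)^2 * B k * X k)" for k
  have X: "of_nat (Suc k) * X (Suc k) = - (2 * of_nat k + 1) * X k" for k
  proof -
    have a: "(- 1/2 gchoose Suc k) * of_nat (Suc k) = (- 1/2 gchoose k) * (- 1/2 - of_nat k :: 'a)"
      using gbinomial_mult_1[of "- 1/2 :: 'a" k] by (simp add: algebra_simps)
    have "of_nat (Suc k) * X (Suc k) = ((- 1/2 gchoose Suc k) * of_nat (Suc k)) * (2 * 2 ^ k)"
      by (simp add: X_def)
    also have "\<dots> = - (2 * of_nat k + 1) * X k"
      unfolding a by (simp add: X_def algebra_simps)
    finally show ?thesis .
  qed
  have B: "of_nat (Suc k) * B (Suc k) = (z + 2 - of_nat k) * B k" for k
    using gbinomial_mult_1[of "of_nat (N + 2) :: 'a" k]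
    unfolding B_def z_def binomial_gbinomial by (simp add: algebra_simps)
  have C: "(z + 2) * (z + 1) * of_nat (N choose k) = (z + 2 - of_nat k) * (z + 1 - of_nat k) * B k" for k
  proof -
    have "of_nat (Suc m) * (of_nat (m choose k) :: 'a) = (of_nat (Suc m) - of_nat k) * of_nat (Suc m choose k)" for m
    proof (cases "k \<le> Suc m")
      case True
      have "(Suc m - k) * (Suc m choose k) = Suc m * (m choose k)"
        using binomial_absorb_comp[of "Suc m" k] by simp
      then have "(of_nat (Suc m - k) * of_nat (Suc m choose k) :: 'a) = of_nat (Suc m) * of_nat (m choose k)"
        by (metis of_nat_mult)
      then show ?thesis using True by (simp only: of_nat_diff)
    qed (simp add: binomial_eq_0)
    note m = this
    have "(z + 1) * of_nat (N choose k) = (z + 1 - of_nat k) * of_nat (Suc N choose k)"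
      using m[of N] by (simp add: z_def add.commute)
    then have "(z + 2) * (z + 1) * of_nat (N choose k) = (z + 1 - of_nat k) * ((z + 2) * of_nat (Suc N choose k))"
      by (simp add: mult_ac)
    moreover have "(z + 2) * of_nat (Suc N choose k) = (z + 2 - of_nat k) * B k"
      using m[of "Suc N"] by (simp add: z_def B_def add.commute del: binomial_Suc_Suc)
    ultimately show ?thesis by (simp add: mult_ac)
  qed
  have "of_nat (N + 2) * (of_nat (N + 2) * d (N + 2) - of_nat (N + 1) * d N)
      = (\<Sum>k\<le>N + 2. (z + 2)^2 * B k * X k - (z + 2) * (z + 1) * of_nat (N choose k) * X k)"
    unfolding d_def X_def B_def z_def sum_subtractf
    by (simp add: sum_distrib_left algebra_simps power2_eq_square binomial_eq_0)
  also have "\<dots> = (\<Sum>k\<le>N + 2. G (Suc k) - G k)"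
  proof (rule sum.cong[OF refl])
    fix k
    have "G (Suc k) = - (of_nat (Suc k) * B (Suc k)) * (of_nat (Suc k) * X (Suc k))"
      by (simp add: G_def power2_eq_square)
    also have "\<dots> = (z + 2 - of_nat k) * B k * ((2 * of_nat k + 1) * X k)"
      unfolding X B by (simp add: algebra_simps)
    finally show "(z + 2)^2 * B k * X k - (z + 2) * (z + 1) * of_nat (N choose k) * X k = G (Suc k) - G k"
      unfolding C G_def by (simp add: algebra_simps power2_eq_square)
  qed
  also have "\<dots> = 0"
    by (subst sum_atMost_telescope) (simp add: G_def B_def binomial_eq_0)
  finally show ?thesis
    by (metis add_2_eq_Suc' eq_iff_diff_eq_0 mult_eq_0_iff of_nat_neq_0)
qed

text \<open>A reason for the parity: 2^k C(-1/2, k) = (-1/2)^k C(2 k, k), and C(2 k, k) is the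
  constant term of (t + 2 + 1/t)^k, so the sum is the constant term of (-(t + 1/t)/2)^N. The
  induction uses the two-step recurrence instead.\<close>

lemma sum_choose_minus_half:
  "(\<Sum>k\<le>N. of_nat (N choose k) * (- 1/2 gchoose k) * 2 ^ k)
     = (if even N then half_choose (N div 2) else 0 :: 'a::field_char_0)"
proof (induction N rule: induct_nat_012)
  case (ge2 N)
  define D :: "nat \<Rightarrow> 'a" where "D N = (\<Sum>k\<le>N. of_nat (N choose k) * (- 1/2 gchoose k) * 2 ^ k)" for N
  have nz: "(of_nat (N + 2) :: 'a) \<noteq> 0" by (subst of_nat_eq_0_iff) simp
  have e: "of_nat (N + 2) * D (N + 2) = of_nat (N + 1) * (if even N then half_choose (N div 2) else 0)"
    using sum_choose_minus_half_Suc_Suc[of N, where ?'a = 'a] ge2(1) by (simp only: D_def)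
  have "D (N + 2) = (if even N then half_choose (Suc (N div 2)) else 0)"
  proof (cases "even N")
    case True
    then have "2 * (N div 2) = N" by simp
    then have "of_nat (N + 2) * half_choose (Suc (N div 2)) = of_nat (N + 1) * (half_choose (N div 2) :: 'a)"
      using nz by (simp add: half_choose_Suc)
    then have "of_nat (N + 2) * D (N + 2) = of_nat (N + 2) * half_choose (Suc (N div 2))"
      using e True by simp
    then show ?thesis using nz True by (simp only: mult_left_cancel) simp
  next
    case False
    then show ?thesis using e nz by (simp only: if_False mult_zero_right mult_eq_0_iff) simp
  qed
  then show ?case by (simp add: D_def)
qed simp_all

text \<open>Prepares a second interpolation: the even entries of row \<open>2 * n\<close> become row
  \<open>n\<close> with signs, times a factor that Vandermonde's identity expands in Newton form in
  \<open>i\<close>.\<close>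

lemma choose_double_half_choose:
  assumes "i \<le> n"
  shows "of_nat ((2 * n) choose (2 * i)) * half_choose i
       = (-1)^i * of_nat (n choose i) * ((of_nat i + (- of_nat n - 1/2)) gchoose i :: 'a::field_char_0)"
proof -
  have nz: "pochhammer (1/2 :: 'a) k \<noteq> 0" for k
    using half_choose_eq_pochhammer[of k, where ?'a = 'a] 
    by (auto simp: half_choose_def)
  have dbl: "(fact (2 * k) :: 'a) = 4 ^ k * pochhammer (1/2) k * fact k" for k
    by (simp add: fact_double power_mult)
  have c: "(of_nat ((2 * n) choose (2 * i)) :: 'a) = fact (2 * n) / (fact (2 * i) * fact (2 * (n - i)))"
    using assms by (subst binomial_fact) (auto simp: diff_mult_distrib2)
  have p4: "(4::'a) ^ n = 4 ^ i * 4 ^ (n - i)"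
    using assms by (simp flip: power_add)
  have g: "((of_nat i + (- of_nat n - 1/2)) gchoose i :: 'a) = (-1)^i * pochhammer (1/2 + of_nat (n - i)) i / fact i"
    using assms by (simp add: gbinomial_pochhammer of_nat_diff algebra_simps)
  have s: "pochhammer (1/2 :: 'a) n = pochhammer (1/2) (n - i) * pochhammer (1/2 + of_nat (n - i)) i"
    using pochhammer_product[of "n - i" n "1/2 :: 'a"] assms by simp
  show ?thesis
    unfolding c g dbl half_choose_eq_pochhammer s p4 
    using assms nz[of i] nz[of "n - i"] by (simp add: binomial_fact field_simps flip: power_mult_distrib)
qed

text \<open>The left side is a Newton series of degree 2 n evaluated at -2 y. By
  \<open>sum_choose_minus_half\<close> its values at odd nodes vanish, and at the even nodes 2 i the
  denominators are 2 (y + i), so the same data are read as an interpolation at 0, ..., n evaluated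
  at -y. The gain is the upper entry -n - 1/2, which is -p/2 when 2 n + 1 = p.\<close>

lemma sum_minus_half_two_power:
  fixes y :: "'a::field_char_0"
  assumes nz1: "pochhammer (2 * y) (Suc (2 * n)) \<noteq> 0" and nz2: "pochhammer y (Suc n) \<noteq> 0"
  shows "(\<Sum>k\<le>2 * n. (- 1/2 gchoose k) * 2 ^ k * (- (2 * y) gchoose k))
    = pochhammer (2 * y) (Suc (2 * n)) / (2 * fact (2 * n)) * (fact n / pochhammer y (Suc n))
      * (\<Sum>j\<le>n. (- y gchoose j) * ((- of_nat n - 1/2) gchoose j))"
proof -
  let ?d = "\<lambda>N. (if even N then half_choose (N div 2) else 0 :: 'a)"
  let ?e = "- of_nat n - 1/2 :: 'a"
  have d: "(\<Sum>k\<le>2 * n. (- 1/2 gchoose k) * 2 ^ k * of_nat (b choose k)) = ?d b" if "b \<le> 2 * n" for b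
  proof -
    have "(\<Sum>k\<le>2 * n. (- 1/2 gchoose k) * 2 ^ k * of_nat (b choose k))
        = (\<Sum>k\<le>b. (- 1/2 gchoose k) * 2 ^ k * (of_nat (b choose k) :: 'a))"
      using that by (intro sum.mono_neutral_right) (auto simp: binomial_eq_0)
    then show ?thesis by (simp add: sum_choose_minus_half[symmetric] mult_ac)
  qed
  have "fact (2 * n) / pochhammer (2 * y) (Suc (2 * n)) * (\<Sum>k\<le>2 * n. (- 1/2 gchoose k) * 2 ^ k * (- (2 * y) gchoose k))
      = (\<Sum>b\<le>2 * n. (-1)^b * of_nat ((2 * n) choose b) * ?d b / (2 * y + of_nat b))"
    using alternating_binomial_newton_reciprocal[OF nz1, of "\<lambda>k. (- 1/2 gchoose k) * 2 ^ k"] d by simp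
  \<comment> \<open>Only the even nodes survive.\<close>
  also have "\<dots> = (\<Sum>b\<in>(*) 2 ` {..n}. (-1)^b * of_nat ((2 * n) choose b) * ?d b / (2 * y + of_nat b))"
    by (rule sum.mono_neutral_right) (auto elim!: evenE)
  also have "\<dots> = (\<Sum>i\<le>n. of_nat ((2 * n) choose (2 * i)) * half_choose i / (2 * y + of_nat (2 * i)))"
    by (subst sum.reindex) (auto intro: inj_onI)
  also have "\<dots> = (\<Sum>i\<le>n. (-1)^i * of_nat (n choose i) * (\<Sum>j\<le>n. (?e gchoose j) * of_nat (i choose j)) / (y + of_nat i)) / 2"
    unfolding sum_divide_distrib
  proof (rule sum.cong[OF refl])
    fix i assume i: "i \<in> {..n}"
    have "(of_nat i + ?e) gchoose i = (\<Sum>j\<le>i. of_nat (i choose j) * (?e gchoose (i - j)))"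
      by (rule gbinomial_add_of_nat[OF order_refl])
    \<comment> \<open>Reversing the sum makes the cofactor of C(i, j) independent of
      \<open>i\<close>, as a Newton expansion requires.\<close>
    also have "\<dots> = (\<Sum>j\<le>i. of_nat (i choose j) * (?e gchoose j))"
      by (rule sum.reindex_bij_witness[of _ "\<lambda>j. i - j" "\<lambda>j. i - j"]) (auto simp: binomial_symmetric[symmetric])
    also have "\<dots> = (\<Sum>j\<le>n. of_nat (i choose j) * (?e gchoose j))"
      using i by (intro sum.mono_neutral_left) (auto simp: binomial_eq_0)
    finally have "(of_nat i + ?e) gchoose i = (\<Sum>j\<le>n. (?e gchoose j) * of_nat (i choose j))"
      by (simp add: mult.commute)
    moreover have "2 * y + of_nat (2 * i) = 2 * (y + of_nat i)" by simp
    ultimately show "of_nat ((2 * n) choose (2 * i)) * half_choose i / (2 * y + of_nat (2 * i))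
       = (-1)^i * of_nat (n choose i) * (\<Sum>j\<le>n. (?e gchoose j) * of_nat (i choose j)) / (y + of_nat i) / 2"
      using choose_double_half_choose[of i n, where ?'a = 'a] i by simp
  qed
  also have "\<dots> = fact n / pochhammer y (Suc n) * (\<Sum>j\<le>n. (?e gchoose j) * (- y gchoose j)) / 2"
    by (subst alternating_binomial_newton_reciprocal[OF nz2]) simp
  finally have "pochhammer (2 * y) (Suc (2 * n)) / fact (2 * n) * (fact (2 * n) / pochhammer (2 * y) (Suc (2 * n))
        * (\<Sum>k\<le>2 * n. (- 1/2 gchoose k) * 2 ^ k * (- (2 * y) gchoose k)))
      = pochhammer (2 * y) (Suc (2 * n)) / fact (2 * n)
        * (fact n / pochhammer y (Suc n) * (\<Sum>j\<le>n. (?e gchoose j) * (- y gchoose j)) / 2)"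
    by (rule arg_cong)
  then show ?thesis
    using nz1 by (simp add: mult_ac)
qed

section \<open>Well-poised sums at -1\<close>

text \<open>The shifts in \<open>N\<close> and in \<open>k\<close> of the common hypergeometric
  term, cleared of denominators; both telescoping proofs below reduce to them.\<close>

lemma well_poised_ratio:
  fixes N k :: nat
  defines "t \<equiv> \<lambda>N k. of_nat (N choose k) * pochhammer (1/2) k / pochhammer (3/2 + of_nat N) k :: 'a::field_char_0"
  shows "(of_nat N + 1) * (3/2 + of_nat N) * t N k
           = (of_nat N + 1 - of_nat k) * (3/2 + of_nat N + of_nat k) * t (Suc N) k"
    and "of_nat (Suc k) * (3/2 + of_nat N + of_nat (Suc k)) * t (Suc N) (Suc k)
           = (of_nat N + 1 - of_nat k) * (1/2 + of_nat k) * t (Suc N) k"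
proof -
  have nz: "(3/2 + of_nat i :: 'a) \<noteq> 0" for i
  proof
    assume "(3/2 + of_nat i :: 'a) = 0"
    then have "(of_nat (3 + 2 * i) :: 'a) = 0" by (simp add: field_simps)
    then show False by (subst (asm) of_nat_eq_0_iff) simp
  qed
  have pz: "pochhammer (3/2 + of_nat i :: 'a) j \<noteq> 0" for i j
    using nz[of "i + _"] by (auto simp: pochhammer_eq_0_iff add.assoc eq_neg_iff_add_eq_0 simp flip: of_nat_add)
  have p: "(3/2 + of_nat N) * pochhammer (3/2 + of_nat (Suc N) :: 'a) k
        = pochhammer (3/2 + of_nat N) k * (3/2 + of_nat N + of_nat k)"
    using pochhammer_rec[of "3/2 + of_nat N :: 'a" k] pochhammer_Suc[of "3/2 + of_nat N :: 'a" k]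
    by (simp add: add_ac)
  have c: "(of_nat N + 1) * (of_nat (N choose k) :: 'a) = (of_nat N + 1 - of_nat k) * of_nat (Suc N choose k)"
  proof (cases "k \<le> Suc N")
    case True
    have "(Suc N - k) * (Suc N choose k) = Suc N * (N choose k)"
      using binomial_absorb_comp[of "Suc N" k] by simp
    then have "(of_nat (Suc N - k) * of_nat (Suc N choose k) :: 'a) = of_nat (Suc N) * of_nat (N choose k)"
      by (metis of_nat_mult)
    then show ?thesis using True by (simp add: of_nat_diff add.commute)
  qed (simp add: binomial_eq_0)
  show "(of_nat N + 1) * (3/2 + of_nat N) * t N k
           = (of_nat N + 1 - of_nat k) * (3/2 + of_nat N + of_nat k) * t (Suc N) k"
  proof -
    have "(3/2 + of_nat N) / pochhammer (3/2 + of_nat N) k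
        = (3/2 + of_nat N + of_nat k) / pochhammer (3/2 + of_nat (Suc N) :: 'a) k"
      using p pz[of N k] pz[of "Suc N" k] by (subst frac_eq_eq) (auto simp: mult_ac)
    then have "((of_nat N + 1) * of_nat (N choose k)) * pochhammer (1/2) k * ((3/2 + of_nat N) / pochhammer (3/2 + of_nat N) k)
        = ((of_nat N + 1 - of_nat k) * of_nat (Suc N choose k)) * pochhammer (1/2) k
            * ((3/2 + of_nat N + of_nat k) / pochhammer (3/2 + of_nat (Suc N) :: 'a) k)"
      unfolding c by simp
    then show ?thesis unfolding t_def by (simp add: mult_ac)
  qed
  have b: "of_nat (Suc k) * (of_nat (Suc N choose Suc k) :: 'a) = (of_nat N + 1 - of_nat k) * of_nat (Suc N choose k)"
    using gbinomial_mult_1[of "of_nat (Suc N) :: 'a" k] unfolding binomial_gbinomial by (simp add: algebra_simps)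
  show "of_nat (Suc k) * (3/2 + of_nat N + of_nat (Suc k)) * t (Suc N) (Suc k)
           = (of_nat N + 1 - of_nat k) * (1/2 + of_nat k) * t (Suc N) k"
  proof -
    have q: "pochhammer (3/2 + of_nat (Suc N) :: 'a) (Suc k)
        = pochhammer (3/2 + of_nat (Suc N)) k * (3/2 + of_nat N + of_nat (Suc k))"
      by (simp add: pochhammer_Suc add_ac)
    have nz': "3/2 + of_nat N + of_nat (Suc k) \<noteq> (0 :: 'a)"
      using nz[of "N + Suc k"] by (simp add: add_ac)
    have "of_nat (Suc k) * (3/2 + of_nat N + of_nat (Suc k)) * t (Suc N) (Suc k)
        = (of_nat (Suc k) * of_nat (Suc N choose Suc k)) * pochhammer (1/2) (Suc k) / pochhammer (3/2 + of_nat (Suc N)) k"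
      unfolding t_def q using nz' by (simp add: mult_ac del: of_nat_Suc binomial_Suc_Suc)
    then show ?thesis unfolding b t_def by (simp add: pochhammer_Suc mult_ac)
  qed
qed

lemma pochhammer_of_nat_div_neq_0:
  assumes "r > 0" "s > 0"
  shows "pochhammer (of_nat r / of_nat s) k \<noteq> (0 :: 'a::field_char_0)"
proof
  assume "pochhammer (of_nat r / of_nat s) k = (0 :: 'a)"
  then obtain i where "of_nat r / of_nat s = (- of_nat i :: 'a)"
    by (auto simp: pochhammer_eq_0_iff)
  then have "(of_nat (r + i * s) :: 'a) = 0"
    using assms by (simp add: field_simps add_eq_0_iff)
  then show False using assms by (subst (asm) of_nat_eq_0_iff) simp
qed

text \<open>Kummer's theorem for 2F1(a, b; 1 + a - b; -1) with a = 1/2 and b = -N.\<close>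

lemma sum_kummer:
  "(\<Sum>k\<le>N. of_nat (N choose k) * pochhammer (1/2) k / pochhammer (3/2 + of_nat N) k)
     = pochhammer (3/2) N / (pochhammer (5/4) N :: 'a::field_char_0)"
proof (induction N)
  case (Suc N)
  define t where "t = (\<lambda>N k. of_nat (N choose k) * pochhammer (1/2) k / pochhammer (3/2 + of_nat N) k :: 'a)"
  define z :: 'a where "z = of_nat N"
  \<comment> \<open>Certificate of the first-order recurrence in \<open>N\<close>; zero at 0 and,
    through the binomial coefficient, beyond \<open>Suc N\<close>.\<close>
  define G where "G k = of_nat k * (3/2 + z + of_nat k) * t (Suc N) k" for k
  have z1: "z + 1 \<noteq> 0" unfolding z_def using of_nat_neq_0[of N, where ?'a = 'a] by (simp add: add.commute)
  have z2: "2 * (z + 1) \<noteq> 0" using z1 by (metis mult_eq_0_iff zero_neq_numeral)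
  have "2 * (z + 1) * ((5/4 + z) * (\<Sum>k\<le>Suc N. t (Suc N) k) - (3/2 + z) * (\<Sum>k\<le>Suc N. t N k))
      = (\<Sum>k\<le>Suc N. 2 * (z + 1) * (5/4 + z) * t (Suc N) k - 2 * ((z + 1) * (3/2 + z) * t N k))"
    by (simp only: sum_subtractf sum_distrib_left) (simp add: algebra_simps sum_distrib_left sum.distrib)
  also have "\<dots> = (\<Sum>k\<le>Suc N. - (G (Suc k) - G k))"
  proof (rule sum.cong[OF refl])
    fix k
    have f1: "(z + 1) * (3/2 + z) * t N k = (z + 1 - of_nat k) * (3/2 + z + of_nat k) * t (Suc N) k"
      using well_poised_ratio(1)[where ?'a = 'a, of N k] unfolding z_def t_def by blast
    have f2: "G (Suc k) = (z + 1 - of_nat k) * (1/2 + of_nat k) * t (Suc N) k"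
      using well_poised_ratio(2)[where ?'a = 'a, of k N] unfolding z_def t_def G_def by blast
    show "2 * (z + 1) * (5/4 + z) * t (Suc N) k - 2 * ((z + 1) * (3/2 + z) * t N k) = - (G (Suc k) - G k)"
      unfolding f1 f2 unfolding G_def by (simp add: field_simps)
  qed
  also have "\<dots> = 0"
    unfolding sum_negf by (subst sum_atMost_telescope) (simp add: G_def t_def binomial_eq_0)
  finally have "(5/4 + z) * (\<Sum>k\<le>Suc N. t (Suc N) k) - (3/2 + z) * (\<Sum>k\<le>Suc N. t N k) = 0"
    using z2 mult_eq_0_iff by blast
  then have "(5/4 + z) * (\<Sum>k\<le>Suc N. t (Suc N) k) = (3/2 + z) * (\<Sum>k\<le>Suc N. t N k)"
    by (simp only: right_minus_eq)
  also have "(\<Sum>k\<le>Suc N. t N k) = (\<Sum>k\<le>N. t N k)"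
    by (simp add: t_def binomial_eq_0)
  also have "\<dots> = pochhammer (3/2) N / pochhammer (5/4) N"
    using Suc.IH by (simp add: t_def)
  finally have e: "(5/4 + z) * (\<Sum>k\<le>Suc N. t (Suc N) k) = (3/2 + z) * (pochhammer (3/2) N / pochhammer (5/4) N)" .
  have nz: "pochhammer (5/4) (Suc N) \<noteq> (0 :: 'a)"
    using pochhammer_of_nat_div_neq_0[of 5 4 "Suc N"] by simp
  then have nz': "5/4 + z \<noteq> 0"
    by (auto simp: pochhammer_Suc z_def)
  from e have "(\<Sum>k\<le>Suc N. t (Suc N) k) * (5/4 + z) = (3/2 + z) * (pochhammer (3/2) N / pochhammer (5/4) N)"
    by (subst mult.commute)
  with nz' have "(\<Sum>k\<le>Suc N. t (Suc N) k) = (3/2 + z) * (pochhammer (3/2) N / pochhammer (5/4) N) / (5/4 + z)"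
    by (rule nonzero_eq_divide_eq[THEN iffD2])
  then have "(\<Sum>k\<le>Suc N. t (Suc N) k) = pochhammer (3/2) (Suc N) / pochhammer (5/4) (Suc N)"
    by (simp only: pochhammer_Suc z_def) simp
  then show ?case by (simp only: t_def)
qed simp

text \<open>The very well-poised companion of Kummer's sum with a = 1/2: the weight 4 k + 1 is the
  quotient of the Pochhammer symbols of 1 + a/2 and a/2.\<close>

lemma sum_very_well_poised:
  "(\<Sum>k\<le>N. (4 * of_nat k + 1) * of_nat (N choose k) * pochhammer (1/2) k / pochhammer (3/2 + of_nat N) k)
     = pochhammer (3/2) N / (pochhammer (3/4) N :: 'a::field_char_0)"
proof (induction N)
  case (Suc N)
  define t where "t = (\<lambda>N k. of_nat (N choose k) * pochhammer (1/2) k / pochhammer (3/2 + of_nat N) k :: 'a)"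
  define z :: 'a where "z = of_nat N"
  \<comment> \<open>The certificate of Kummer's sum times the linear factor 1/2 - 2 k.\<close>
  define G where "G k = (1/2 - 2 * of_nat k) * (of_nat k * (3/2 + z + of_nat k) * t (Suc N) k)" for k
  have z2: "z + 1 \<noteq> 0" unfolding z_def using of_nat_neq_0[of N, where ?'a = 'a] by (simp add: add.commute)
  have "(z + 1) * ((3/4 + z) * (\<Sum>k\<le>Suc N. (4 * of_nat k + 1) * t (Suc N) k) - (3/2 + z) * (\<Sum>k\<le>Suc N. (4 * of_nat k + 1) * t N k))
      = (\<Sum>k\<le>Suc N. (4 * of_nat k + 1) * ((z + 1) * (3/4 + z) * t (Suc N) k - (z + 1) * (3/2 + z) * t N k))"
    by (simp only: sum_subtractf sum_distrib_left right_diff_distrib) (simp add: mult_ac)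
  also have "\<dots> = (\<Sum>k\<le>Suc N. G (Suc k) - G k)"
  proof (rule sum.cong[OF refl])
    fix k
    have f1: "(z + 1) * (3/2 + z) * t N k = (z + 1 - of_nat k) * (3/2 + z + of_nat k) * t (Suc N) k"
      using well_poised_ratio(1)[where ?'a = 'a, of N k] unfolding z_def t_def by blast
    have f2: "G (Suc k) = (1/2 - 2 * of_nat (Suc k)) * ((z + 1 - of_nat k) * (1/2 + of_nat k) * t (Suc N) k)"
      using well_poised_ratio(2)[where ?'a = 'a, of k N] unfolding z_def t_def G_def by (rule arg_cong)
    show "(4 * of_nat k + 1) * ((z + 1) * (3/4 + z) * t (Suc N) k - (z + 1) * (3/2 + z) * t N k) = G (Suc k) - G k"
      unfolding f1 f2 unfolding G_def by (simp add: field_simps)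
  qed
  also have "\<dots> = 0"
    by (subst sum_atMost_telescope) (simp add: G_def t_def binomial_eq_0)
  finally have "(3/4 + z) * (\<Sum>k\<le>Suc N. (4 * of_nat k + 1) * t (Suc N) k) - (3/2 + z) * (\<Sum>k\<le>Suc N. (4 * of_nat k + 1) * t N k) = 0"
    using z2 mult_eq_0_iff by blast
  then have "(3/4 + z) * (\<Sum>k\<le>Suc N. (4 * of_nat k + 1) * t (Suc N) k) = (3/2 + z) * (\<Sum>k\<le>Suc N. (4 * of_nat k + 1) * t N k)"
    by (simp only: right_minus_eq)
  also have "(\<Sum>k\<le>Suc N. (4 * of_nat k + 1) * t N k) = (\<Sum>k\<le>N. (4 * of_nat k + 1) * t N k)"
    by (simp add: t_def binomial_eq_0)
  also have "\<dots> = pochhammer (3/2) N / pochhammer (3/4) N"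
    using Suc.IH by (simp add: t_def mult.assoc)
  finally have e: "(3/4 + z) * (\<Sum>k\<le>Suc N. (4 * of_nat k + 1) * t (Suc N) k) = (3/2 + z) * (pochhammer (3/2) N / pochhammer (3/4) N)" .
  have nz: "pochhammer (3/4) (Suc N) \<noteq> (0 :: 'a)"
    using pochhammer_of_nat_div_neq_0[of 3 4 "Suc N"] by simp
  then have nz': "3/4 + z \<noteq> 0"
    by (auto simp: pochhammer_Suc z_def)
  from e have "(\<Sum>k\<le>Suc N. (4 * of_nat k + 1) * t (Suc N) k) * (3/4 + z) = (3/2 + z) * (pochhammer (3/2) N / pochhammer (3/4) N)"
    by (subst mult.commute)
  with nz' have "(\<Sum>k\<le>Suc N. (4 * of_nat k + 1) * t (Suc N) k) = (3/2 + z) * (pochhammer (3/2) N / pochhammer (3/4) N) / (3/4 + z)"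
    by (rule nonzero_eq_divide_eq[THEN iffD2])
  then have "(\<Sum>k\<le>Suc N. (4 * of_nat k + 1) * t (Suc N) k) = pochhammer (3/2) (Suc N) / pochhammer (3/4) (Suc N)"
    by (simp only: pochhammer_Suc z_def) simp
  then show ?case by (simp only: t_def) (simp add: mult.assoc)
qed simp

section \<open>From well-poised sums to alternating sums of squares\<close>

text \<open>Interpolation at N = -1/2: the polynomial C(N, k) (3/2 + N + k)_(n-k) has degree n in N
  and takes there the value C(-1/2, k) n!/k!. The proof shifts N by k so that Vandermonde's identity
  supplies Newton coefficients.\<close>

lemma alternating_binomial_choose_pochhammer:
  fixes n k :: nat
  assumes kn: "k \<le> n"
  shows "(\<Sum>N\<le>n. (-1)^N * of_nat (n choose N) * of_nat (N choose k)
            * pochhammer (3/2 + of_nat N + of_nat k) (n - k) / (1/2 + of_nat N))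
       = (-1)^k * (fact n)^2 * pochhammer (1/2) k / (pochhammer (1/2) (Suc n) * (fact k)^2 :: 'a::field_char_0)"
proof -
  let ?c = "of_nat k + of_nat n + 1/2 :: 'a"
  have nz: "pochhammer (1/2 + of_nat k :: 'a) (Suc (n - k)) \<noteq> 0"
    using pochhammer_of_nat_div_neq_0[of "1 + 2 * k" 2 "Suc (n - k)", where ?'a = 'a] by (simp add: add_divide_distrib)
  have p: "pochhammer (3/2 + of_nat (l + k) + of_nat k) (n - k) = fact (n - k) * ((of_nat l + ?c) gchoose (n - k))" for l
    using kn by (simp add: gbinomial_pochhammer' of_nat_diff algebra_simps)
  have "(\<Sum>N\<le>n. (-1)^N * of_nat (n choose N) * of_nat (N choose k)
            * pochhammer (3/2 + of_nat N + of_nat k) (n - k) / (1/2 + of_nat N))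
      = (\<Sum>N\<in>{k..n}. (-1)^N * of_nat (n choose N) * of_nat (N choose k)
            * pochhammer (3/2 + of_nat N + of_nat k) (n - k) / (1/2 + of_nat N :: 'a))"
    by (rule sum.mono_neutral_right) (auto simp: binomial_eq_0)
  also have "\<dots> = (\<Sum>l\<le>n - k. (-1)^(l + k) * of_nat (n choose (l + k)) * of_nat ((l + k) choose k)
            * pochhammer (3/2 + of_nat (l + k) + of_nat k) (n - k) / (1/2 + of_nat (l + k)))"
    using kn by (intro sum.reindex_bij_witness[of _ "\<lambda>l. l + k" "\<lambda>i. i - k"]) auto
  also have "\<dots> = (\<Sum>l\<le>n - k. (-1)^k * of_nat (n choose k) * fact (n - k) * ((-1)^l * of_nat ((n - k) choose l)
            * (\<Sum>j\<le>n - k. (?c gchoose (n - k - j)) * of_nat (l choose j)) / (1/2 + of_nat k + of_nat l)))"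
  proof (rule sum.cong[OF refl])
    fix l assume "l \<in> {..n - k}"
    then have "(n choose (l + k)) * ((l + k) choose k) = (n choose k) * ((n - k) choose l)"
      using choose_mult[of k "l + k" n] kn by simp
    then have c: "(of_nat (n choose (l + k)) * of_nat ((l + k) choose k) :: 'a) = of_nat (n choose k) * of_nat ((n - k) choose l)"
      by (metis of_nat_mult)
    have "(-1)^(l + k) * of_nat (n choose (l + k)) * of_nat ((l + k) choose k)
            * pochhammer (3/2 + of_nat (l + k) + of_nat k) (n - k) / (1/2 + of_nat (l + k))
       = (-1)^k * ((-1)^l * (of_nat (n choose (l + k)) * of_nat ((l + k) choose k))
            * (fact (n - k) * ((of_nat l + ?c) gchoose (n - k))) / (1/2 + of_nat k + of_nat l))"
      unfolding p by (simp add: power_add algebra_simps)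
    also have "(of_nat l + ?c) gchoose (n - k) = (\<Sum>j\<le>n - k. (?c gchoose (n - k - j)) * of_nat (l choose j))"
      by (subst gbinomial_add_of_nat[OF order_refl]) (simp add: mult.commute)
    finally show "(-1)^(l + k) * of_nat (n choose (l + k)) * of_nat ((l + k) choose k)
            * pochhammer (3/2 + of_nat (l + k) + of_nat k) (n - k) / (1/2 + of_nat (l + k))
       = (-1)^k * of_nat (n choose k) * fact (n - k) * ((-1)^l * of_nat ((n - k) choose l)
            * (\<Sum>j\<le>n - k. (?c gchoose (n - k - j)) * of_nat (l choose j)) / (1/2 + of_nat k + of_nat l))"
      unfolding c by (simp only: mult_ac times_divide_eq_right)
  qed
  also have "\<dots> = (-1)^k * of_nat (n choose k) * fact (n - k) * (fact (n - k) / pochhammer (1/2 + of_nat k) (Suc (n - k))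
            * (\<Sum>j\<le>n - k. (?c gchoose (n - k - j)) * (- (1/2 + of_nat k) gchoose j)))"
    unfolding sum_distrib_left[symmetric] by (subst alternating_binomial_newton_reciprocal[OF nz]) simp
  also have "(\<Sum>j\<le>n - k. (?c gchoose (n - k - j)) * (- (1/2 + of_nat k) gchoose j)) = (- (1/2 + of_nat k) + ?c) gchoose (n - k)"
    using gbinomial_Vandermonde[of "- (1/2 + of_nat k)" ?c "n - k"] by (simp add: atLeast0AtMost mult.commute)
  also have "\<dots> = of_nat (n choose (n - k))"
    by (simp add: binomial_gbinomial)
  also have "pochhammer (1/2) (Suc n) = pochhammer (1/2) k * pochhammer (1/2 + of_nat k :: 'a) (Suc (n - k))"
    using pochhammer_product[of k "Suc n" "1/2 :: 'a"] kn by (simp add: Suc_diff_le)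
  ultimately show ?thesis
    using kn nz pochhammer_of_nat_div_neq_0[of 1 2 k, where ?'a = 'a]
    by (simp add: binomial_fact field_simps power2_eq_square)
qed

text \<open>The factor (3/2 + N)_n clears the denominators of \<open>Z N\<close> and leaves a
  polynomial in N of degree n. Its value at N = -1/2 turns each C(N, k) into (-1)^k
  \<open>half_choose k\<close>, which squares the factor already present. A closed form of
  \<open>Z\<close> therefore transforms the alternating sum of squares.\<close>

lemma alternating_binomial_sum_of_choose_sums:
  fixes w :: "nat \<Rightarrow> 'a::field_char_0"
  assumes Z: "\<And>N. Z N = (\<Sum>k\<le>N. w k * of_nat (N choose k) * pochhammer (1/2) k / pochhammer (3/2 + of_nat N) k)"
  shows "(\<Sum>N\<le>n. (-1)^N * of_nat (n choose N) * (pochhammer (3/2 + of_nat N) n * Z N) / (1/2 + of_nat N))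
       = (fact n)^2 / pochhammer (1/2) (Suc n) * (\<Sum>k\<le>n. w k * (-1)^k * (half_choose k)^2)"
proof -
  have pz: "pochhammer (3/2 + of_nat N :: 'a) j \<noteq> 0" for N j
    using pochhammer_of_nat_div_neq_0[of "3 + 2 * N" 2 j, where ?'a = 'a] by (simp add: add_divide_distrib)
  have Z': "pochhammer (3/2 + of_nat N) n * Z N
      = (\<Sum>k\<le>n. w k * pochhammer (1/2) k * (of_nat (N choose k) * pochhammer (3/2 + of_nat N + of_nat k) (n - k)))"
    if "N \<le> n" for N
  proof -
    have "Z N = (\<Sum>k\<le>n. w k * of_nat (N choose k) * pochhammer (1/2) k / pochhammer (3/2 + of_nat N) k)"
      unfolding Z using that by (intro sum.mono_neutral_left) (auto simp: binomial_eq_0)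
    then show ?thesis
      unfolding sum_distrib_left
    proof (simp only: sum_distrib_left, intro sum.cong refl)
      fix k assume "k \<in> {..n}"
      then have "pochhammer (3/2 + of_nat N :: 'a) n = pochhammer (3/2 + of_nat N) k * pochhammer (3/2 + of_nat N + of_nat k) (n - k)"
        by (intro pochhammer_product) simp
      then show "pochhammer (3/2 + of_nat N) n * (w k * of_nat (N choose k) * pochhammer (1/2) k / pochhammer (3/2 + of_nat N) k)
        = w k * pochhammer (1/2) k * (of_nat (N choose k) * pochhammer (3/2 + of_nat N + of_nat k) (n - k))"
        using pz[of N k] by simp
    qed
  qed
  have "(\<Sum>N\<le>n. (-1)^N * of_nat (n choose N) * (pochhammer (3/2 + of_nat N) n * Z N) / (1/2 + of_nat N))
      = (\<Sum>N\<le>n. \<Sum>k\<le>n. w k * pochhammer (1/2) k * ((-1)^N * of_nat (n choose N) * of_nat (N choose k)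
            * pochhammer (3/2 + of_nat N + of_nat k) (n - k) / (1/2 + of_nat N)))"
  proof (rule sum.cong[OF refl])
    fix N assume "N \<in> {..n}"
    then show "(-1)^N * of_nat (n choose N) * (pochhammer (3/2 + of_nat N) n * Z N) / (1/2 + of_nat N)
      = (\<Sum>k\<le>n. w k * pochhammer (1/2) k * ((-1)^N * of_nat (n choose N) * of_nat (N choose k)
            * pochhammer (3/2 + of_nat N + of_nat k) (n - k) / (1/2 + of_nat N)))"
      by (subst Z') (auto simp: sum_distrib_left sum_divide_distrib mult_ac intro!: sum.cong)
  qed
  also have "\<dots> = (\<Sum>k\<le>n. w k * pochhammer (1/2) k * (\<Sum>N\<le>n. (-1)^N * of_nat (n choose N) * of_nat (N choose k)
            * pochhammer (3/2 + of_nat N + of_nat k) (n - k) / (1/2 + of_nat N)))"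
    by (subst sum.swap) (simp only: sum_distrib_left)
  also have "\<dots> = (\<Sum>k\<le>n. w k * pochhammer (1/2) k * ((-1)^k * (fact n)^2 * pochhammer (1/2) k / (pochhammer (1/2) (Suc n) * (fact k)^2)))"
    by (intro sum.cong refl) (subst alternating_binomial_choose_pochhammer, auto)
  also have "\<dots> = (fact n)^2 / pochhammer (1/2) (Suc n) * (\<Sum>k\<le>n. w k * (-1)^k * (half_choose k)^2)"
    unfolding sum_distrib_left by (intro sum.cong refl) (simp add: half_choose_eq_pochhammer power_divide power2_eq_square)
  finally show ?thesis .
qed

text \<open>Reversing the order of summation makes the leading term the only one of order \<open>p\<^sup>0\<close> (here \<open>2 n + 1 = p\<close>).\<close>

lemma sum_alternating_half_choose:
  fixes y :: "'a::field_char_0"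
  assumes Z: "\<And>N. (\<Sum>k\<le>N. w k * of_nat (N choose k) * pochhammer (1/2) k / pochhammer (3/2 + of_nat N) k)
                  = pochhammer (3/2) N / pochhammer y N"
    and y: "\<And>k. pochhammer y k \<noteq> 0"
  shows "(\<Sum>k\<le>n. w k * (-1)^k * (half_choose k)^2)
     = (-1)^n * pochhammer (1/2) (Suc n) / (fact n)^2 * pochhammer (3/2) (2 * n) / (pochhammer y n * (of_nat n + 1/2))
       * (\<Sum>i\<le>n. (-1)^i * of_nat (n choose i) * pochhammer (1 - y - of_nat n) i / pochhammer (- 1/2 - 2 * of_nat n) i
              * ((of_nat n + 1/2) / (of_nat n + 1/2 - of_nat i)))"
proof -
  have hz: "pochhammer (1/2) (Suc n) \<noteq> (0 :: 'a)"
    using pochhammer_of_nat_div_neq_0[of 1 2 "Suc n", where ?'a = 'a] by simp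
  have nn: "(of_nat n + 1/2 :: 'a) \<noteq> 0" for n
  proof
    assume "(of_nat n + 1/2 :: 'a) = 0"
    then have "(of_nat (2 * n + 1) :: 'a) = 0" by (simp add: field_simps)
    then show False by (subst (asm) of_nat_eq_0_iff) simp
  qed
  have rev: "pochhammer z (m - i) * pochhammer (1 - z - of_nat m) i = (-1)^i * pochhammer z m" if "i \<le> m" for z :: 'a and m i
  proof -
    have "pochhammer z m = pochhammer z (m - i) * pochhammer (z + of_nat (m - i)) i"
      using pochhammer_product[of "m - i" m z] that by simp
    moreover have "pochhammer (z + of_nat (m - i)) i = (-1)^i * pochhammer (1 - z - of_nat m) i"
      using pochhammer_minus[of "- (1 - z - of_nat m)" i] that by (simp add: of_nat_diff algebra_simps)
    ultimately show ?thesis by simp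
  qed
  have t3: "pochhammer (3/2 :: 'a) m \<noteq> 0" for m
    using pochhammer_of_nat_div_neq_0[of 3 2 m, where ?'a = 'a] by simp
  have "(fact n)^2 / pochhammer (1/2) (Suc n) * (\<Sum>k\<le>n. w k * (-1)^k * (half_choose k)^2)
      = (\<Sum>N\<le>n. (-1)^N * of_nat (n choose N) * (pochhammer (3/2 + of_nat N) n * (pochhammer (3/2) N / pochhammer y N)) / (1/2 + of_nat N))"
    by (rule alternating_binomial_sum_of_choose_sums[symmetric]) (simp add: Z)
  also have "\<dots> = (\<Sum>i\<le>n. (-1)^(n - i) * of_nat (n choose (n - i)) * (pochhammer (3/2 + of_nat (n - i)) n * (pochhammer (3/2) (n - i) / pochhammer y (n - i))) / (1/2 + of_nat (n - i)))"
    by (rule sum.reindex_bij_witness[of _ "\<lambda>j. n - j" "\<lambda>j. n - j"]) auto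
  also have "\<dots> = (\<Sum>i\<le>n. (-1)^n * pochhammer (3/2) (2 * n) / (pochhammer y n * (of_nat n + 1/2)) * ((-1)^i * of_nat (n choose i) * pochhammer (1 - y - of_nat n) i / pochhammer (- 1/2 - 2 * of_nat n) i
              * ((of_nat n + 1/2) / (of_nat n + 1/2 - of_nat i))))"
  proof (rule sum.cong[OF refl])
    fix i assume "i \<in> {..n}"
    then have i: "i \<le> n" by simp
    have "pochhammer (3/2 + of_nat (n - i)) n * pochhammer (3/2) (n - i) = pochhammer (3/2 :: 'a) (2 * n - i)"
      using pochhammer_product[of "n - i" "2 * n - i" "3/2 :: 'a"] i by (simp add: mult.commute)
    moreover have r3: "pochhammer (3/2 :: 'a) (2 * n - i) * pochhammer (- 1/2 - 2 * of_nat n) i = (-1)^i * pochhammer (3/2) (2 * n)"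
      using rev[of i "2 * n" "3/2"] i by simp
    moreover have "pochhammer (- 1/2 - 2 * of_nat n :: 'a) i \<noteq> 0"
      using r3 t3[of "2 * n"] by auto
    ultimately have a: "pochhammer (3/2 + of_nat (n - i)) n * pochhammer (3/2) (n - i)
        = (-1)^i * pochhammer (3/2 :: 'a) (2 * n) / pochhammer (- 1/2 - 2 * of_nat n) i"
      by (simp add: field_simps)
    have b: "1 / pochhammer y (n - i) = (-1)^i * pochhammer (1 - y - of_nat n) i / pochhammer y n"
      using rev[of i n y] y[of "n - i"] y[of n] i by (simp add: field_simps)
    have c: "(1/2 + of_nat (n - i) :: 'a) = of_nat n + 1/2 - of_nat i"
      using i by (simp add: of_nat_diff)
    have s: "(-1 :: 'a)^(n - i) = (-1)^n * (-1)^i"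
      using i by (auto simp: minus_one_power_iff)
    have "(-1)^(n - i) * of_nat (n choose (n - i)) * (pochhammer (3/2 + of_nat (n - i)) n * (pochhammer (3/2) (n - i) / pochhammer y (n - i))) / (1/2 + of_nat (n - i))
       = (-1)^n * (-1)^i * of_nat (n choose i) * (pochhammer (3/2 + of_nat (n - i)) n * pochhammer (3/2) (n - i)) * (1 / pochhammer y (n - i)) / (1/2 + of_nat (n - i) :: 'a)"
      unfolding s using i by (simp add: binomial_symmetric[symmetric])
    also have "\<dots> = (-1)^n * pochhammer (3/2) (2 * n) / (pochhammer y n * (of_nat n + 1/2)) * ((-1)^i * of_nat (n choose i) * pochhammer (1 - y - of_nat n) i / pochhammer (- 1/2 - 2 * of_nat n) i
              * ((of_nat n + 1/2) / (of_nat n + 1/2 - of_nat i)))"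
      unfolding a b c using nn[of n] by (cases "even i") (simp_all add: mult_ac)
    finally show "(-1)^(n - i) * of_nat (n choose (n - i)) * (pochhammer (3/2 + of_nat (n - i)) n * (pochhammer (3/2) (n - i) / pochhammer y (n - i))) / (1/2 + of_nat (n - i))
      = (-1)^n * pochhammer (3/2) (2 * n) / (pochhammer y n * (of_nat n + 1/2)) * ((-1)^i * of_nat (n choose i) * pochhammer (1 - y - of_nat n) i / pochhammer (- 1/2 - 2 * of_nat n) i
              * ((of_nat n + 1/2) / (of_nat n + 1/2 - of_nat i)))" .
  qed
  finally have "pochhammer (1/2) (Suc n) / (fact n)^2 * ((fact n)^2 / pochhammer (1/2) (Suc n) * (\<Sum>k\<le>n. w k * (-1)^k * (half_choose k)^2))
     = pochhammer (1/2) (Suc n) / (fact n)^2 * ((-1)^n * pochhammer (3/2) (2 * n) / (pochhammer y n * (of_nat n + 1/2)) * (\<Sum>i\<le>n. (-1)^i * of_nat (n choose i) * pochhammer (1 - y - of_nat n) i / pochhammer (- 1/2 - 2 * of_nat n) i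
              * ((of_nat n + 1/2) / (of_nat n + 1/2 - of_nat i))))"
    by (simp only: sum_distrib_left)
  then show ?thesis using hz by simp
qed

section \<open>Congruences between \<open>p\<close>-integral rationals\<close>

locale p_adic =
  fixes p :: nat
  assumes prime_p: "prime p"
begin

definition pint :: "rat set" where
  "pint = {r. \<exists>a b. r = of_int a / of_int b \<and> coprime b (int p)}"

definition punit :: "rat set" where
  "punit = {r. r \<noteq> 0 \<and> r \<in> pint \<and> inverse r \<in> pint}"

abbreviation P :: rat where "P \<equiv> of_nat p"

text \<open>Phrased with a \<open>pint\<close> cofactor instead of \<open>quotient_of\<close>, so
  that the ring operations are immediate; \<open>rat_cong_pow_of_pcong\<close> translates the final
  result.\<close>

definition pcong :: "nat \<Rightarrow> rat \<Rightarrow> rat \<Rightarrow> bool" where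
  "pcong k a b \<longleftrightarrow> (\<exists>c\<in>pint. a - b = P ^ k * c)"

lemma not_coprime_0: "coprime b (int p) \<Longrightarrow> b \<noteq> 0"
  using prime_gt_1_nat[OF prime_p] by (auto simp: coprime_commute)

lemma pintI: "r = of_int a / of_int b \<Longrightarrow> coprime b (int p) \<Longrightarrow> r \<in> pint"
  by (auto simp: pint_def)

lemma pint_of_int [simp, intro]: "of_int a \<in> pint"
  by (rule pintI[of _ a 1]) auto

lemma pint_of_nat [simp, intro]: "of_nat a \<in> pint"
  using pint_of_int[of "int a"] by simp

lemma pint_numeral [simp, intro]: "numeral a \<in> pint" "0 \<in> pint" "1 \<in> pint"
  using pint_of_int[of "numeral a"] pint_of_int[of 0] pint_of_int[of 1] by auto

lemma pint_add [intro!]: "a \<in> pint \<Longrightarrow> b \<in> pint \<Longrightarrow> a + b \<in> pint"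
proof -
  assume "a \<in> pint" "b \<in> pint"
  then obtain x y u v where *: "a = of_int x / of_int y" "coprime y (int p)"
    "b = of_int u / of_int v" "coprime v (int p)" by (auto simp: pint_def)
  show ?thesis
    using * not_coprime_0[OF *(2)] not_coprime_0[OF *(4)]
    by (intro pintI[of _ "x * v + u * y" "y * v"]) (auto simp: field_simps)
qed

lemma pint_mult [intro!]: "a \<in> pint \<Longrightarrow> b \<in> pint \<Longrightarrow> a * b \<in> pint"
proof -
  assume "a \<in> pint" "b \<in> pint"
  then obtain x y u v where *: "a = of_int x / of_int y" "coprime y (int p)"
    "b = of_int u / of_int v" "coprime v (int p)" by (auto simp: pint_def)
  show ?thesis
    using * by (intro pintI[of _ "x * u" "y * v"]) auto
qed

lemma pint_minus [intro!]: "a \<in> pint \<Longrightarrow> - a \<in> pint"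
  using pint_mult[OF pint_of_int[of "- 1"], of a] by simp

lemma pint_diff [intro!]: "a \<in> pint \<Longrightarrow> b \<in> pint \<Longrightarrow> a - b \<in> pint"
  using pint_add[of a "- b"] by auto

lemma pint_power [intro!]: "a \<in> pint \<Longrightarrow> a ^ k \<in> pint"
  by (induction k) auto

lemma pint_sum [intro!]: "(\<And>i. i \<in> I \<Longrightarrow> f i \<in> pint) \<Longrightarrow> sum f I \<in> pint"
  by (induction I rule: infinite_finite_induct) auto

lemma pint_prod [intro!]: "(\<And>i. i \<in> I \<Longrightarrow> f i \<in> pint) \<Longrightarrow> prod f I \<in> pint"
  by (induction I rule: infinite_finite_induct) auto

lemma pint_divide [intro]: "a \<in> pint \<Longrightarrow> b \<in> punit \<Longrightarrow> a / b \<in> pint"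
  unfolding punit_def divide_inverse by auto

lemma punit_of_int: "\<not> int p dvd a \<Longrightarrow> of_int a \<in> punit"
proof -
  assume "\<not> int p dvd a"
  then have "coprime a (int p)"
    using prime_p prime_imp_coprime[of "int p" a] by (simp add: coprime_commute)
  then show ?thesis
    using not_coprime_0[of a] pintI[of "inverse (of_int a)" 1 a] by (auto simp: punit_def divide_inverse)
qed

lemma punit_of_nat: "\<not> p dvd a \<Longrightarrow> of_nat a \<in> punit"
  using punit_of_int[of "int a"] by simp

lemma punit_of_nat_less: "0 < a \<Longrightarrow> a < p \<Longrightarrow> of_nat a \<in> punit"
  by (rule punit_of_nat) (auto dest: dvd_imp_le)

lemma punit_1 [simp, intro]: "1 \<in> punit"
  by (auto simp: punit_def)

lemma punit_pint [intro]: "a \<in> punit \<Longrightarrow> a \<in> pint"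
  by (auto simp: punit_def)

lemma punit_nonzero: "a \<in> punit \<Longrightarrow> a \<noteq> 0"
  by (auto simp: punit_def)

lemma punit_mult [intro]: "a \<in> punit \<Longrightarrow> b \<in> punit \<Longrightarrow> a * b \<in> punit"
  by (auto simp: punit_def)

lemma punit_minus [intro]: "a \<in> punit \<Longrightarrow> - a \<in> punit"
  by (auto simp: punit_def)

lemma punit_divide [intro]: "a \<in> punit \<Longrightarrow> b \<in> punit \<Longrightarrow> a / b \<in> punit"
  unfolding divide_inverse by (auto simp: punit_def)

lemma punit_power [intro]: "a \<in> punit \<Longrightarrow> a ^ k \<in> punit"
  by (induction k) auto

lemma punit_prod [intro]: "(\<And>i. i \<in> I \<Longrightarrow> f i \<in> punit) \<Longrightarrow> prod f I \<in> punit"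
  by (induction I rule: infinite_finite_induct) auto

lemma P_nonzero: "P \<noteq> 0"
  using prime_gt_0_nat[OF prime_p] by simp

lemma pint_P [simp, intro]: "P \<in> pint" by (rule pint_of_nat)

lemma pcongI: "a = b + P ^ k * c \<Longrightarrow> c \<in> pint \<Longrightarrow> pcong k a b"
  by (auto simp: pcong_def)

lemma pcongE: "pcong k a b \<Longrightarrow> (\<And>c. c \<in> pint \<Longrightarrow> a = b + P ^ k * c \<Longrightarrow> thesis) \<Longrightarrow> thesis"
  by (force simp: pcong_def algebra_simps)

lemma pcong_refl [simp, intro]: "pcong k a a"
  by (rule pcongI[of _ _ _ 0]) auto

lemma pcong_sym: "pcong k a b \<Longrightarrow> pcong k b a"
  by (erule pcongE, rule pcongI[of _ _ _ "- _"]) auto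

lemma pcong_trans [trans]: "pcong k a b \<Longrightarrow> pcong k b c \<Longrightarrow> pcong k a c"
proof (elim pcongE)
  fix x y assume "x \<in> pint" "y \<in> pint" "a = b + P ^ k * x" "b = c + P ^ k * y"
  then show ?thesis by (intro pcongI[of _ _ _ "x + y"]) (auto simp: algebra_simps)
qed

lemma pcong_eq_trans [trans]: "pcong k a b \<Longrightarrow> b = c \<Longrightarrow> pcong k a c" by simp
lemma pcong_add: "pcong k a b \<Longrightarrow> pcong k c d \<Longrightarrow> pcong k (a + c) (b + d)"
proof (elim pcongE)
  fix x y assume "x \<in> pint" "y \<in> pint" "a = b + P ^ k * x" "c = d + P ^ k * y"
  then show ?thesis by (intro pcongI[of _ _ _ "x + y"]) (auto simp: algebra_simps)
qed

lemma pcong_cmult: "pcong k a b \<Longrightarrow> c \<in> pint \<Longrightarrow> pcong k (c * a) (c * b)"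
proof (elim pcongE)
  fix x assume "x \<in> pint" "c \<in> pint" "a = b + P ^ k * x"
  then show ?thesis by (intro pcongI[of _ _ _ "c * x"]) (auto simp: algebra_simps)
qed

lemma pcong_minus: "pcong k a b \<Longrightarrow> pcong k (- a) (- b)"
  using pcong_cmult[OF _ pint_of_int[of "- 1"], of k a b] by simp

lemma pcong_diff: "pcong k a b \<Longrightarrow> pcong k c d \<Longrightarrow> pcong k (a - c) (b - d)"
  using pcong_add[of k a b "- c" "- d"] pcong_minus by simp

lemma pcong_pint: "pcong k a b \<Longrightarrow> b \<in> pint \<Longrightarrow> a \<in> pint"
  by (erule pcongE) auto

lemma pcong_mult: "pcong k a b \<Longrightarrow> pcong k c d \<Longrightarrow> b \<in> pint \<Longrightarrow> d \<in> pint \<Longrightarrow> pcong k (a * c) (b * d)"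
proof -
  assume *: "pcong k a b" "pcong k c d" "b \<in> pint" "d \<in> pint"
  have "pcong k (c * a) (c * b)" using * by (intro pcong_cmult pcong_pint[OF *(2)])
  moreover have "pcong k (b * c) (b * d)" using * by (intro pcong_cmult)
  ultimately show ?thesis using pcong_trans by (simp add: mult.commute)
qed

lemma pcong_power: "pcong k a b \<Longrightarrow> b \<in> pint \<Longrightarrow> pcong k (a ^ m) (b ^ m)"
  by (induction m) (auto intro: pcong_mult)

lemma pcong_sum: "(\<And>i. i \<in> I \<Longrightarrow> pcong k (f i) (g i)) \<Longrightarrow> pcong k (sum f I) (sum g I)"
  by (induction I rule: infinite_finite_induct) (auto intro: pcong_add)

lemma pcong_prod: "(\<And>i. i \<in> I \<Longrightarrow> pcong k (f i) (g i)) \<Longrightarrow> (\<And>i. i \<in> I \<Longrightarrow> g i \<in> pint) \<Longrightarrow> pcong k (prod f I) (prod g I)"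
  by (induction I rule: infinite_finite_induct) (auto intro!: pcong_mult)

lemma pcong_weaken: "pcong k a b \<Longrightarrow> j \<le> k \<Longrightarrow> pcong j a b"
proof (elim pcongE)
  fix x assume "x \<in> pint" "a = b + P ^ k * x" "j \<le> k"
  then show ?thesis by (intro pcongI[of _ _ _ "P ^ (k - j) * x"]) (auto simp: mult.assoc[symmetric] simp flip: power_add)
qed

lemma pcong_P_mult: "pcong k a b \<Longrightarrow> pcong (k + j) (P ^ j * a) (P ^ j * b)"
proof (elim pcongE)
  fix x assume "x \<in> pint" "a = b + P ^ k * x"
  then show ?thesis by (intro pcongI[of _ _ _ x]) (auto simp: algebra_simps power_add)
qed

lemma pcong_P_cancel: "pcong (k + j) (P ^ j * a) (P ^ j * b) \<Longrightarrow> pcong k a b"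
proof (elim pcongE)
  fix x assume x: "x \<in> pint" "P ^ j * a = P ^ j * b + P ^ (k + j) * x"
  then have "P ^ j * a = P ^ j * (b + P ^ k * x)" by (simp add: algebra_simps power_add)
  then show ?thesis using x P_nonzero by (intro pcongI[of _ _ _ x]) auto
qed

lemma pcong_0_iff: "pcong k a b \<longleftrightarrow> pcong k (a - b) 0"
  by (auto simp: pcong_def)

text \<open>With at least one factor p available, a = b (1 + p u/v) with v prime to p, and the
  numerator v + p u is again prime to p.\<close>

lemma punit_pcong: "pcong (Suc k) a b \<Longrightarrow> b \<in> punit \<Longrightarrow> a \<in> punit"
proof (elim pcongE)
  fix x assume x: "x \<in> pint" "a = b + P ^ Suc k * x" "b \<in> punit"
  have "P ^ k * x / b \<in> pint" using x by auto
  then obtain u v where uv: "P ^ k * x / b = of_int u / of_int v" "coprime v (int p)" by (auto simp: pint_def)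
  have v0: "v \<noteq> 0" using not_coprime_0 uv by simp
  have "a = b * (1 + P * (P ^ k * x / b))" using x punit_nonzero[OF x(3)] by (simp add: field_simps)
  also have "1 + P * (P ^ k * x / b) = of_int (v + int p * u) / of_int v"
    unfolding uv using v0 by (simp add: field_simps)
  finally have eq: "a = b * (of_int (v + int p * u) / of_int v)" .
  have "\<not> int p dvd v"
    using uv(2) prime_gt_1_nat[OF prime_p] coprime_common_divisor[of v "int p" "int p"] by auto
  then have "of_int (v + int p * u) \<in> punit" "of_int v \<in> punit"
    by (intro punit_of_int; simp add: dvd_add_left_iff)+
  then show ?thesis unfolding eq using x(3) by (intro punit_mult punit_divide)
qed

lemma pcong_divide: "pcong k a b \<Longrightarrow> c \<in> punit \<Longrightarrow> pcong k (a / c) (b / c)"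
  using pcong_cmult[of k a b "1 / c"] by (auto simp: punit_def divide_inverse mult.commute)

lemma pcong_cancel: "pcong k (c * a) (c * b) \<Longrightarrow> c \<in> punit \<Longrightarrow> pcong k a b"
  using pcong_divide[of k "c * a" "c * b" c] punit_nonzero[of c] by simp

lemma pcong_inverse: "pcong k a b \<Longrightarrow> a \<in> punit \<Longrightarrow> b \<in> punit \<Longrightarrow> pcong k (1 / a) (1 / b)"
proof -
  assume *: "pcong k a b" "a \<in> punit" "b \<in> punit"
  have "pcong k (b / (a * b)) (a / (a * b))"
    using pcong_sym[OF *(1)] * by (intro pcong_divide) auto
  then show ?thesis using punit_nonzero * by simp
qed

text \<open>\<open>tri x a b c\<close> records the first three digits (with coefficients in \<open>pint\<close>) of a \<open>p\<close>-adic expansion of \<open>x\<close>.\<close>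

definition tri :: "rat \<Rightarrow> rat \<Rightarrow> rat \<Rightarrow> rat \<Rightarrow> bool" where
  "tri x a b c \<longleftrightarrow> a \<in> pint \<and> b \<in> pint \<and> c \<in> pint \<and> pcong 3 x (a + b * P + c * P\<^sup>2)"

lemma tri_const: "a \<in> pint \<Longrightarrow> tri a a 0 0"
  by (auto simp: tri_def)

lemma triI: "x = a + b * P + c * P\<^sup>2 \<Longrightarrow> a \<in> pint \<Longrightarrow> b \<in> pint \<Longrightarrow> c \<in> pint \<Longrightarrow> tri x a b c"
  by (auto simp: tri_def)

lemma tri_add: "tri x a b c \<Longrightarrow> tri y d e f \<Longrightarrow> tri (x + y) (a + d) (b + e) (c + f)"
  unfolding tri_def
proof (elim conjE, intro conjI)
  assume "pcong 3 x (a + b * P + c * P\<^sup>2)" "pcong 3 y (d + e * P + f * P\<^sup>2)"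
  from pcong_add[OF this] show "pcong 3 (x + y) (a + d + (b + e) * P + (c + f) * P\<^sup>2)"
    by (simp add: algebra_simps)
qed auto

lemma tri_mult: "tri x a b c \<Longrightarrow> tri y d e f \<Longrightarrow> tri (x * y) (a * d) (a * e + b * d) (a * f + b * e + c * d)"
proof -
  assume 1: "tri x a b c" and 2: "tri y d e f"
  have i: "a \<in> pint" "b \<in> pint" "c \<in> pint" "d \<in> pint" "e \<in> pint" "f \<in> pint"
    using 1 2 by (auto simp: tri_def)
  have "pcong 3 (x * y) ((a + b * P + c * P\<^sup>2) * (d + e * P + f * P\<^sup>2))"
    using 1 2 i by (intro pcong_mult) (auto simp: tri_def)
  also have "pcong 3 ((a + b * P + c * P\<^sup>2) * (d + e * P + f * P\<^sup>2))
     (a * d + (a * e + b * d) * P + (a * f + b * e + c * d) * P\<^sup>2)"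
    using i by (intro pcongI[of _ _ _ "b * f + c * e + c * f * P"]) (auto simp: algebra_simps power2_eq_square power3_eq_cube)
  finally show ?thesis using i by (auto simp: tri_def)
qed

lemma tri_cmult: "k \<in> pint \<Longrightarrow> tri x a b c \<Longrightarrow> tri (k * x) (k * a) (k * b) (k * c)"
  using tri_mult[OF tri_const[of k]] by simp

lemma tri_minus: "tri x a b c \<Longrightarrow> tri (- x) (- a) (- b) (- c)"
  using tri_cmult[OF pint_of_int[of "- 1"], of x a b c] by simp

lemma tri_diff: "tri x a b c \<Longrightarrow> tri y d e f \<Longrightarrow> tri (x - y) (a - d) (b - e) (c - f)"
  using tri_add[OF _ tri_minus] by fastforce

text \<open>The third digit matters only modulo p, since it is multiplied by p^2.\<close>

lemma tri_adjust: "tri x a b c \<Longrightarrow> pcong 1 c c' \<Longrightarrow> c' \<in> pint \<Longrightarrow> tri x a b c'"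
proof -
  assume 1: "tri x a b c" and c: "pcong 1 c c'" "c' \<in> pint"
  have "pcong 3 (P\<^sup>2 * c) (P\<^sup>2 * c')" using pcong_P_mult[OF c(1), of 2] by (simp add: eval_nat_numeral)
  then have "pcong 3 (a + b * P + c * P\<^sup>2) (a + b * P + c' * P\<^sup>2)"
    by (intro pcong_add) (auto simp: mult.commute)
  then show ?thesis using 1 c pcong_trans by (auto simp: tri_def)
qed

lemma tri_pcong: "tri x a b c \<Longrightarrow> pcong 3 y x \<Longrightarrow> tri y a b c"
  unfolding tri_def by (blast intro: pcong_trans)

lemma tri_P_mult: "x \<in> pint \<Longrightarrow> pcong 2 x (a + b * P) \<Longrightarrow> a \<in> pint \<Longrightarrow> b \<in> pint \<Longrightarrow> tri (P * x) 0 a b"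
  using pcong_P_mult[of 2 x "a + b * P" 1] by (auto simp: tri_def algebra_simps power2_eq_square eval_nat_numeral)

lemma tri_pcong_1: "tri x a b c \<Longrightarrow> pcong 1 x a"
proof -
  assume 1: "tri x a b c"
  have "pcong 1 (a + b * P + c * P\<^sup>2) a"
    using 1 by (intro pcongI[of _ _ _ "b + c * P"]) (auto simp: tri_def algebra_simps power2_eq_square)
  then show ?thesis using 1 pcong_weaken[of 3 _ _ 1] pcong_trans unfolding tri_def by (metis one_le_numeral)
qed

lemma tri_pcong_2: "tri x a b c \<Longrightarrow> pcong 2 x (a + b * P)"
proof -
  assume 1: "tri x a b c"
  have "pcong 2 (a + b * P + c * P\<^sup>2) (a + b * P)"
    using 1 by (intro pcongI[of _ _ _ "c"]) (auto simp: tri_def algebra_simps)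
  then show ?thesis using 1 pcong_weaken[of 3 _ _ 2] pcong_trans unfolding tri_def by (metis numeral_le_iff semiring_norm(69,72) order_refl eval_nat_numeral(3) le_Suc_eq)
qed

lemma tri_inverse:
  assumes 1: "tri x 1 b c"
  shows "tri (1 / x) 1 (- b) (b\<^sup>2 - c)"
proof -
  have i: "b \<in> pint" "c \<in> pint" using 1 by (auto simp: tri_def)
  have u: "x \<in> punit" using tri_pcong_1[OF 1] punit_pcong[of 0] by auto
  have t: "tri (1 - b * P + (b\<^sup>2 - c) * P\<^sup>2) 1 (- b) (b\<^sup>2 - c)"
    using i by (intro triI) auto
  have "pcong 3 (x * (1 - b * P + (b\<^sup>2 - c) * P\<^sup>2)) 1"
    using tri_mult[OF 1 t] by (simp add: tri_def power2_eq_square)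
  then have "pcong 3 (x * (1 / x)) (x * (1 - b * P + (b\<^sup>2 - c) * P\<^sup>2))"
    using punit_nonzero[OF u] pcong_sym by simp
  then show ?thesis using pcong_cancel[OF _ u] tri_pcong[OF t] by blast
qed

text \<open>The third digit is the second elementary symmetric function, written through power sums
  because those are what reflection arguments control.\<close>

lemma tri_prod:
  assumes "finite I" "\<And>i. i \<in> I \<Longrightarrow> f i \<in> pint" and two: "2 \<in> punit"
  shows "tri (\<Prod>i\<in>I. 1 + P * f i) 1 (\<Sum>i\<in>I. f i) (((\<Sum>i\<in>I. f i)\<^sup>2 - (\<Sum>i\<in>I. (f i)\<^sup>2)) / 2)"
  using assms(1,2)
proof (induction I rule: finite_induct)
  case empty
  then show ?case by (auto intro: tri_const)
next
  case (insert i I)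
  have "tri (1 + P * f i) 1 (f i) 0" using insert.prems by (intro triI) auto
  from tri_mult[OF this insert.IH] insert.prems insert.hyps show ?case
    by (simp add: field_simps power2_eq_square)
qed

end

section \<open>Harmonic numbers and powers of two\<close>

locale quarter_prime = p_adic +
  fixes M n :: nat
  assumes p_eq: "p = 4 * M + 1" and n_eq: "n = 2 * M"
begin

definition H :: rat where "H = (\<Sum>i=1..n. 1 / of_nat i)"
definition K :: rat where "K = (\<Sum>i=1..M. 1 / of_nat i)"
definition e :: rat where "e = (\<Sum>i=1..M. 1 / (of_nat i)\<^sup>2)"

lemma M_pos: "M > 0"
  using prime_gt_1_nat[OF prime_p] p_eq by auto

lemma p_eq_n: "p = 2 * n + 1" by (simp add: p_eq n_eq)

lemma P_eq: "P = 4 * of_nat M + 1" "P = 2 * of_nat n + 1"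
  using p_eq p_eq_n by simp_all

lemma punit_small: "0 < a \<Longrightarrow> a \<le> 4 * M \<Longrightarrow> of_nat a \<in> punit"
  by (rule punit_of_nat_less) (auto simp: p_eq)

lemma punit_2 [simp, intro]: "2 \<in> punit" and punit_3 [simp, intro]: "3 \<in> punit" and punit_4 [simp, intro]: "4 \<in> punit"
  and punit_8 [simp, intro]: "8 \<in> punit" and punit_16 [simp, intro]: "16 \<in> punit" and punit_32 [simp, intro]: "32 \<in> punit"
proof -
  show 2: "2 \<in> punit" using punit_small[of 2] M_pos by simp
  show "3 \<in> punit" using punit_small[of 3] M_pos by simp
  have "(2::rat) ^ k \<in> punit" for k using 2 by blast
  from this[of 2] this[of 3] this[of 4] this[of 5] show "4 \<in> punit" "8 \<in> punit" "16 \<in> punit" "32 \<in> punit" by simp_all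
qed

section \<open>Reflection of reciprocals and harmonic sums\<close>

lemma pint_divide_numeral [intro!]:
  "a \<in> pint \<Longrightarrow> a / 2 \<in> pint" "a \<in> pint \<Longrightarrow> a / 3 \<in> pint" "a \<in> pint \<Longrightarrow> a / 4 \<in> pint" "a \<in> pint \<Longrightarrow> a / 8 \<in> pint"
  "a \<in> pint \<Longrightarrow> a / 16 \<in> pint" "a \<in> pint \<Longrightarrow> a / 32 \<in> pint"
  by (auto intro: pint_divide)

lemma pint_inverse_small: "0 < a \<Longrightarrow> a \<le> 4 * M \<Longrightarrow> 1 / of_nat a \<in> pint"
  by (intro pint_divide punit_small) auto

lemma pint_HKe [simp, intro]: "H \<in> pint" "K \<in> pint" "e \<in> pint"
  unfolding H_def K_def e_def
  by (auto simp: n_eq intro!: pint_divide punit_power punit_small)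

lemma punit_fact: "k \<le> 4 * M \<Longrightarrow> fact k \<in> punit"
  unfolding fact_prod of_nat_prod by (intro punit_prod punit_small) auto

lemma sum_even_odd: "(\<Sum>i=1..2*m. f i) = (\<Sum>i=1..m. f (2 * i) + f (2 * i - 1))" for f :: "nat \<Rightarrow> rat"
  by (induction m) (auto simp: algebra_simps)

lemma sum_reflect: "(\<Sum>i=1..m. f (m + 1 - i)) = (\<Sum>i=1..m. f i)" for f :: "nat \<Rightarrow> rat"
  by (rule sum.reindex_bij_witness[of _ "\<lambda>i. m + 1 - i" "\<lambda>i. m + 1 - i"]) auto

lemma inverse_reflect:
  assumes "0 < a" "a < p"
  shows "pcong 1 (1 / of_nat (p - a)) (- 1 / of_nat a)"
    and "pcong 2 (1 / of_nat (p - a)) (- 1 / of_nat a - P * (1 / (of_nat a)\<^sup>2))"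
    and "pcong 1 (1 / (of_nat (p - a))\<^sup>2) (1 / (of_nat a)\<^sup>2)"
proof -
  have u: "of_nat a \<in> punit" "of_nat (p - a) \<in> punit" by (rule punit_of_nat_less; use assms in simp)+
  have nz: "(of_nat a :: rat) \<noteq> 0" "(of_nat (p - a) :: rat) \<noteq> 0" using u by (auto dest: punit_nonzero)
  have pa: "of_nat (p - a) = P - of_nat a" using assms by (simp add: of_nat_diff)
  show 2: "pcong 2 (1 / of_nat (p - a)) (- 1 / of_nat a - P * (1 / (of_nat a)\<^sup>2))"
  proof (rule pcongI[of _ _ _ "1 / (of_nat (p - a) * (of_nat a)\<^sup>2)"])
    show "1 / of_nat (p - a) = - 1 / of_nat a - P * (1 / (of_nat a)\<^sup>2) + P\<^sup>2 * (1 / (of_nat (p - a) * (of_nat a)\<^sup>2))"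
      using nz unfolding pa by (simp add: field_simps power2_eq_square)
  qed (intro pint_divide punit_mult punit_power u pint_numeral)
  have "pcong 1 (1 / of_nat (p - a)) (- 1 / of_nat a - P * (1 / (of_nat a)\<^sup>2))"
    using 2 by (rule pcong_weaken) simp
  also have "pcong 1 (- 1 / of_nat a - P * (1 / (of_nat a)\<^sup>2)) (- 1 / of_nat a)"
    by (rule pcongI[of _ _ _ "- (1 / (of_nat a)\<^sup>2)"]) (auto intro!: pint_divide punit_power u)
  finally show 1: "pcong 1 (1 / of_nat (p - a)) (- 1 / of_nat a)" .
  have "- 1 / of_nat a \<in> pint" using u by (intro pint_divide) auto
  from pcong_power[OF 1 this, of 2] show "pcong 1 (1 / (of_nat (p - a))\<^sup>2) (1 / (of_nat a)\<^sup>2)"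
    by (simp add: power_divide)
qed

text \<open>Let s be the sum and T the one up to 2 n = p - 1. Reflecting i to p - i gives T = 2 s
  modulo p; splitting by parity and reflecting the odd part gives T = s/2. Hence 3 s = 0, and 3 is a
  unit as p is at least 5.\<close>

lemma harmonic2_n: "pcong 1 (\<Sum>i=1..n. 1 / (of_nat i)\<^sup>2) 0"
proof -
  define s :: rat where "s = (\<Sum>i=1..n. 1 / (of_nat i)\<^sup>2)"
  have s: "s \<in> pint" unfolding s_def by (auto simp: n_eq intro!: pint_divide punit_power punit_small)
  define T :: rat where "T = (\<Sum>i=1..2*n. 1 / (of_nat i)\<^sup>2)"
  have "T = (\<Sum>i=1..n. 1 / (of_nat i)\<^sup>2) + (\<Sum>i=1..n. 1 / (of_nat (p - i))\<^sup>2)"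
  proof -
    have "{1..2*n} = {1..n} \<union> {n+1..2*n}" by auto
    then have "T = (\<Sum>i=1..n. 1 / (of_nat i)\<^sup>2) + (\<Sum>i=n+1..2*n. 1 / (of_nat i)\<^sup>2)"
      unfolding T_def by (simp add: sum.union_disjoint)
    also have "(\<Sum>i=n+1..2*n. 1 / (of_nat i :: rat)\<^sup>2) = (\<Sum>i=1..n. 1 / (of_nat (p - i))\<^sup>2)"
      by (rule sum.reindex_bij_witness[of _ "\<lambda>i. p - i" "\<lambda>i. p - i"]) (auto simp: p_eq_n)
    finally show ?thesis .
  qed
  also have "pcong 1 \<dots> (s + s)"
    unfolding s_def by (intro pcong_add pcong_sum pcong_refl inverse_reflect(3)) (auto simp: p_eq_n)
  finally have 1: "pcong 1 T (s + s)" .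
  have "T = (\<Sum>i=1..n. 1 / (of_nat (2 * i))\<^sup>2) + (\<Sum>i=1..n. 1 / (of_nat (2 * i - 1))\<^sup>2)"
    unfolding T_def sum_even_odd by (rule sum.distrib)
  also have "(\<Sum>i=1..n. 1 / (of_nat (2 * i - 1))\<^sup>2) = (\<Sum>i=1..n. 1 / (of_nat (p - 2 * i) :: rat)\<^sup>2)"
    by (subst sum_reflect[symmetric]) (rule sum.cong, auto simp: p_eq_n diff_mult_distrib2)
  also have "pcong 1 ((\<Sum>i=1..n. 1 / (of_nat (2 * i))\<^sup>2) + (\<Sum>i=1..n. 1 / (of_nat (p - 2 * i))\<^sup>2))
     ((\<Sum>i=1..n. 1 / (of_nat (2 * i))\<^sup>2) + (\<Sum>i=1..n. 1 / (of_nat (2 * i))\<^sup>2))"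
    by (intro pcong_add pcong_sum pcong_refl inverse_reflect(3)) (auto simp: p_eq_n)
  also have "(\<Sum>i=1..n. 1 / (of_nat (2 * i))\<^sup>2) = s / 4"
    unfolding s_def sum_divide_distrib by (intro sum.cong) (auto simp: power2_eq_square)
  finally have 2: "pcong 1 T (s / 4 + s / 4)" .
  have "pcong 1 (s + s) (s / 4 + s / 4)" using pcong_trans[OF pcong_sym[OF 1] 2] .
  then have "pcong 1 (s + s - (s / 4 + s / 4)) 0" by (rule pcong_0_iff[THEN iffD1])
  then have "pcong 1 (2 * (s + s - (s / 4 + s / 4))) (2 * 0)" by (rule pcong_cmult) auto
  then have "pcong 1 (3 * s) (3 * 0)" by simp
  then show ?thesis using pcong_cancel[OF _ punit_3] s_def by blast
qed

text \<open>By \<open>harmonic2_n\<close> the power sum of order two drops out, so the product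
  agrees with exp(a H p) to this precision.\<close>

lemma tri_prod_harmonic:
  assumes a: "a \<in> pint"
  shows "tri (\<Prod>i=1..n. 1 + P * (a / of_nat i)) 1 (a * H) (a\<^sup>2 * H\<^sup>2 / 2)"
proof -
  have pi: "a / of_nat i \<in> pint" if "i \<in> {1..n}" for i
    using that a by (intro pint_divide punit_small) (auto simp: n_eq)
  have "tri (\<Prod>i=1..n. 1 + P * (a / of_nat i)) 1 (\<Sum>i=1..n. a / of_nat i)
     (((\<Sum>i=1..n. a / of_nat i)\<^sup>2 - (\<Sum>i=1..n. (a / of_nat i)\<^sup>2)) / 2)"
    by (rule tri_prod) (auto simp: pi)
  also have "(\<Sum>i=1..n. a / of_nat i) = a * H" by (simp add: H_def sum_distrib_left)
  also have "(\<Sum>i=1..n. (a / of_nat i)\<^sup>2) = a\<^sup>2 * (\<Sum>i=1..n. 1 / (of_nat i)\<^sup>2)"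
    by (simp add: sum_distrib_left power_divide)
  finally show ?thesis
  proof (rule tri_adjust)
    have "pcong 1 (((a * H)\<^sup>2 - a\<^sup>2 * (\<Sum>i=1..n. 1 / (of_nat i)\<^sup>2)) / 2) (((a * H)\<^sup>2 - a\<^sup>2 * 0) / 2)"
      using a by (intro pcong_divide pcong_diff pcong_refl pcong_cmult harmonic2_n) auto
    then show "pcong 1 (((a * H)\<^sup>2 - a\<^sup>2 * (\<Sum>i=1..n. 1 / (of_nat i)\<^sup>2)) / 2) (a\<^sup>2 * H\<^sup>2 / 2)"
      by (simp add: power_mult_distrib)
  qed (use a in auto)
qed

section \<open>Factorials and powers of two by reflection\<close>

text \<open>The factors above n are p - i with i from 1 to n; the sign (-1)^n is 1 because n is
  even.\<close>

lemma fact_2n: "(fact (2 * n) :: rat) = (fact n)\<^sup>2 * (\<Prod>i=1..n. 1 + P * (- 1 / of_nat i))"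
proof -
  have "(fact n :: rat) = (\<Prod>i=1..n. of_nat i)" by (simp add: fact_prod)
  then have f: "(\<Prod>i=1..n. of_nat i) = (fact n :: rat)" ..
  have "(fact (2 * n) :: rat) = (\<Prod>i=1..2*n. of_nat i)" by (simp add: fact_prod)
  also have "{1..2*n} = {1..n} \<union> {n+1..2*n}" by auto
  also have "(\<Prod>i\<in>{1..n} \<union> {n+1..2*n}. of_nat i :: rat) = fact n * (\<Prod>i=n+1..2*n. of_nat i)"
    by (subst prod.union_disjoint) (auto simp: f[unfolded One_nat_def])
  also have "(\<Prod>i=n+1..2*n. of_nat i :: rat) = (\<Prod>i=1..n. of_nat (p - i))"
    by (rule prod.reindex_bij_witness[of _ "\<lambda>i. p - i" "\<lambda>i. p - i"]) (auto simp: p_eq_n)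
  also have "\<dots> = (\<Prod>i=1..n. - (of_nat i * (1 + P * (- 1 / of_nat i))))"
    by (intro prod.cong refl) (auto simp: of_nat_diff p_eq_n field_simps)
  also have "\<dots> = (-1)^n * fact n * (\<Prod>i=1..n. 1 + P * (- 1 / of_nat i))"
    by (simp only: prod_uminus prod.distrib) (simp add: f[unfolded One_nat_def])
  finally have 1: "(fact (2 * n) :: rat) = fact n * ((-1)^n * fact n * (\<Prod>i=1..n. 1 + P * (- 1 / of_nat i)))" .
  then show ?thesis by (simp add: n_eq power_mult power2_eq_square)
qed

text \<open>Both sides of the identity are \<open>(2 n)!\<close> divided by \<open>(-1)\<^sup>n n!\<^sup>2\<close>: reflect \<open>j\<close> to \<open>p - j\<close> in the upper half,
  respectively among the odd factors.\<close>

lemma two_power_prod: "2 ^ (2 * n) * (\<Prod>i=1..n. 1 + P * (- (1/2) / of_nat i)) = (\<Prod>i=1..n. 1 + P * (- 1 / of_nat i))"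
proof -
  have "(fact n :: rat) = (\<Prod>i=1..n. of_nat i)" by (simp add: fact_prod)
  then have f: "(\<Prod>i=1..n. of_nat i) = (fact n :: rat)" ..
  have "(fact (2 * m) :: rat) = 2 ^ m * fact m * (\<Prod>i=1..m. of_nat (2 * i - 1))" for m
    by (induction m) (auto simp: algebra_simps)
  then have "(fact (2 * n) :: rat) = 2 ^ n * fact n * (\<Prod>i=1..n. of_nat (2 * i - 1))" .
  also have "(\<Prod>i=1..n. of_nat (2 * i - 1)) = (\<Prod>i=1..n. of_nat (p - 2 * i) :: rat)"
    by (rule prod.reindex_bij_witness[of _ "\<lambda>i. n + 1 - i" "\<lambda>i. n + 1 - i"]) (auto simp: p_eq_n diff_mult_distrib2)
  also have "\<dots> = (\<Prod>i=1..n. - 2 * of_nat i * (1 + P * (- (1/2) / of_nat i)))"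
    by (intro prod.cong refl) (auto simp: of_nat_diff p_eq_n field_simps)
  also have "\<dots> = (-2)^n * fact n * (\<Prod>i=1..n. 1 + P * (- (1/2) / of_nat i))"
    by (simp only: prod.distrib) (simp add: f[unfolded One_nat_def])
  finally have 2: "(fact (2 * n) :: rat) = 2 ^ n * fact n * ((-2)^n * fact n * (\<Prod>i=1..n. 1 + P * (- (1/2) / of_nat i)))" .
  have "(-2 :: rat)^n = (-1)^n * 2^n" by (simp flip: power_mult_distrib)
  moreover have "(-1 :: rat)^n = 1" by (simp add: n_eq)
  ultimately show ?thesis using 2 unfolding fact_2n
    by (simp add: power_mult power2_eq_square mult_ac power_mult_distrib flip: power_add)
qed

lemma tri_eqI: "tri x a b c \<Longrightarrow> a = a' \<Longrightarrow> b = b' \<Longrightarrow> c = c' \<Longrightarrow> tri x a' b' c'"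
  by simp

text \<open>The second digit matters modulo p^2: a correction by a multiple of p is carried into the
  third digit.\<close>

lemma tri_adjust1: "tri x a b c \<Longrightarrow> pcong 2 b (b' + P * d) \<Longrightarrow> b' \<in> pint \<Longrightarrow> d \<in> pint \<Longrightarrow> tri x a b' (c + d)"
proof -
  assume 1: "tri x a b c" and b: "pcong 2 b (b' + P * d)" "b' \<in> pint" "d \<in> pint"
  have "pcong 3 (P * b) (P * (b' + P * d))" using pcong_P_mult[OF b(1), of 1] by (simp add: eval_nat_numeral)
  then have "pcong 3 (a + P * b + c * P\<^sup>2) (a + P * (b' + P * d) + c * P\<^sup>2)"
    by (intro pcong_add) auto
  then have "pcong 3 (a + b * P + c * P\<^sup>2) (a + b' * P + (c + d) * P\<^sup>2)"
    by (simp add: algebra_simps power2_eq_square)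
  then show ?thesis using 1 b pcong_trans unfolding tri_def by blast
qed

lemma tri_same:
  assumes "tri x a b c" "tri x a b' c'"
  shows "pcong 2 (b + c * P) (b' + c' * P)"
proof -
  have "pcong 3 (a + b * P + c * P\<^sup>2) (a + b' * P + c' * P\<^sup>2)"
    using assms pcong_trans pcong_sym unfolding tri_def by blast
  from pcong_diff[OF this pcong_refl[of 3 a]]
  have "pcong 3 (P * (b + c * P)) (P * (b' + c' * P))"
    by (simp add: algebra_simps power2_eq_square)
  then show ?thesis using pcong_P_cancel[of 2 1] by (simp add: eval_nat_numeral)
qed

text \<open>Solving \<open>two_power_prod\<close> for the power expresses 2^(p-1), hence the Fermat
  quotient of 2, through H.\<close>

lemma tri_two_power: "tri (2 ^ (2 * n)) 1 (- H / 2) (H\<^sup>2 / 8)"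
proof -
  define A where "A = (\<Prod>i=1..n. 1 + P * (- (1/2) / of_nat i))"
  have i: "- (1/2) \<in> pint" "(-1 :: rat) \<in> pint" by (auto intro: pint_divide_numeral)
  have A: "tri A 1 (- (1/2) * H) ((- (1/2))\<^sup>2 * H\<^sup>2 / 2)"
    unfolding A_def by (rule tri_prod_harmonic) (rule i)
  have "A \<noteq> 0" using tri_pcong_1[OF A] punit_pcong[of 0 A 1] punit_nonzero by auto
  then have eq: "2 ^ (2 * n) = (\<Prod>i=1..n. 1 + P * (- 1 / of_nat i)) * (1 / A)"
    using two_power_prod by (simp add: A_def field_simps)
  show ?thesis unfolding eq
    by (rule tri_eqI[OF tri_mult[OF tri_prod_harmonic[OF i(2)] tri_inverse[OF A]]])
       (simp_all add: power2_eq_square field_simps)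
qed

lemma prod_four_minus_two: "(\<Prod>i=1..m. of_nat (4 * i - 2)) = (fact (2 * m) / fact m :: rat)"
proof (induction m)
  case (Suc m)
  have "(\<Prod>i=1..Suc m. of_nat (4 * i - 2)) = (fact (2 * m) / fact m) * (4 * of_nat m + 2 :: rat)"
    using Suc by simp
  also have "\<dots> = fact (2 * Suc m) / fact (Suc m)"
  proof -
    have "(fact (2 * Suc m) :: rat) = (2 * of_nat (Suc m)) * ((2 * of_nat m + 1) * fact (2 * m))"
      by (simp add: algebra_simps)
    moreover have "(of_nat (Suc m) :: rat) \<noteq> 0" by (rule of_nat_neq_0)
    ultimately show ?thesis by (simp add: field_simps del: of_nat_Suc)
  qed
  finally show ?case .
qed simp

text \<open>After i is replaced by M + 1 - i, the factor 4 i - 1 is p - (4 i - 2); this links the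
  residue classes 3 and 2 modulo 4.\<close>

lemma prod_four_minus_one:
  "(\<Prod>i=1..M. of_nat (4 * i - 1)) = (-1) ^ M * (fact n / fact M) * (\<Prod>i=1..M. 1 + P * (- 1 / of_nat (4 * i - 2)))"
proof -
  have "(\<Prod>i=1..M. of_nat (4 * i - 1)) = (\<Prod>i=1..M. of_nat (p - (4 * i - 2)) :: rat)"
    by (rule prod.reindex_bij_witness[of _ "\<lambda>i. M + 1 - i" "\<lambda>i. M + 1 - i"]) (auto simp: p_eq diff_mult_distrib2)
  also have "\<dots> = (\<Prod>i=1..M. - (of_nat (4 * i - 2) * (1 + P * (- 1 / of_nat (4 * i - 2)))))"
  proof (intro prod.cong refl)
    fix i assume i: "i \<in> {1..M}"
    then have "of_nat (p - (4 * i - 2)) = P - of_nat (4 * i - 2)"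
      by (intro of_nat_diff) (auto simp: p_eq)
    moreover have "(of_nat (4 * i - 2) :: rat) \<noteq> 0" using i by (subst of_nat_eq_0_iff) auto
    ultimately show "(of_nat (p - (4 * i - 2)) :: rat) = - (of_nat (4 * i - 2) * (1 + P * (- 1 / of_nat (4 * i - 2))))"
      by (simp add: field_simps)
  qed
  also have "\<dots> = (-1) ^ M * ((\<Prod>i=1..M. of_nat (4 * i - 2)) * (\<Prod>i=1..M. 1 + P * (- 1 / of_nat (4 * i - 2))))"
    by (simp only: prod_uminus prod.distrib) simp
  finally show ?thesis unfolding prod_four_minus_two n_eq by simp
qed

text \<open>Rests on 4 (M + i) = p + (4 i - 1): the product of the left sides is 4^M n!/M!, that of
  the right sides is known from \<open>prod_four_minus_one\<close>. This gives the power 2^n with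
  its sign, a square root of what \<open>tri_two_power\<close> treats.\<close>

lemma two_power_sign_prod:
  "2 ^ n * (-1) ^ M = (\<Prod>i=1..M. 1 + P * (1 / of_nat (4 * i - 1))) * (\<Prod>i=1..M. 1 + P * (- 1 / of_nat (4 * i - 2)))"
proof -
  have r: "(\<Prod>i=1..m. of_nat (M + i)) = (fact (M + m) / fact M :: rat)" for m
  proof (induction m)
    case (Suc m)
    then have "(\<Prod>i=1..Suc m. of_nat (M + i)) = (fact (M + m) / fact M) * (of_nat (M + Suc m) :: rat)"
      by simp
    also have "\<dots> = fact (M + Suc m) / fact M"
      by (simp add: mult.commute)
    finally show ?case .
  qed simp
  have "4 ^ M * (fact n / fact M :: rat) = (\<Prod>i=1..M. 4 * of_nat (M + i))"
    unfolding prod.distrib r by (simp add: n_eq mult_2)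
  also have "\<dots> = (\<Prod>i=1..M. of_nat (4 * i - 1) * (1 + P * (1 / of_nat (4 * i - 1))))"
  proof (intro prod.cong refl)
    fix i assume i: "i \<in> {1..M}"
    then have nz: "(of_nat (4 * i - 1) :: rat) \<noteq> 0" by (subst of_nat_eq_0_iff) auto
    have "4 * (M + i) = p + (4 * i - 1)" using i by (auto simp: p_eq)
    then have "(4 * of_nat (M + i) :: rat) = P + of_nat (4 * i - 1)" by (metis of_nat_add of_nat_mult of_nat_numeral)
    moreover have "P + z = z * (1 + P * (1 / z))" if "z \<noteq> 0" for z
      using that by (simp add: distrib_left)
    ultimately show "(4 * of_nat (M + i) :: rat) = of_nat (4 * i - 1) * (1 + P * (1 / of_nat (4 * i - 1)))"
      using nz by presburger
  qed
  also have "\<dots> = (-1) ^ M * (fact n / fact M) * (\<Prod>i=1..M. 1 + P * (- 1 / of_nat (4 * i - 2))) * (\<Prod>i=1..M. 1 + P * (1 / of_nat (4 * i - 1)))"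
    unfolding prod.distrib prod_four_minus_one ..
  finally have "4 ^ M = (-1 :: rat) ^ M * ((\<Prod>i=1..M. 1 + P * (- 1 / of_nat (4 * i - 2))) * (\<Prod>i=1..M. 1 + P * (1 / of_nat (4 * i - 1))))"
    by simp
  then have "(-1) ^ M * 4 ^ M = (-1) ^ M * ((-1 :: rat) ^ M * ((\<Prod>i=1..M. 1 + P * (- 1 / of_nat (4 * i - 2))) * (\<Prod>i=1..M. 1 + P * (1 / of_nat (4 * i - 1)))))"
    by (rule arg_cong)
  then show ?thesis
    by (simp only: n_eq power_mult mult.assoc[symmetric] flip: power_mult_distrib) (simp add: mult.commute)
qed

text \<open>The two claims are proved together. Expanding \<open>two_power_sign_prod\<close> gives
  digits in the sum b of 1/(4 i - 2), and squaring must reproduce \<open>tri_two_power\<close>. This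
  determines b modulo p^2 in terms of H and e; since H = K/2 + 2 b exactly, K follows, and
  substituting b back removes it from the expansion.\<close>

lemma
  shows harmonic_K: "pcong 2 K (3/2 * H - e / 4 * P)"
    and tri_two_power_sign: "tri (2 ^ n * (-1) ^ M) 1 (- H / 4) (H\<^sup>2 / 32)"
proof -
  define a b a2 b2 :: rat where "a = (\<Sum>i=1..M. 1 / of_nat (4 * i - 1))" and "b = (\<Sum>i=1..M. 1 / of_nat (4 * i - 2))"
    and "a2 = (\<Sum>i=1..M. 1 / (of_nat (4 * i - 1))\<^sup>2)" and "b2 = (\<Sum>i=1..M. 1 / (of_nat (4 * i - 2))\<^sup>2)"
  define t :: rat where "t = 2 ^ n * (-1) ^ M"
  have ib: "1 / of_nat (4 * i - 2) \<in> pint" and ia: "1 / of_nat (4 * i - 1) \<in> pint" if "i \<in> {1..M}" for i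
    by (rule pint_inverse_small; use that in auto)+
  have i: "a \<in> pint" "b \<in> pint" "a2 \<in> pint" "b2 \<in> pint"
    unfolding a_def b_def a2_def b2_def
    by (intro pint_sum ia ib pint_divide punit_power punit_small pint_numeral; auto)+
  have ra: "a = (\<Sum>i=1..M. 1 / of_nat (p - (4 * i - 2)))"
    unfolding a_def by (subst sum_reflect[symmetric]) (rule sum.cong, auto simp: p_eq diff_mult_distrib2)
  have ra2: "a2 = (\<Sum>i=1..M. 1 / (of_nat (p - (4 * i - 2)))\<^sup>2)"
    unfolding a2_def by (subst sum_reflect[symmetric]) (rule sum.cong, auto simp: p_eq diff_mult_distrib2)
  have "pcong 2 a (\<Sum>i=1..M. - 1 / of_nat (4 * i - 2) - P * (1 / (of_nat (4 * i - 2))\<^sup>2))"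
    unfolding ra by (intro pcong_sum inverse_reflect(2)) (auto simp: p_eq)
  also have "\<dots> = - b - P * b2"
    unfolding b_def b2_def by (simp add: sum_subtractf sum_negf sum_distrib_left)
  finally have a: "pcong 2 a (- b - P * b2)" .
  have a2: "pcong 1 a2 b2"
    unfolding ra2 b2_def by (intro pcong_sum inverse_reflect(3)) (auto simp: p_eq)
  have "H = (\<Sum>i=1..2*M. 1 / of_nat i)" by (simp add: H_def flip: n_eq)
  also have "\<dots> = (\<Sum>i=1..M. 1 / of_nat (2 * i)) + (\<Sum>i=1..M. 1 / of_nat (2 * i - 1))"
    unfolding sum_even_odd by (rule sum.distrib)
  also have "(\<Sum>i=1..M. 1 / of_nat (2 * i)) = K / 2" by (simp add: K_def sum_divide_distrib mult.commute)
  also have "(\<Sum>i=1..M. 1 / of_nat (2 * i - 1)) = 2 * b"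
    unfolding b_def sum_distrib_left
  proof (intro sum.cong refl)
    fix i assume i: "i \<in> {1..M}"
    have "4 * i - 2 = 2 * (2 * i - 1)" by auto
    then show "1 / of_nat (2 * i - 1) = 2 * (1 / of_nat (4 * i - 2) :: rat)" by simp
  qed
  finally have H: "H = K / 2 + 2 * b" .
  have "(\<Sum>i=1..n. 1 / (of_nat i)\<^sup>2) = (\<Sum>i=1..M. 1 / (of_nat (2 * i))\<^sup>2) + (\<Sum>i=1..M. 1 / (of_nat (2 * i - 1))\<^sup>2 :: rat)"
    unfolding n_eq sum_even_odd by (rule sum.distrib)
  also have "(\<Sum>i=1..M. 1 / (of_nat (2 * i))\<^sup>2) = e / 4" by (simp add: e_def sum_divide_distrib power_mult_distrib mult.commute)
  also have "(\<Sum>i=1..M. 1 / (of_nat (2 * i - 1))\<^sup>2) = 4 * b2"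
    unfolding b2_def sum_distrib_left
  proof (intro sum.cong refl)
    fix i assume i: "i \<in> {1..M}"
    have "4 * i - 2 = 2 * (2 * i - 1)" by auto
    then show "1 / (of_nat (2 * i - 1))\<^sup>2 = 4 * (1 / (of_nat (4 * i - 2))\<^sup>2 :: rat)" by (simp add: power_mult_distrib)
  qed
  \<comment> \<open>As the full sum of 1/i^2 vanishes modulo p, its odd part \<open>b2\<close> is a
    multiple of its even part, that is, of \<open>e\<close>.\<close>
  finally have "pcong 1 (e / 4 + 4 * b2) 0" using harmonic2_n by simp
  from pcong_divide[OF pcong_diff[OF this pcong_refl[of 1 "e / 4"]] punit_4]
  have b2: "pcong 1 b2 (- e / 16)" by simp
  have ta: "tri (\<Prod>i=1..M. 1 + P * (1 / of_nat (4 * i - 1))) 1 a ((a\<^sup>2 - a2) / 2)"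
    unfolding a_def a2_def using tri_prod[of "{1..M}" "\<lambda>i. 1 / of_nat (4 * i - 1)"] ia by (simp add: power_divide)
  have tb: "tri (\<Prod>i=1..M. 1 + P * (- 1 / of_nat (4 * i - 2))) 1 (- b) ((b\<^sup>2 - b2) / 2)"
    unfolding b_def b2_def using tri_prod[of "{1..M}" "\<lambda>i. - (1 / of_nat (4 * i - 2))"] pint_minus[OF ib]
    by (simp add: power_divide sum_negf)
  define c where "c = (b\<^sup>2 - b2) / 2 - a * b + (a\<^sup>2 - a2) / 2"
  have "tri t 1 (a - b) c"
    unfolding t_def two_power_sign_prod by (rule tri_eqI[OF tri_mult[OF ta tb]]) (simp_all add: c_def)
  moreover have "pcong 2 (a - b) (- 2 * b + P * (- b2))"
    using pcong_diff[OF a pcong_refl[of 2 b]] by simp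
  ultimately have t1: "tri t 1 (- 2 * b) (c + - b2)"
    by (rule tri_adjust1) (use i in auto)
  have "pcong 1 a (- b)"
  proof -
    have "pcong 1 a (- b - P * b2)" using a by (rule pcong_weaken) simp
    also have "pcong 1 (- b - P * b2) (- b)" using i by (intro pcongI[of _ _ _ "- b2"]) auto
    finally show ?thesis .
  qed
  then have "pcong 1 (c + - b2) ((b\<^sup>2 - (- e / 16)) / 2 - (- b) * b + ((- b)\<^sup>2 - (- e / 16)) / 2 + - (- e / 16))"
    unfolding c_def using i b2 pcong_trans[OF a2 b2]
    by (intro pcong_add pcong_diff pcong_minus pcong_divide pcong_power pcong_mult pcong_refl) auto
  then have c: "pcong 1 (c + - b2) (2 * b\<^sup>2 + e / 8)"
    by (rule pcong_eq_trans) (simp add: field_simps power2_eq_square)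
  have t2: "tri t 1 (- 2 * b) (2 * b\<^sup>2 + e / 8)"
    using t1 c by (rule tri_adjust) (use i in auto)
  \<comment> \<open>The second source of information: the square must have the digits found for 2^(2
    n).\<close>
  have "t\<^sup>2 = 2 ^ (2 * n)"
    by (simp add: t_def power_mult_distrib flip: power_mult)
  then have "tri (2 ^ (2 * n)) 1 (- 4 * b) (8 * b\<^sup>2 + e / 4)"
    using tri_eqI[OF tri_mult[OF t2 t2]] by (simp add: power2_eq_square)
  from tri_same[OF this tri_two_power] have k: "pcong 2 (- 4 * b + (8 * b\<^sup>2 + e / 4) * P) (- H / 2 + H\<^sup>2 / 8 * P)" .
  have P0: "pcong 1 (x * P) 0" if "x \<in> pint" for x
    using that by (intro pcongI[of _ _ _ x]) auto
  have "pcong 1 (- 4 * b + (8 * b\<^sup>2 + e / 4) * P - (8 * b\<^sup>2 + e / 4) * P) (- H / 2 + H\<^sup>2 / 8 * P - 0)"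
    using i by (intro pcong_diff P0 pcong_weaken[OF k]) auto
  then have "pcong 1 (- 4 * b) (- H / 2 + H\<^sup>2 / 8 * P)" by simp
  also have "pcong 1 (- H / 2 + H\<^sup>2 / 8 * P) (- H / 2 + 0)"
    by (intro pcong_add P0 pcong_refl) auto
  finally have "pcong 1 (4 * b) (4 * (H / 8))" using pcong_minus by fastforce
  \<comment> \<open>A first approximation of b modulo p suffices to cancel the quadratic terms and
    reach precision p^2.\<close>
  then have b1: "pcong 1 b (H / 8)" by (rule pcong_cancel) auto
  have "pcong 1 (b\<^sup>2) ((H / 8)\<^sup>2)" by (rule pcong_power[OF b1]) auto
  then have "pcong 1 (8 * b\<^sup>2) (8 * (H / 8)\<^sup>2)" by (rule pcong_cmult) auto
  then have "pcong 2 (P ^ 1 * (8 * b\<^sup>2)) (P ^ 1 * (8 * (H / 8)\<^sup>2))" using pcong_P_mult[of 1 _ _ 1] by (simp only: one_add_one)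
  from pcong_diff[OF k this] have k2: "pcong 2 (- 4 * b + e / 4 * P) (- H / 2)"
    by (simp add: algebra_simps power_divide)
  have "pcong 2 (- 4 * b + e / 4 * P + (2 * H - e / 4 * P)) (- H / 2 + (2 * H - e / 4 * P))"
    by (intro pcong_add k2 pcong_refl)
  moreover have "- 4 * b + e / 4 * P + (2 * H - e / 4 * P) = K" using H by simp
  moreover have "- H / 2 + (2 * H - e / 4 * P) = 3/2 * H - e / 4 * P" by simp
  ultimately show "pcong 2 K (3/2 * H - e / 4 * P)" by (simp only:)
  have "pcong 2 ((- 4 * b + e / 4 * P - e / 4 * P) / 2) ((- H / 2 - e / 4 * P) / 2)"
    by (intro pcong_divide pcong_diff k2 pcong_refl punit_2)
  then have "pcong 2 (- 2 * b) (- H / 4 + P * (- e / 8))"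
    by (simp add: field_simps)
  with t2 have "tri t 1 (- H / 4) (2 * b\<^sup>2 + e / 8 + - e / 8)"
    by (rule tri_adjust1) auto
  moreover have "pcong 1 (2 * b\<^sup>2 + e / 8 + - e / 8) (2 * (H / 8)\<^sup>2 + e / 8 + - e / 8)"
    using i by (intro pcong_add pcong_cmult pcong_power[OF b1] pcong_refl) auto
  ultimately have "tri t 1 (- H / 4) (2 * (H / 8)\<^sup>2 + e / 8 + - e / 8)"
    by (rule tri_adjust) auto
  then show "tri (2 ^ n * (-1) ^ M) 1 (- H / 4) (H\<^sup>2 / 32)" by (simp add: t_def power_divide)
qed

lemma K_pcong_1: "pcong 1 K (3/2 * H)"
  by (rule pcong_trans[OF pcong_weaken[OF harmonic_K]]) (auto intro!: pcongI[of _ _ _ "- (e / 4)"])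

lemma tri_prod_M:
  assumes "a \<in> pint"
  shows "tri (\<Prod>i=1..M. 1 + P * (a / of_nat i)) 1 (a * K) (a\<^sup>2 * (K\<^sup>2 - e) / 2)"
proof -
  have pi: "a / of_nat i \<in> pint" if "i \<in> {1..M}" for i
    using that assms by (intro pint_divide punit_small) auto
  have s: "(\<Sum>i=1..M. a / of_nat i) = a * K" by (simp add: K_def sum_distrib_left)
  have s2: "(\<Sum>i=1..M. (a / of_nat i)\<^sup>2) = a\<^sup>2 * e" by (simp add: e_def sum_distrib_left power_divide)
  have "tri (\<Prod>i=1..M. 1 + P * (a / of_nat i)) 1 (a * K) (((a * K)\<^sup>2 - a\<^sup>2 * e) / 2)"
    using tri_prod[of "{1..M}" "\<lambda>i. a / of_nat i"] pi unfolding s s2 by auto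
  then show ?thesis by (rule tri_eqI) (simp_all add: power_mult_distrib right_diff_distrib)
qed

end

section \<open>Alternating sums of binomial coefficients over \<open>j\<close>\<close>

text \<open>C(N + 1, j) - C(N, j) = C(N, j - 1) = j/(N + 1) C(N + 1, j), so the increment in N loses
  the factor 1/j.\<close>

lemma sum_signed_choose_over_Suc:
  fixes x :: "nat \<Rightarrow> rat"
  shows "(\<Sum>j=1..Suc N. (-1)^j / of_nat j * of_nat (Suc N choose j) * x j)
       = (\<Sum>j=1..N. (-1)^j / of_nat j * of_nat (N choose j) * x j)
         + (\<Sum>j=1..Suc N. (-1)^j * of_nat (Suc N choose j) * x j) / of_nat (Suc N)"
proof -
  have "(-1)^j / of_nat j * of_nat (Suc N choose j) * x j - (-1)^j / of_nat j * of_nat (N choose j) * x j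
      = (-1)^j * of_nat (Suc N choose j) * x j / of_nat (Suc N)" if j: "j \<in> {1..Suc N}" for j
  proof -
    obtain i where j: "j = Suc i" using j by (cases j) auto
    have "Suc i * (Suc N choose Suc i) = Suc N * (N choose i)" by (metis Suc_times_binomial_eq mult.commute)
    then have "of_nat (Suc i) * of_nat (Suc N choose Suc i) = (of_nat (Suc N) * of_nat (N choose i) :: rat)"
      by (metis of_nat_mult)
    then have m: "of_nat (N choose i) * of_nat (Suc N) = (of_nat (Suc N choose Suc i) * of_nat (Suc i) :: rat)"
      by (simp only: mult.commute)
    have "(of_nat (N choose i) :: rat) / of_nat (Suc i) = of_nat (Suc N choose Suc i) / of_nat (Suc N)"
      by (rule iffD2[OF frac_eq_eq[OF of_nat_neq_0 of_nat_neq_0] m])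
    moreover have "(of_nat (Suc N choose Suc i) - of_nat (N choose Suc i) :: rat) = of_nat (N choose i)" by simp
    ultimately have "(of_nat (Suc N choose j) - of_nat (N choose j) :: rat) / of_nat j = of_nat (Suc N choose j) / of_nat (Suc N)"
      unfolding j by (simp only:)
    then have "(-1)^j * x j * ((of_nat (Suc N choose j) - of_nat (N choose j)) / of_nat j) = (-1)^j * x j * (of_nat (Suc N choose j) / of_nat (Suc N))"
      by simp
    then show ?thesis by (simp add: right_diff_distrib diff_divide_distrib mult_ac)
  qed
  then have "(\<Sum>j=1..Suc N. (-1)^j / of_nat j * of_nat (Suc N choose j) * x j - (-1)^j / of_nat j * of_nat (N choose j) * x j)
      = (\<Sum>j=1..Suc N. (-1)^j * of_nat (Suc N choose j) * x j / of_nat (Suc N))"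
    by (intro sum.cong) auto
  then show ?thesis
    unfolding sum_subtractf sum_divide_distrib[symmetric] by (simp add: binomial_eq_0 algebra_simps)
qed

text \<open>By the difference form of Pascal's rule, partial sums are replaced by their
  increments.\<close>

lemma sum_signed_choose_partial_sums:
  fixes z :: "nat \<Rightarrow> rat"
  shows "(\<Sum>j=1..Suc N. (-1)^j * of_nat (Suc N choose j) * (\<Sum>i<j. z i)) = - (\<Sum>i\<le>N. (-1)^i * of_nat (N choose i) * z i)"
proof -
  have "(\<Sum>j=1..Suc N. (-1)^j * of_nat (Suc N choose j) * (\<Sum>i<j. z i)) = (\<Sum>j\<le>Suc N. (-1)^j * of_nat (Suc N choose j) * (\<Sum>i<j. z i))"
    by (rule sum.mono_neutral_left) (auto simp: Suc_le_eq)
  also have "\<dots> = (\<Sum>i\<le>N. (-1)^i * of_nat (N choose i) * ((\<Sum>j<i. z j) - (\<Sum>j<Suc i. z j)))"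
    by (rule alternating_binomial_sum_Suc)
  finally show ?thesis by (simp add: sum_negf)
qed

lemma sum_signed_choose_1: "(\<Sum>j=1..Suc N. (-1)^j * of_nat (Suc N choose j) :: rat) = - 1"
proof -
  have "(\<Sum>j\<le>Suc N. (-1)^j * of_nat (Suc N choose j) * 1 :: rat) = 0"
    by (subst alternating_binomial_sum_Suc) simp
  then show ?thesis by (subst (asm) sum.atMost_Suc_shift) (simp add: sum.atLeast_Suc_atMost_Suc_shift atLeast0AtMost del: sum.atMost_Suc sum.cl_ivl_Suc binomial_Suc_Suc)
qed

lemma sum_signed_choose_over:
  "(\<Sum>j=1..N. (-1)^j / of_nat j * of_nat (N choose j)) = - (\<Sum>i=1..N. 1 / of_nat i :: rat)"
proof (induction N)
  case (Suc N)
  then show ?case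
    using sum_signed_choose_over_Suc[of N "\<lambda>_. 1"] sum_signed_choose_1[of N]
    by (simp del: binomial_Suc_Suc of_nat_Suc)
qed simp

lemma sum_signed_choose_over_square:
  "(\<Sum>j=1..N. (-1)^j / of_nat j * of_nat (N choose j) * (1 / of_nat j))
     = - ((\<Sum>i=1..N. 1 / of_nat i)\<^sup>2 + (\<Sum>i=1..N. 1 / (of_nat i)\<^sup>2)) / (2 :: rat)"
proof (induction N)
  case (Suc N)
  have "(\<Sum>j=1..Suc N. (-1)^j * of_nat (Suc N choose j) * (1 / of_nat j) :: rat) = - (\<Sum>i=1..Suc N. 1 / of_nat i)"
    using sum_signed_choose_over[of "Suc N"] by (simp add: mult.commute del: binomial_Suc_Suc of_nat_Suc sum.cl_ivl_Suc)
  then show ?case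
    unfolding sum_signed_choose_over_Suc Suc.IH
    by (simp add: power2_eq_square divide_simps del: of_nat_Suc) (simp add: algebra_simps del: of_nat_Suc)
qed simp

lemma sum_signed_choose_over_harmonic:
  "(\<Sum>j=1..N. (-1)^j / of_nat j * of_nat (N choose j) * (\<Sum>i<j. 1 / of_nat i))
     = ((\<Sum>i=1..N. 1 / of_nat i)\<^sup>2 - (\<Sum>i=1..N. 1 / (of_nat i)\<^sup>2)) / (2 :: rat)"
proof (induction N)
  case (Suc N)
  have "(\<Sum>j=1..Suc N. (-1)^j * of_nat (Suc N choose j) * (\<Sum>i<j. 1 / of_nat i) :: rat) = - (\<Sum>i\<le>N. (-1)^i * of_nat (N choose i) * (1 / of_nat i))"
    by (rule sum_signed_choose_partial_sums)
  also have "(\<Sum>i\<le>N. (-1)^i * of_nat (N choose i) * (1 / of_nat i) :: rat) = (\<Sum>j=1..N. (-1)^j / of_nat j * of_nat (N choose j))"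
    by (rule sum.mono_neutral_cong_right) auto
  finally have "(\<Sum>j=1..Suc N. (-1)^j * of_nat (Suc N choose j) * (\<Sum>i<j. 1 / of_nat i) :: rat) = (\<Sum>i=1..N. 1 / of_nat i)"
    unfolding sum_signed_choose_over by simp
  then show ?case
    unfolding sum_signed_choose_over_Suc Suc.IH
    by (simp add: power2_eq_square divide_simps del: of_nat_Suc) (simp add: algebra_simps del: of_nat_Suc)
qed simp

text \<open>The increments in N are partial fractions with y = -n, whose value is a reciprocal
  binomial coefficient. Unlike the preceding sums this one stays open: for N = M it is -W.\<close>

lemma sum_signed_choose_over_shifted:
  assumes "N \<le> n"
  shows "(\<Sum>j=1..N. (-1)^j / of_nat j * of_nat (N choose j) * (\<Sum>i<j. 1 / (of_nat n - of_nat i)))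
     = (\<Sum>a=1..N. (-1)^a / ((of_nat a)\<^sup>2 * of_nat (n choose a)) :: rat)"
  using assms
proof (induction N)
  case (Suc N)
  have "of_nat (n choose Suc N) = ((-1)^(Suc N) * pochhammer (- of_nat n) (Suc N) / fact (Suc N) :: rat)"
    by (simp only: binomial_gbinomial gbinomial_pochhammer)
  then have pz: "pochhammer (- of_nat n :: rat) (Suc N) = (-1)^(Suc N) * fact (Suc N) * of_nat (n choose Suc N)"
    by (simp del: fact_Suc)
  have cz: "(of_nat (n choose Suc N) :: rat) \<noteq> 0"
    using Suc.prems by (subst of_nat_eq_0_iff) (simp add: binomial_eq_0_iff)
  have "(\<Sum>j=1..Suc N. (-1)^j * of_nat (Suc N choose j) * (\<Sum>i<j. 1 / (of_nat n - of_nat i)) :: rat) = - (\<Sum>i\<le>N. (-1)^i * of_nat (N choose i) * (1 / (of_nat n - of_nat i)))"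
    by (rule sum_signed_choose_partial_sums)
  also have "\<dots> = (\<Sum>i\<le>N. (-1)^i * of_nat (N choose i) / (- of_nat n + of_nat i))"
    unfolding sum_negf[symmetric] by (intro sum.cong refl) (simp add: minus_divide_right)
  also have "\<dots> = fact N / pochhammer (- of_nat n) (Suc N)"
    by (rule alternating_binomial_reciprocal) (use cz in \<open>simp only: pz mult_eq_0_iff, simp\<close>)
  also have "\<dots> = (-1)^(Suc N) / (of_nat (Suc N) * of_nat (n choose (Suc N)))"
    unfolding pz using cz by (simp add: field_simps del: of_nat_Suc)
  finally show ?case
    unfolding sum_signed_choose_over_Suc using Suc by (simp add: power2_eq_square del: of_nat_Suc)
qed simp

section \<open>Pochhammer symbols as perturbed factorials\<close>

lemma pochhammer_one_plus: "pochhammer (1 + x) m = fact m * (\<Prod>i=1..m. 1 + x / of_nat i)" for x :: rat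
proof (induction m)
  case (Suc m)
  have "(of_nat (Suc m) :: rat) \<noteq> 0" by (rule of_nat_neq_0)
  then have "1 + x + of_nat m = of_nat (Suc m) * (1 + x / of_nat (Suc m))"
    by (simp add: field_simps)
  then show ?case using Suc by (simp add: pochhammer_Suc del: of_nat_Suc)
qed simp

lemma pochhammer_Suc_prod: "pochhammer x (Suc m) = x * fact m * (\<Prod>i=1..m. 1 + x / of_nat i)" for x :: rat
  using pochhammer_rec[of x m] pochhammer_one_plus[of x m] by (simp add: add.commute)

lemma pochhammer_minus_prod: "pochhammer (x - of_nat m) m = (-1)^m * fact m * (\<Prod>i=1..m. 1 - x / of_nat i)" for x :: rat
  using pochhammer_minus[of "of_nat m - x" m] pochhammer_one_plus[of "- x" m] by simp

lemma gbinomial_minus_prod: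
  fixes x :: rat
  assumes "j > 0"
  shows "(- x gchoose j) = (-1)^j * (x / of_nat j) * (\<Prod>i=1..j - 1. 1 + x / of_nat i)"
proof -
  obtain m where j: "j = Suc m" using assms by (cases j) auto
  show ?thesis unfolding j gbinomial_pochhammer minus_minus pochhammer_Suc_prod fact_Suc
    by (simp del: of_nat_Suc)
qed

context quarter_prime
begin

text \<open>Enters from two sources: the steps that carry \<open>G\<close> from near 0 to near M,
  and \<open>sum_signed_choose_over_shifted\<close>. The sign makes the latter contribute +W after
  subtraction.\<close>

definition W :: rat where "W = - (\<Sum>a=1..M. (-1)^a / ((of_nat a)\<^sup>2 * of_nat (n choose a)))"

text \<open>For an integer A between 0 and n this is minus the A-th harmonic number, by
  \<open>sum_signed_choose_over\<close>; \<open>G\<close> extends it to p-integral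
  rationals.\<close>

definition G :: "rat \<Rightarrow> rat" where "G A = (\<Sum>j=1..n. (-1)^j / of_nat j * (A gchoose j))"

lemma punit_binomial: "N \<le> 4 * M \<Longrightarrow> a \<le> N \<Longrightarrow> of_nat (N choose a) \<in> punit"
  by (subst binomial_fact) (auto intro!: punit_divide punit_mult punit_fact)

lemma pint_W [simp, intro]: "W \<in> pint"
  unfolding W_def
  by (intro pint_minus pint_sum pint_divide punit_mult punit_power punit_binomial punit_small pint_power pint_numeral; simp add: n_eq)

lemma pint_gbinomial: "x \<in> pint \<Longrightarrow> j \<le> 4 * M \<Longrightarrow> (x gchoose j) \<in> pint"
  unfolding gbinomial_prod_rev by (intro pint_divide punit_fact) auto

lemma pcong_gbinomial: "pcong k x y \<Longrightarrow> y \<in> pint \<Longrightarrow> j \<le> 4 * M \<Longrightarrow> pcong k (x gchoose j) (y gchoose j)"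
  unfolding gbinomial_prod_rev by (intro pcong_divide punit_fact pcong_prod pcong_diff pcong_refl) auto

text \<open>C(A, j) - C(A - 1, j) = (j/A) C(A, j) removes the factor 1/j, and the truncated
  alternating row sum is C(A - 1, n), with sign + because n is even. For a natural number below n
  that last term vanishes; near one it is a multiple of p.\<close>

lemma G_step:
  assumes "A \<noteq> 0"
  shows "G A = G (A - 1) + ((A - 1 gchoose n) - 1) / A"
proof -
  have "A * (G A - G (A - 1)) = (\<Sum>j=1..n. A * ((-1)^j / of_nat j * ((A gchoose j) - (A - 1 gchoose j))))"
    unfolding G_def by (simp add: sum_distrib_left sum_subtractf right_diff_distrib)
  also have "\<dots> = (\<Sum>j=1..n. (-1)^j * (A gchoose j))"
  proof (intro sum.cong refl)
    fix j assume "j \<in> {1..n}"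
    then obtain i where j: "j = Suc i" by (cases j) auto
    have "(A gchoose Suc i) - (A - 1 gchoose Suc i) = (A - 1 gchoose i)"
      using gbinomial_Suc_Suc[of "A - 1" i] by simp
    moreover have "of_nat (Suc i) * (A gchoose Suc i) = A * (A - 1 gchoose i)"
      using gbinomial_absorption[of i A] by simp
    moreover have "(of_nat (Suc i) :: rat) \<noteq> 0" by (rule of_nat_neq_0)
    ultimately have "A * ((A gchoose j) - (A - 1 gchoose j)) / of_nat j = (A gchoose j)"
      unfolding j by (metis nonzero_mult_div_cancel_left)
    then have "(-1)^j * (A * ((A gchoose j) - (A - 1 gchoose j)) / of_nat j) = (-1)^j * (A gchoose j)" by simp
    then show "A * ((-1)^j / of_nat j * ((A gchoose j) - (A - 1 gchoose j))) = (-1)^j * (A gchoose j)"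
      by (simp add: mult_ac)
  qed
  also have "\<dots> = (\<Sum>j\<le>n. (A gchoose j) * (-1)^j) - 1"
    by (subst sum.atMost_shift) (simp add: sum.atLeast1_atMost_eq mult.commute)
  also have "\<dots> = (A - 1 gchoose n) - 1"
    unfolding gbinomial_sum_lower_neg by (simp add: n_eq)
  finally show ?thesis using assms by (simp add: field_simps)
qed

lemma G_add:
  assumes "\<And>a. 0 < a \<Longrightarrow> a \<le> m \<Longrightarrow> x + of_nat a \<noteq> 0"
  shows "G (x + of_nat m) = G x + (\<Sum>a=1..m. ((x + of_nat a - 1 gchoose n) - 1) / (x + of_nat a))"
  using assms
proof (induction m)
  case (Suc m)
  then have IH: "G (x + of_nat m) = G x + (\<Sum>a=1..m. ((x + of_nat a - 1 gchoose n) - 1) / (x + of_nat a))" by simp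
  have nz: "x + of_nat (Suc m) \<noteq> 0" using Suc.prems by blast
  have m: "x + of_nat (Suc m) - 1 = x + of_nat m" by simp
  show ?case using G_step[OF nz] unfolding m IH by (simp add: m del: of_nat_Suc)
qed simp

lemma pcong_P_prod:
  assumes "d \<in> pint" "\<And>i. i \<in> I \<Longrightarrow> f i \<in> pint"
  shows "pcong 1 (\<Prod>i\<in>I. 1 + P * d * f i) 1"
proof -
  have "pcong 1 (\<Prod>i\<in>I. 1 + P * d * f i) (\<Prod>i\<in>I. 1)"
    using assms by (intro pcong_prod) (auto intro!: pcongI[of _ _ _ "d * f _"])
  then show ?thesis by simp
qed

lemma pcong_P_scale: "pcong 1 u v \<Longrightarrow> d \<in> pint \<Longrightarrow> pcong 2 (P * d * u) (P * d * v)"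
  using pcong_P_mult[OF pcong_cmult, of 1 u v d 1] by (simp only: one_add_one power_one_right mult.assoc)

text \<open>To first order the j-th term is -p d/j^2, and the sum of 1/j^2 vanishes modulo
  p.\<close>

lemma G_P:
  assumes d: "d \<in> pint"
  shows "pcong 2 (G (P * d)) 0"
proof -
  have "pcong 2 (G (P * d)) (\<Sum>j=1..n. P * (- d) * (1 / (of_nat j)\<^sup>2))"
    unfolding G_def
  proof (intro pcong_sum)
    fix j assume j: "j \<in> {1..n}"
    have u: "1 / of_nat i \<in> pint" if "i \<in> {1..j}" for i
      using that j by (intro pint_inverse_small) (auto simp: n_eq)
    have "(P * d gchoose j) = (-1)^j * (- (P * d) / of_nat j) * (\<Prod>i=1..j - 1. 1 + P * (- d) * (1 / of_nat i))"
      using gbinomial_minus_prod[of j "- (P * d)"] j by simp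
    then have "(-1)^j / of_nat j * (P * d gchoose j) = P * (- d) * (1 / (of_nat j)\<^sup>2 * (\<Prod>i=1..j - 1. 1 + P * (- d) * (1 / of_nat i)))"
      by (cases "even j") (simp_all add: power2_eq_square)
    also have "pcong 2 \<dots> (P * (- d) * (1 / (of_nat j)\<^sup>2 * 1))"
    proof (intro pcong_P_scale pcong_cmult pcong_P_prod)
      show "1 / (of_nat j)\<^sup>2 \<in> pint" using j by (intro pint_divide punit_power punit_small) (auto simp: n_eq)
    qed (use d u in auto)
    finally show "pcong 2 ((-1)^j / of_nat j * (P * d gchoose j)) (P * (- d) * (1 / (of_nat j)\<^sup>2))" by simp
  qed
  also have "(\<Sum>j=1..n. P * (- d) * (1 / (of_nat j)\<^sup>2)) = P * (- d) * (\<Sum>j=1..n. 1 / (of_nat j)\<^sup>2)"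
    by (simp add: sum_distrib_left)
  also have "pcong 2 \<dots> (P * (- d) * 0)"
    using d by (intro pcong_P_scale harmonic2_n) auto
  finally show ?thesis by simp
qed

text \<open>The n consecutive numerator factors run through x = p d itself, because 0 < a \<le> n.
  This yields one factor p, so the remaining factors are needed only modulo p.\<close>

lemma gbinomial_near:
  assumes d: "d \<in> pint" and a: "0 < a" "a \<le> n"
  shows "pcong 2 (P * d + of_nat a - 1 gchoose n) (P * d * ((-1)^a / (of_nat a * of_nat (n choose a))))"
proof -
  define x where "x = P * d"
  obtain r where r: "n = a + r" using a by (metis le_add_diff_inverse)
  obtain b where b: "a = Suc b" using a by (cases a) auto
  have u: "1 / of_nat i \<in> pint" if "i \<in> {1..n}" for i
    using that by (intro pint_inverse_small) (auto simp: n_eq)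
  have sgn: "(-1 :: rat)^r = (-1)^a"
  proof -
    have "even (a + r)" unfolding r[symmetric] n_eq by simp
    then show ?thesis by (auto simp: minus_one_power_iff)
  qed
  have "(x + of_nat a - 1 gchoose n) = pochhammer (x - of_nat r) n / fact n"
    unfolding gbinomial_pochhammer' by (simp add: r algebra_simps)
  also have "pochhammer (x - of_nat r) n = pochhammer (x - of_nat r) r * pochhammer x a"
    using pochhammer_product[of r n "x - of_nat r"] by (simp add: r)
  also have "\<dots> / fact n = x * ((-1)^r * fact r * fact b / fact n * ((\<Prod>i=1..r. 1 - x / of_nat i) * (\<Prod>i=1..b. 1 + x / of_nat i)))"
    unfolding pochhammer_minus_prod b pochhammer_Suc_prod by simp
  also have "fact r * fact b / fact n = 1 / (of_nat a * of_nat (n choose a) :: rat)"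
  proof -
    have "(of_nat (n choose a) :: rat) = fact n / (fact a * fact r)"
      using a r by (subst binomial_fact) auto
    moreover have "(fact a :: rat) = of_nat a * fact b" by (simp add: b)
    ultimately show ?thesis using a by simp
  qed
  then have "(-1)^r * fact r * fact b / fact n = ((-1)^a / (of_nat a * of_nat (n choose a)) :: rat)"
    unfolding sgn by (metis (no_types) mult.assoc mult.right_neutral times_divide_eq_right)
  finally have "(x + of_nat a - 1 gchoose n) = P * d * ((-1)^a / (of_nat a * of_nat (n choose a)) * ((\<Prod>i=1..r. 1 + P * (- d) * (1 / of_nat i)) * (\<Prod>i=1..b. 1 + P * d * (1 / of_nat i))))"
    by (simp add: x_def)
  also have "pcong 2 \<dots> (P * d * ((-1)^a / (of_nat a * of_nat (n choose a)) * (1 * 1)))"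
  proof (intro pcong_P_scale pcong_cmult pcong_mult pcong_P_prod)
    show "(-1)^a / (of_nat a * of_nat (n choose a)) \<in> pint"
      using a by (intro pint_divide punit_mult punit_small punit_binomial) (auto simp: n_eq)
  qed (use d u r b in auto)
  finally show ?thesis by (simp add: x_def)
qed

text \<open>Starting from p d, where \<open>G\<close> vanishes modulo p^2, M unit steps are taken.
  The terms -1/(x + a) contribute -K + x e and the near-zero binomial coefficients contribute -x
  W.\<close>

lemma G_M:
  assumes d: "d \<in> pint"
  shows "pcong 2 (G (P * d + of_nat M)) (- K + P * d * (e - W))"
proof -
  define x where "x = P * d"
  have ua: "of_nat a \<in> punit" if "a \<in> {1..M}" for a using that by (intro punit_small) auto
  have ux: "x + of_nat a \<in> punit" if "a \<in> {1..M}" for a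
  proof -
    have "pcong 1 (x + of_nat a) (of_nat a)" using d by (intro pcongI[of _ _ _ d]) (auto simp: x_def)
    then show ?thesis using ua[OF that] punit_pcong[of 0] by simp
  qed
  have nz: "x + of_nat a \<noteq> 0" if "0 < a" "a \<le> M" for a using ux[of a] that punit_nonzero by auto
  have "G (x + of_nat M) = G x + (\<Sum>a=1..M. ((x + of_nat a - 1 gchoose n) - 1) / (x + of_nat a))"
    using nz by (rule G_add)
  also have "pcong 2 \<dots> (0 + (\<Sum>a=1..M. x * ((-1)^a / ((of_nat a)\<^sup>2 * of_nat (n choose a))) - 1 / of_nat a + x * (1 / (of_nat a)\<^sup>2)))"
  proof (intro pcong_add pcong_sum)
    show "pcong 2 (G x) 0" unfolding x_def using d by (rule G_P)
    fix a assume a: "a \<in> {1..M}"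
    define u :: rat where "u = (-1)^a / (of_nat a * of_nat (n choose a))"
    have u: "u \<in> pint" unfolding u_def
      using a by (intro pint_divide punit_mult punit_small punit_binomial) (auto simp: n_eq)
    have a0: "(of_nat a :: rat) \<noteq> 0" using punit_nonzero[OF ua[OF a]] .
    have "pcong 2 (((x + of_nat a - 1 gchoose n) - 1) / (x + of_nat a)) ((x * u - 1) / (x + of_nat a))"
      unfolding x_def u_def using d a ux[OF a]
      by (intro pcong_divide pcong_diff pcong_refl gbinomial_near) (auto simp: n_eq x_def)
    also have "pcong 2 ((x * u - 1) / (x + of_nat a)) (x * (u / of_nat a) - 1 / of_nat a + x * (1 / (of_nat a)\<^sup>2))"
    \<comment> \<open>The cofactor is the exact remainder after expanding 1/(x + a) to first order
      in x = p d.\<close>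
    proof (rule pcongI[of _ _ _ "- (d\<^sup>2 * (u * of_nat a + 1) / ((of_nat a)\<^sup>2 * (x + of_nat a)))"])
      have "(x * u - 1) / (x + z) = x * (u / z) - 1 / z + x * (1 / z\<^sup>2) + - (x\<^sup>2 * (u * z + 1) / (z\<^sup>2 * (x + z)))"
        if "z \<noteq> 0" "x + z \<noteq> 0" for z
        using that by (simp add: divide_simps) (simp add: algebra_simps power2_eq_square)
      from this[OF a0] nz[of a] a
      show "(x * u - 1) / (x + of_nat a) = x * (u / of_nat a) - 1 / of_nat a + x * (1 / (of_nat a)\<^sup>2)
         + P\<^sup>2 * (- (d\<^sup>2 * (u * of_nat a + 1) / ((of_nat a)\<^sup>2 * (x + of_nat a))))"
        by (simp add: x_def power_mult_distrib)
    qed (use d u ua[OF a] ux[OF a] in auto)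
    also have "u / of_nat a = (-1)^a / ((of_nat a)\<^sup>2 * of_nat (n choose a))"
      by (simp add: u_def power2_eq_square mult_ac)
    finally show "pcong 2 (((x + of_nat a - 1 gchoose n) - 1) / (x + of_nat a))
      (x * ((-1)^a / ((of_nat a)\<^sup>2 * of_nat (n choose a))) - 1 / of_nat a + x * (1 / (of_nat a)\<^sup>2))" .
  qed
  also have "0 + (\<Sum>a=1..M. x * ((-1)^a / ((of_nat a)\<^sup>2 * of_nat (n choose a))) - 1 / of_nat a + x * (1 / (of_nat a)\<^sup>2))
     = - K + P * d * (e - W)"
    unfolding sum.distrib sum_subtractf sum_distrib_left[symmetric] K_def e_def W_def x_def by (simp add: algebra_simps)
  finally show ?thesis by (simp add: x_def)
qed

end

section \<open>The sums over \<open>k\<close> modulo \<open>p\<^sup>3\<close>\<close>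

lemma pochhammer_three_halves: "pochhammer (3/2) k = (2 * of_nat k + 1) * pochhammer (1/2 :: rat) k"
  using pochhammer_rec[of "1/2 :: rat" k] pochhammer_Suc[of "1/2 :: rat" k] by (simp add: field_simps)

text \<open>The 2 m + 1 factors lie symmetrically about x; pairing x + i with x - i makes the
  first-order terms cancel.\<close>

lemma pochhammer_centred:
  "pochhammer (x - of_nat m) (2 * m + 1)
     = (-1)^m * x * (fact m)\<^sup>2 * ((\<Prod>i=1..m. 1 + x / of_nat i) * (\<Prod>i=1..m. 1 - x / of_nat i))" for x :: rat
proof -
  have "pochhammer (x - of_nat m) (2 * m + 1) = pochhammer (x - of_nat m) m * pochhammer x (Suc m)"
    using pochhammer_product[of m "2 * m + 1" "x - of_nat m"] by simp
  then show ?thesis unfolding pochhammer_minus_prod pochhammer_Suc_prod by (simp add: power2_eq_square)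
qed

context quarter_prime
begin

section \<open>The product prefactors\<close>

definition c :: rat where "c = of_nat (n choose M)"
definition m :: rat where "m = c / 2 ^ n"

lemma punit_c [simp, intro]: "c \<in> punit"
  unfolding c_def by (rule punit_binomial) (auto simp: n_eq)

lemma punit_m [simp, intro]: "m \<in> punit"
  unfolding m_def by auto

lemma c_fact: "c = fact n / (fact M)\<^sup>2"
  unfolding c_def by (subst binomial_fact) (auto simp: n_eq power2_eq_square)

lemma c_sign: "(-1) ^ M * c = m * (2 ^ n * (-1) ^ M)"
  by (simp add: m_def)

lemma pint_halves [simp, intro]: "1/2 \<in> pint" "- (1/2) \<in> pint" "1/4 \<in> pint" "- (1/4) \<in> pint" "3/4 \<in> pint" "- (3/4) \<in> pint"
  by auto

text \<open>1/2 = p/2 - n, so the p factors are centred at p/2. The symmetry removes the second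
  digit and \<open>harmonic2_n\<close> the third.\<close>

lemma half_pochhammer:
  obtains V where "pochhammer (1/2) p = P / 2 * (fact n)\<^sup>2 * V" "tri V 1 0 0"
proof
  let ?V = "(\<Prod>i=1..n. 1 + P * (1/2 / of_nat i)) * (\<Prod>i=1..n. 1 + P * (- (1/2) / of_nat i))"
  have x: "P / 2 - of_nat n = 1/2" using P_eq(2) by (simp add: field_simps)
  have s: "(-1 :: rat) ^ n = 1" by (simp add: n_eq)
  show "pochhammer (1/2) p = P / 2 * (fact n)\<^sup>2 * ?V"
    using pochhammer_centred[of "P / 2" n] unfolding x s p_eq_n[symmetric] by simp
  show "tri ?V 1 0 0"
    by (rule tri_eqI[OF tri_mult[OF tri_prod_harmonic[of "1/2"] tri_prod_harmonic[of "- (1/2)"]]])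
       (auto simp: power2_eq_square field_simps)
qed

lemma half_pochhammer_n:
  obtains T where "pochhammer (1/2) n = fact n * T" "tri T 1 (- H / 2) (H\<^sup>2 / 8)"
proof
  have x: "P / 2 - of_nat n = 1/2" using P_eq(2) by (simp add: field_simps)
  have s: "(-1 :: rat) ^ n = 1" by (simp add: n_eq)
  show "pochhammer (1/2) n = fact n * (\<Prod>i=1..n. 1 + P * (- (1/2) / of_nat i))"
    using pochhammer_minus_prod[of "P / 2" n] unfolding x s by simp
  show "tri (\<Prod>i=1..n. 1 + P * (- (1/2) / of_nat i)) 1 (- H / 2) (H\<^sup>2 / 8)"
    by (rule tri_eqI[OF tri_prod_harmonic]) (auto simp: power2_eq_square)
qed

lemma half_pochhammer_over_fact:
  obtains Y where "pochhammer (1/2) p / fact (2 * n) = P / 2 * Y" "tri Y 1 H (H\<^sup>2 / 2)"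
proof -
  obtain V where V: "pochhammer (1/2) p = P / 2 * (fact n)\<^sup>2 * V" "tri V 1 0 0" by (rule half_pochhammer)
  define D where "D = (\<Prod>i=1..n. 1 + P * (- 1 / of_nat i))"
  have D: "tri D 1 (-1 * H) ((-1)\<^sup>2 * H\<^sup>2 / 2)"
    unfolding D_def by (rule tri_prod_harmonic) auto
  have "pochhammer (1/2) p / fact (2 * n) = P / 2 * (V * (1 / D))"
    unfolding V fact_2n D_def[symmetric] by simp
  moreover have "tri (V * (1 / D)) 1 H (H\<^sup>2 / 2)"
    by (rule tri_eqI[OF tri_mult[OF V(2) tri_inverse[OF D]]]) (simp_all add: power2_eq_square)
  ultimately show ?thesis using that by blast
qed

text \<open>1/4 = p/4 - M, so the n + 1 = 2 M + 1 factors are centred at p/4. Here the power sum of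
  order two runs only to M and survives as \<open>e\<close>. The middle factor puts p into the
  denominator, which compensates the p in \<open>half_pochhammer\<close>.\<close>

lemma quarter_pochhammer:
  obtains X where "fact n / pochhammer (1/4) (Suc n) = 4 / P * ((-1) ^ M * c) * X" "tri X 1 0 (e / 16)"
proof -
  define D where "D = (\<Prod>i=1..M. 1 + P * (1/4 / of_nat i)) * (\<Prod>i=1..M. 1 + P * (- (1/4) / of_nat i))"
  have D: "tri D 1 0 (- e / 16)"
    unfolding D_def by (rule tri_eqI[OF tri_mult[OF tri_prod_M tri_prod_M]]) (auto simp: power2_eq_square field_simps)
  have q: "pochhammer (1/4) (Suc n) = (-1)^M * (P / 4) * (fact M)\<^sup>2 * D"
  proof -
    have x: "P / 4 - of_nat M = 1/4" using P_eq(1) by (simp add: field_simps)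
    have k: "2 * M + 1 = Suc n" by (simp add: n_eq)
    show ?thesis using pochhammer_centred[of "P / 4" M] unfolding x k D_def by simp
  qed
  have "fact n / pochhammer (1/4) (Suc n) = 4 / P * ((-1) ^ M * c) * (1 / D)"
    unfolding q c_fact by (cases "even M") (simp_all add: field_simps)
  moreover have "tri (1 / D) 1 0 (e / 16)" using tri_inverse[OF D] by simp
  ultimately show ?thesis using that by blast
qed

section \<open>The two terminating sums to third order\<close>

text \<open>The remaining sum of \<open>sum_minus_half_two_power\<close>; its second upper entry is
  -p/2, so every term with j > 0 is divisible by p.\<close>

definition SE :: "rat \<Rightarrow> rat" where
  "SE y = (\<Sum>j\<le>n. (- y gchoose j) * ((- of_nat n - 1/2) gchoose j))"

text \<open>Pulling p/(2 j) out of C(-p/2, j) leaves a product 1 + O(p) whose first-order part is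
  half a harmonic number. Since p is already in front, \<open>r\<close> is needed only modulo
  p^2.\<close>

lemma SE_pcong:
  assumes y: "y \<in> pint"
  obtains r where "SE y = 1 + P * (r / 2)"
    "pcong 2 r (G (- y) + P * (1/2 * (\<Sum>j=1..n. (-1)^j / of_nat j * (- y gchoose j) * (\<Sum>i<j. 1 / of_nat i))))"
proof -
  define f where "f j = (-1)^j / of_nat j * (- y gchoose j)" for j
  define g where "g j = (\<Prod>i=1..j - 1. 1 + P * (1 / of_nat (2 * i)))" for j
  define r where "r = (\<Sum>j=1..n. f j * g j)"
  have f: "f j \<in> pint" if "j \<in> {1..n}" for j
    using that y unfolding f_def by (intro pint_mult pint_divide punit_small pint_gbinomial) (auto simp: n_eq)
  have P2: "- of_nat n - 1/2 = - (P / 2)" using P_eq(2) by (simp add: field_simps)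
  have "SE y = 1 + (\<Sum>j=1..n. (- y gchoose j) * (- (P / 2) gchoose j))"
    unfolding SE_def P2 by (subst sum.atMost_shift) (simp add: sum.atLeast1_atMost_eq)
  also have "(\<Sum>j=1..n. (- y gchoose j) * (- (P / 2) gchoose j)) = (\<Sum>j=1..n. P / 2 * (f j * g j))"
    by (intro sum.cong refl) (simp add: gbinomial_minus_prod f_def g_def mult_ac)
  also have "\<dots> = P * (r / 2)" by (simp add: r_def sum_distrib_left mult_ac)
  finally have 1: "SE y = 1 + P * (r / 2)" .
  have g: "pcong 2 (g j) (1 + P * (1/2 * (\<Sum>i<j. 1 / of_nat i)))" if "j \<in> {1..n}" for j
  proof -
    have u: "1 / of_nat (2 * i) \<in> pint" if "i \<in> {1..j - 1}" for i
      using that \<open>j \<in> {1..n}\<close> by (intro pint_inverse_small) (auto simp: n_eq)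
    have "pcong 2 (g j) (1 + (\<Sum>i=1..j - 1. 1 / of_nat (2 * i)) * P)"
      unfolding g_def by (rule tri_pcong_2[OF tri_prod]) (use u in auto)
    also have "(\<Sum>i=1..j - 1. 1 / of_nat (2 * i)) = 1/2 * (\<Sum>i=1..j - 1. 1 / of_nat i :: rat)"
      by (simp add: sum_distrib_left)
    also have "(\<Sum>i=1..j - 1. 1 / of_nat i :: rat) = (\<Sum>i<j. 1 / of_nat i)"
      by (rule sum.mono_neutral_left) auto
    finally show ?thesis by (simp add: mult.commute)
  qed
  have "pcong 2 r (\<Sum>j=1..n. f j * (1 + P * (1/2 * (\<Sum>i<j. 1 / of_nat i))))"
    unfolding r_def using f g by (intro pcong_sum pcong_cmult) auto
  also have "\<dots> = (\<Sum>j=1..n. f j + P * (1/2 * (f j * (\<Sum>i<j. 1 / of_nat i))))"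
    by (intro sum.cong refl) (simp add: distrib_left)
  also have "\<dots> = G (- y) + P * (1/2 * (\<Sum>j=1..n. f j * (\<Sum>i<j. 1 / of_nat i)))"
    by (simp only: sum.distrib sum_distrib_left[symmetric] G_def f_def)
  also have "(\<Sum>j=1..n. f j * (\<Sum>i<j. 1 / of_nat i)) = (\<Sum>j=1..n. (-1)^j / of_nat j * (- y gchoose j) * (\<Sum>i<j. 1 / of_nat i))"
    by (simp only: f_def)
  finally show ?thesis using that 1 by blast
qed

lemma sum_choose_M_cut:
  "(\<Sum>j=1..n. (-1)^j / of_nat j * (of_nat M gchoose j) * x j) = (\<Sum>j=1..M. (-1)^j / of_nat j * of_nat (M choose j) * (x j :: rat))"
  by (rule sum.mono_neutral_cong_right) (auto simp: n_eq binomial_gbinomial[symmetric] binomial_eq_0)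

text \<open>In a correction already multiplied by p the upper entry may be replaced by M, and row M
  ends at j = M, where closed forms are available.\<close>

lemma pcong_sum_choose_M:
  assumes z: "pcong 1 z (of_nat M)" and x: "\<And>j. j \<in> {1..n} \<Longrightarrow> x j \<in> pint"
  shows "pcong 1 (\<Sum>j=1..n. (-1)^j / of_nat j * (z gchoose j) * x j) (\<Sum>j=1..M. (-1)^j / of_nat j * of_nat (M choose j) * x j)"
proof -
  have "pcong 1 (\<Sum>j=1..n. (-1)^j / of_nat j * (z gchoose j) * x j) (\<Sum>j=1..n. (-1)^j / of_nat j * (of_nat M gchoose j) * x j)"
  proof (intro pcong_sum)
    fix j assume j: "j \<in> {1..n}"
    have "pcong 1 ((-1)^j / of_nat j * x j * (z gchoose j)) ((-1)^j / of_nat j * x j * (of_nat M gchoose j))"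
      using j x by (intro pcong_cmult pcong_gbinomial z pint_mult pint_divide punit_small) (auto simp: n_eq)
    then show "pcong 1 ((-1)^j / of_nat j * (z gchoose j) * x j) ((-1)^j / of_nat j * (of_nat M gchoose j) * x j)"
      by (simp add: mult_ac)
  qed
  then show ?thesis unfolding sum_choose_M_cut .
qed

lemma tri_P_add: "r \<in> pint \<Longrightarrow> pcong 2 r (a + b * P) \<Longrightarrow> a \<in> pint \<Longrightarrow> b \<in> pint \<Longrightarrow> tri (1 + P * r) 1 a b"
  using tri_add[OF tri_const[of 1] tri_P_mult[of r a b]] by auto

lemma pint_sum_inverse: "j \<le> n \<Longrightarrow> (\<Sum>i<j. 1 / of_nat i) \<in> pint"
proof -
  assume "j \<le> n"
  then have "1 / of_nat i \<in> pint" if "i < j" for i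
    using that by (cases "i = 0") (auto intro!: pint_inverse_small simp: n_eq)
  then show ?thesis by auto
qed

text \<open>As -1/4 = M - p/4, the main part is \<open>G_M\<close> with d = -1/4 and the correction
  is computed in row M. Then K is eliminated by \<open>harmonic_K\<close>.\<close>

lemma tri_SE: "tri (SE (1/4)) 1 (- (3/4) * H) (9/32 * H\<^sup>2 - e/8 + W/8)"
proof -
  obtain r where r: "SE (1/4) = 1 + P * (r / 2)"
    "pcong 2 r (G (- (1/4)) + P * (1/2 * (\<Sum>j=1..n. (-1)^j / of_nat j * (- (1/4) gchoose j) * (\<Sum>i<j. 1 / of_nat i))))"
    by (rule SE_pcong[of "1/4"]) auto
  have z: "- (1/4) = P * (- (1/4)) + of_nat M" using P_eq(1) by (simp add: field_simps)
  have "pcong 1 (- (1/4)) (of_nat M)"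
    by (rule pcongI[of _ _ _ "- (1/4)"]) (use P_eq(1) in \<open>auto simp: field_simps\<close>)
  then have "pcong 1 (\<Sum>j=1..n. (-1)^j / of_nat j * (- (1/4) gchoose j) * (\<Sum>i<j. 1 / of_nat i)) ((K\<^sup>2 - e) / 2)"
    using pcong_sum_choose_M[of "- (1/4)" "\<lambda>j. \<Sum>i<j. 1 / of_nat i"] pint_sum_inverse
    unfolding sum_signed_choose_over_harmonic K_def[symmetric] e_def[symmetric] by auto
  from pcong_P_scale[OF this, of "1/2"]
  have s: "pcong 2 (P * (1/2 * (\<Sum>j=1..n. (-1)^j / of_nat j * (- (1/4) gchoose j) * (\<Sum>i<j. 1 / of_nat i)))) (P * (1/2 * ((K\<^sup>2 - e) / 2)))"
    by (simp only: mult.assoc pint_halves simp_thms)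
  have g: "pcong 2 (G (- (1/4))) (- K + P * (- (1/4)) * (e - W))"
    using G_M[of "- (1/4)"] unfolding z[symmetric] by auto
  have r2: "pcong 2 (r / 2) (- K / 2 + ((K\<^sup>2 - e) / 4 - (e - W) / 4) / 2 * P)"
  proof -
    have "pcong 2 r (- K + P * (- (1/4)) * (e - W) + P * (1/2 * ((K\<^sup>2 - e) / 2)))"
      by (rule pcong_trans[OF r(2)]) (intro pcong_add g s)
    then have "pcong 2 (r / 2) ((- K + P * (- (1/4)) * (e - W) + P * (1/2 * ((K\<^sup>2 - e) / 2))) / 2)"
      by (rule pcong_divide) auto
    then show ?thesis by (rule pcong_eq_trans) (simp add: field_simps)
  qed
  then have ri: "r / 2 \<in> pint" by (rule pcong_pint) auto
  have "tri (SE (1/4)) 1 (- K / 2) (((K\<^sup>2 - e) / 4 - (e - W) / 4) / 2)"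
    unfolding r(1) using ri r2 by (rule tri_P_add) auto
  moreover have "pcong 2 (- K / 2) (- (3/4) * H + P * (e / 8))"
    using pcong_divide[OF pcong_minus[OF harmonic_K] punit_2] by (rule pcong_eq_trans) (simp add: field_simps)
  ultimately have t: "tri (SE (1/4)) 1 (- (3/4) * H) (((K\<^sup>2 - e) / 4 - (e - W) / 4) / 2 + e / 8)"
    by (rule tri_adjust1) auto
  have "pcong 1 (K\<^sup>2) ((3/2 * H)\<^sup>2)" by (rule pcong_power[OF K_pcong_1]) auto
  then have "pcong 1 (((K\<^sup>2 - e) / 4 - (e - W) / 4) / 2 + e / 8) ((((3/2 * H)\<^sup>2 - e) / 4 - (e - W) / 4) / 2 + e / 8)"
    by (intro pcong_add pcong_divide pcong_diff pcong_refl) auto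
  from tri_adjust[OF t this] have "tri (SE (1/4)) 1 (- (3/4) * H) ((((3/2 * H)\<^sup>2 - e) / 4 - (e - W) / 4) / 2 + e / 8)"
    by auto
  then show ?thesis by (rule tri_eqI) (simp_all add: field_simps power2_eq_square)
qed

text \<open>The remaining sum of \<open>sum_alternating_half_choose\<close> with z = n + y - 1. The
  last factor is (p/2)/(p/2 - i): it is 1 at i = 0 and divisible by p otherwise.\<close>

definition SQ :: "rat \<Rightarrow> rat" where
  "SQ z = (\<Sum>i\<le>n. (-1)^i * of_nat (n choose i) * pochhammer (- z) i / pochhammer (- 1/2 - 2 * of_nat n) i
             * ((of_nat n + 1/2) / (of_nat n + 1/2 - of_nat i)))"

lemma punit_n_diff:
  assumes "j < n"
  shows "of_nat n - of_nat j \<in> punit"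
proof -
  have "of_nat (n - j) \<in> punit" using assms by (intro punit_small) (auto simp: n_eq)
  then show ?thesis using assms by (simp add: of_nat_diff)
qed

text \<open>Compared with \<open>SE_pcong\<close>, the first-order correction has two parts: 1/i
  from the factor (p/2)/(p/2 - i), and the reciprocals of n - j from the Pochhammer symbol in the
  denominator.\<close>

lemma SQ_pcong:
  assumes z: "z \<in> pint"
  obtains r where "SQ z = 1 + P * (- r / 2)"
    "pcong 2 r (G z + P * (1/2 * (\<Sum>i=1..n. (-1)^i / of_nat i * (z gchoose i) * (1 / of_nat i - (\<Sum>j<i. 1 / (of_nat n - of_nat j))))))"
proof -
  define f where "f i = (-1)^i / of_nat i * (z gchoose i)" for i
  define R where "R i = (\<Prod>j<i. 1 + P * (1/2 / (of_nat n - of_nat j)))" for i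
  define S where "S i = 1 + P * (- (1/2) / of_nat i)" for i
  define r where "r = (\<Sum>i=1..n. f i * (1 / R i * (1 / S i)))"
  have f: "f j \<in> pint" if "j \<in> {1..n}" for j
    using that z unfolding f_def by (intro pint_mult pint_divide punit_small pint_gbinomial) (auto simp: n_eq)
  define h :: "nat \<Rightarrow> rat" where "h i = (\<Sum>j<i. 1 / (of_nat n - of_nat j))" for i
  define q where "q i = ((1/2 * h i)\<^sup>2 - (\<Sum>j<i. (1/2 / (of_nat n - of_nat j))\<^sup>2)) / 2" for i
  have h: "(\<Sum>j<i. 1/2 / (of_nat n - of_nat j)) = 1/2 * h i" for i
    by (simp only: h_def sum_distrib_left times_divide_eq_right mult_1_right)
  have R: "tri (R i) 1 (1/2 * h i) (q i)" if "i \<in> {1..n}" for i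
    unfolding R_def q_def h[symmetric] by (rule tri_prod) (use pint_divide[OF pint_halves(1) punit_n_diff] that in auto)
  have S: "tri (S i) 1 (- (1/2) / of_nat i) 0" if "i \<in> {1..n}" for i
    unfolding S_def using that by (intro triI pint_divide punit_small) (auto simp: n_eq)
  have RS: "tri (1 / R i * (1 / S i)) 1 (1/2 * (1 / of_nat i - h i))
      (((1/2) / of_nat i)\<^sup>2 - (1/2 * h i) * ((1/2) / of_nat i) + ((1/2 * h i)\<^sup>2 - q i))"
    if "i \<in> {1..n}" for i
    by (rule tri_eqI[OF tri_mult[OF tri_inverse[OF R[OF that]] tri_inverse[OF S[OF that]]]])
       (simp_all add: power2_eq_square right_diff_distrib)
  have nn: "- 1/2 - 2 * of_nat n = - of_nat n - P / 2" using P_eq(2) by (simp add: field_simps)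
  have n2: "of_nat n + 1/2 = P / 2" using P_eq(2) by (simp add: field_simps)
  \<comment> \<open>The denominator parameter is -n - p/2, so its Pochhammer symbol is that of -n
    times \<open>R i\<close>; the symbol of -n cancels against the binomial coefficient.\<close>
  have summand: "(-1)^i * of_nat (n choose i) * pochhammer (- z) i / pochhammer (- 1/2 - 2 * of_nat n) i
             * ((of_nat n + 1/2) / (of_nat n + 1/2 - of_nat i)) = - (P / 2) * (f i * (1 / R i * (1 / S i)))" if i: "i \<in> {1..n}" for i
  proof -
    have gz: "pochhammer (- z) i = (-1)^i * fact i * (z gchoose i)"
      unfolding gbinomial_pochhammer by (cases "even i") auto
    have gn: "(-1)^i * of_nat (n choose i) = pochhammer (- of_nat n) i / (fact i :: rat)"
      unfolding binomial_gbinomial gbinomial_pochhammer by (cases "even i") auto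
    have njz: "(of_nat n - of_nat j :: rat) \<noteq> 0" if "j < i" for j
      using that i by (simp del: of_nat_diff)
    have pr: "pochhammer (- of_nat n - P / 2) i = pochhammer (- of_nat n) i * R i"
      unfolding pochhammer_prod R_def prod.distrib[symmetric] atLeast0LessThan
      using njz by (intro prod.cong refl) (auto simp: field_simps)
    have nz: "pochhammer (- of_nat n :: rat) i \<noteq> 0"
      using njz unfolding pochhammer_prod atLeast0LessThan by (auto simp: prod_zero_iff)
    have iz: "(of_nat i :: rat) \<noteq> 0" using i by auto
    have "P / 2 - of_nat i = - of_nat i * S i" unfolding S_def using iz by (simp add: field_simps)
    then have s1: "(P / 2) / (P / 2 - of_nat i) = - (P / 2) / of_nat i * (1 / S i)" by simp
    have s2: "pochhammer (- of_nat n) i / pochhammer (- of_nat n - P / 2) i = 1 / R i"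
      unfolding pr using nz by simp
    have "((-1)^i * of_nat (n choose i)) * pochhammer (- z) i / pochhammer (- of_nat n - P / 2) i * ((P / 2) / (P / 2 - of_nat i))
      = (-1)^i * (z gchoose i) * (pochhammer (- of_nat n) i / pochhammer (- of_nat n - P / 2) i) * ((P / 2) / (P / 2 - of_nat i))"
      unfolding gz gn by simp
    also have "\<dots> = (-1)^i * (z gchoose i) * (1 / R i) * (- (P / 2) / of_nat i * (1 / S i))"
      unfolding s1 s2 ..
    finally have "((-1)^i * of_nat (n choose i)) * pochhammer (- z) i / pochhammer (- of_nat n - P / 2) i * ((P / 2) / (P / 2 - of_nat i))
      = (-1)^i * (z gchoose i) * (1 / R i) * (- (P / 2) / of_nat i * (1 / S i))" .
    then show ?thesis unfolding nn n2 f_def by (simp add: mult_ac)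
  qed
  have "SQ z = 1 + (\<Sum>i=1..n. (-1)^i * of_nat (n choose i) * pochhammer (- z) i / pochhammer (- 1/2 - 2 * of_nat n) i
             * ((of_nat n + 1/2) / (of_nat n + 1/2 - of_nat i)))"
    unfolding SQ_def using P_nonzero n2 by (subst sum.atMost_shift) (simp add: sum.atLeast1_atMost_eq)
  also have "\<dots> = 1 + (\<Sum>i=1..n. - (P / 2) * (f i * (1 / R i * (1 / S i))))"
    using summand by (intro arg_cong2[of _ _ _ _ "(+)"] sum.cong refl) auto
  also have "(\<Sum>i=1..n. - (P / 2) * (f i * (1 / R i * (1 / S i)))) = - (P / 2) * r"
    by (simp only: r_def sum_distrib_left)
  finally have 1: "SQ z = 1 + P * (- r / 2)" by simp
  have "pcong 2 r (\<Sum>i=1..n. f i * (1 + (1/2 * (1 / of_nat i - h i)) * P))"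
    unfolding r_def using f by (intro pcong_sum pcong_cmult tri_pcong_2[OF RS]) auto
  also have "\<dots> = (\<Sum>i=1..n. f i + P * (1/2 * (f i * (1 / of_nat i - h i))))"
    by (intro sum.cong refl) (simp add: distrib_left)
  also have "\<dots> = G z + P * (1/2 * (\<Sum>i=1..n. f i * (1 / of_nat i - h i)))"
    by (simp only: sum.distrib sum_distrib_left[symmetric] G_def f_def)
  also have "(\<Sum>i=1..n. f i * (1 / of_nat i - h i)) = (\<Sum>i=1..n. (-1)^i / of_nat i * (z gchoose i) * (1 / of_nat i - (\<Sum>j<i. 1 / (of_nat n - of_nat j))))"
    by (simp only: f_def h_def)
  finally show ?thesis using that 1 by blast
qed

text \<open>Here n + 1/4 = M + p/4. In r/p the term W has coefficient -1/4 from \<open>G_M\<close>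
  and +1/2 from \<open>sum_signed_choose_over_shifted\<close>; the outer factor -1/2 gives -W/8,
  opposite to \<open>tri_SE\<close>. The digits in H match those of \<open>tri_SE\<close> up to
  sign.\<close>

lemma tri_SQ: "tri (SQ (of_nat n + 1/4)) 1 (3/4 * H) (9/32 * H\<^sup>2 - e/8 - W/8)"
proof -
  define h :: "nat \<Rightarrow> rat" where "h i = (\<Sum>j<i. 1 / (of_nat n - of_nat j))" for i
  define z :: rat where "z = of_nat n + 1/4"
  have zi: "z \<in> pint" unfolding z_def by auto
  have z: "z = P * (1/4) + of_nat M" using P_eq(1) by (simp add: z_def n_eq field_simps)
  obtain r where r: "SQ z = 1 + P * (- r / 2)"
    "pcong 2 r (G z + P * (1/2 * (\<Sum>i=1..n. (-1)^i / of_nat i * (z gchoose i) * (1 / of_nat i - h i))))"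
    unfolding h_def by (rule SQ_pcong[OF zi])
  have h: "h i \<in> pint" if "i \<in> {1..n}" for i
    unfolding h_def
  proof (intro pint_sum pint_divide)
    fix j assume j: "j \<in> {..<i}"
    have "of_nat (n - j) \<in> punit" using that j by (intro punit_small) (auto simp: n_eq)
    then show "(of_nat n - of_nat j :: rat) \<in> punit" using that j by (simp add: of_nat_diff)
  qed auto
  have hi: "1 / of_nat i - h i \<in> pint" if "i \<in> {1..n}" for i
    using that h by (intro pint_diff pint_inverse_small) (auto simp: n_eq)
  have "pcong 1 z (of_nat M)"
    unfolding z by (rule pcongI[of _ _ _ "1/4"]) auto
  from pcong_sum_choose_M[OF this hi]
  have "pcong 1 (\<Sum>i=1..n. (-1)^i / of_nat i * (z gchoose i) * (1 / of_nat i - h i))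
     (\<Sum>j=1..M. (-1)^j / of_nat j * of_nat (M choose j) * (1 / of_nat j - h j))" by auto
  also have "(\<Sum>j=1..M. (-1)^j / of_nat j * of_nat (M choose j) * (1 / of_nat j - h j))
     = (\<Sum>j=1..M. (-1)^j / of_nat j * of_nat (M choose j) * (1 / of_nat j)) - (\<Sum>j=1..M. (-1)^j / of_nat j * of_nat (M choose j) * h j)"
    by (simp only: right_diff_distrib sum_subtractf)
  also have "\<dots> = - (K\<^sup>2 + e) / 2 + W"
    unfolding h_def sum_signed_choose_over_square
    by (subst sum_signed_choose_over_shifted, simp add: n_eq, simp add: K_def e_def W_def)
  finally have "pcong 1 (\<Sum>i=1..n. (-1)^i / of_nat i * (z gchoose i) * (1 / of_nat i - h i)) (- (K\<^sup>2 + e) / 2 + W)" .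
  from pcong_P_scale[OF this, of "1/2"]
  have s: "pcong 2 (P * (1/2 * (\<Sum>i=1..n. (-1)^i / of_nat i * (z gchoose i) * (1 / of_nat i - h i)))) (P * (1/2 * (- (K\<^sup>2 + e) / 2 + W)))"
    by (simp only: mult.assoc pint_halves simp_thms)
  have g: "pcong 2 (G z) (- K + P * (1/4) * (e - W))"
    unfolding z by (rule G_M) auto
  have r2: "pcong 2 (- r / 2) (K / 2 + ((K\<^sup>2 - W) / 8) * P)"
  proof -
    have "pcong 2 r (- K + P * (1/4) * (e - W) + P * (1/2 * (- (K\<^sup>2 + e) / 2 + W)))"
      by (rule pcong_trans[OF r(2)]) (intro pcong_add g s)
    then have "pcong 2 (- r / 2) (- (- K + P * (1/4) * (e - W) + P * (1/2 * (- (K\<^sup>2 + e) / 2 + W))) / 2)"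
      by (intro pcong_divide pcong_minus) auto
    then show ?thesis by (rule pcong_eq_trans) (simp add: field_simps)
  qed
  then have ri: "- r / 2 \<in> pint" by (rule pcong_pint) auto
  have "tri (SQ z) 1 (K / 2) ((K\<^sup>2 - W) / 8)"
    unfolding r(1) using ri r2 by (rule tri_P_add) auto
  moreover have "pcong 2 (K / 2) (3/4 * H + P * (- e / 8))"
    using pcong_divide[OF harmonic_K punit_2] by (rule pcong_eq_trans) (simp add: field_simps)
  ultimately have t: "tri (SQ z) 1 (3/4 * H) ((K\<^sup>2 - W) / 8 + - e / 8)"
    by (rule tri_adjust1) auto
  have "pcong 1 (K\<^sup>2) ((3/2 * H)\<^sup>2)" by (rule pcong_power[OF K_pcong_1]) auto
  then have "pcong 1 ((K\<^sup>2 - W) / 8 + - e / 8) (((3/2 * H)\<^sup>2 - W) / 8 + - e / 8)"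
    by (intro pcong_add pcong_divide pcong_diff pcong_refl) auto
  from tri_adjust[OF t this] have "tri (SQ z) 1 (3/4 * H) (((3/2 * H)\<^sup>2 - W) / 8 + - e / 8)"
    by auto
  then show ?thesis unfolding z_def by (rule tri_eqI) (simp_all add: field_simps power2_eq_square)
qed

section \<open>Assembling the series\<close>

lemma minus_half_products:
  "(- 1/2 gchoose k) * (- 1/2 gchoose k) = (half_choose k :: rat)\<^sup>2"
  "(- 1/2 gchoose k) * (- 3/2 gchoose k) = (2 * of_nat k + 1) * (half_choose k :: rat)\<^sup>2"
proof -
  show "(- 1/2 gchoose k) * (- 1/2 gchoose k) = (half_choose k :: rat)\<^sup>2"
    unfolding gbinomial_minus_half by (cases "even k") (simp_all add: power2_eq_square)
  have "(- 3/2 gchoose k) = (2 * of_nat k + 1) * (- 1/2 gchoose k :: rat)"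
    by (simp add: gbinomial_pochhammer pochhammer_three_halves)
  then show "(- 1/2 gchoose k) * (- 3/2 gchoose k) = (2 * of_nat k + 1) * (half_choose k :: rat)\<^sup>2"
    unfolding gbinomial_minus_half by (cases "even k") (simp_all add: power2_eq_square)
qed

lemma sum_E_SE:
  assumes "y = 1/4 \<or> y = 3/4"
  shows "(\<Sum>k\<le>2 * n. (- 1/2 gchoose k) * 2 ^ k * (- (2 * y) gchoose k))
     = pochhammer (2 * y) p / (2 * fact (2 * n)) * (fact n / pochhammer y (Suc n)) * SE y"
proof -
  have "pochhammer (2 * y) (Suc (2 * n)) \<noteq> 0" "pochhammer y (Suc n) \<noteq> 0"
    using assms pochhammer_of_nat_div_neq_0[of 1 2 "Suc (2 * n)", where ?'a = rat] pochhammer_of_nat_div_neq_0[of 3 2 "Suc (2 * n)", where ?'a = rat]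
      pochhammer_of_nat_div_neq_0[of 1 4 "Suc n", where ?'a = rat] pochhammer_of_nat_div_neq_0[of 3 4 "Suc n", where ?'a = rat]
    by (elim disjE; hypsubst; simp)+
  from sum_minus_half_two_power[OF this] show ?thesis
    by (simp only: SE_def p_eq_n Suc_eq_plus1)
qed

text \<open>Specialises the reversed sum to 2 n + 1 = p. Kummer's sum has y = 5/4, so z = n + 1/4;
  the very well-poised sum has y = 3/4, so z = n - 1/4.\<close>

lemma sum_Q_SQ:
  assumes Z: "\<And>N. (\<Sum>k\<le>N. w k * of_nat (N choose k) * pochhammer (1/2) k / pochhammer (3/2 + of_nat N) k)
                  = pochhammer (3/2) N / pochhammer y N"
    and y: "\<And>k. pochhammer y k \<noteq> 0"
  shows "(\<Sum>k\<le>n. w k * (-1)^k * (half_choose k)\<^sup>2)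
     = 2 * pochhammer (1/2) n * pochhammer (1/2) p / ((fact n)\<^sup>2 * pochhammer y n) * SQ (of_nat n + y - 1)"
proof -
  have s: "(-1 :: rat) ^ n = 1" by (simp add: n_eq)
  have n2: "of_nat n + 1/2 = P / 2" using P_eq(2) by (simp add: field_simps)
  have h1: "pochhammer (1/2 :: rat) (Suc n) = pochhammer (1/2) n * (P / 2)"
    using n2 by (simp add: pochhammer_Suc add.commute)
  have h2: "pochhammer (1/2 :: rat) p = 1/2 * pochhammer (3/2) (2 * n)"
    unfolding p_eq_n using pochhammer_rec[of "1/2 :: rat" "2 * n"] by simp
  have z: "1 - y - of_nat n = - (of_nat n + y - 1)" by simp
  have S: "(\<Sum>i\<le>n. (-1)^i * of_nat (n choose i) * pochhammer (1 - y - of_nat n) i / pochhammer (- 1/2 - 2 * of_nat n) i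
              * ((of_nat n + 1/2) / (of_nat n + 1/2 - of_nat i))) = SQ (of_nat n + y - 1)"
    unfolding SQ_def z ..
  show ?thesis
    unfolding sum_alternating_half_choose[of w y n, OF Z y] S unfolding h1 h2 s n2
    using P_nonzero by simp
qed

text \<open>Each series is m times a product of expansions in which all terms in H cancel, leaving
  -e/16 + W/8 and -e/16 - W/8 as third digits.\<close>

lemma even_part:
  "pcong 3 ((\<Sum>k\<le>2 * n. (half_choose k)\<^sup>2 * 2 ^ k) + (\<Sum>k\<le>n. (-1)^k * (half_choose k)\<^sup>2)) (m * (2 - P\<^sup>2 * e / 8))"
proof -
  obtain V where V: "pochhammer (1/2) p = P / 2 * (fact n)\<^sup>2 * V" "tri V 1 0 0" by (rule half_pochhammer)
  obtain Y where Y: "pochhammer (1/2) p / fact (2 * n) = P / 2 * Y" "tri Y 1 H (H\<^sup>2 / 2)" by (rule half_pochhammer_over_fact)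
  obtain X where X: "fact n / pochhammer (1/4) (Suc n) = 4 / P * ((-1) ^ M * c) * X" "tri X 1 0 (e / 16)" by (rule quarter_pochhammer)
  define t :: rat where "t = 2 ^ n * (-1) ^ M"
  have t: "tri t 1 (- H / 4) (H\<^sup>2 / 32)" unfolding t_def by (rule tri_two_power_sign)
  obtain T2 where hn: "pochhammer (1/2 :: rat) n = fact n * T2" and T2: "tri T2 1 (- H / 2) (H\<^sup>2 / 8)" by (rule half_pochhammer_n)
  have cm: "(-1) ^ M * c = m * t" unfolding t_def by (rule c_sign)
  have "(\<Sum>k\<le>2 * n. (half_choose k)\<^sup>2 * 2 ^ k) = (\<Sum>k\<le>2 * n. (- 1/2 gchoose k) * 2 ^ k * (- (2 * (1/4 :: rat)) gchoose k))"
    unfolding minus_half_products(1)[symmetric] by (simp add: mult_ac)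
  also have "\<dots> = (pochhammer (1/2) p / fact (2 * n)) / 2 * (fact n / pochhammer (1/4) (Suc n)) * SE (1/4)"
    by (subst sum_E_SE) auto
  also have "\<dots> = m * (t * Y * X * SE (1/4))"
    unfolding Y X cm using P_nonzero by simp
  finally have E: "(\<Sum>k\<le>2 * n. (half_choose k)\<^sup>2 * 2 ^ k) = m * (t * Y * X * SE (1/4))" .
  have tE: "tri (t * Y * X * SE (1/4)) 1 0 (- e / 16 + W / 8)"
    by (rule tri_eqI[OF tri_mult[OF tri_mult[OF tri_mult[OF t Y(2)] X(2)] tri_SE]]) (simp_all add: power2_eq_square field_simps)
  have p54: "pochhammer (5/4 :: rat) k \<noteq> 0" for k
    using pochhammer_of_nat_div_neq_0[of 5 4 k, where ?'a = rat] by simp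
  have f54: "pochhammer (5/4 :: rat) n = 4 * pochhammer (1/4) (Suc n)"
    using pochhammer_rec[of "1/4 :: rat" n] by simp
  have z54: "of_nat n + 5/4 - 1 = (of_nat n + 1/4 :: rat)" by simp
  have "(\<Sum>k\<le>n. (-1)^k * (half_choose k)\<^sup>2) = (\<Sum>k\<le>n. 1 * (-1)^k * (half_choose k :: rat)\<^sup>2)" by simp
  also have "\<dots> = 2 * pochhammer (1/2) n * pochhammer (1/2) p / ((fact n)\<^sup>2 * pochhammer (5/4) n) * SQ (of_nat n + 5/4 - 1)"
    by (rule sum_Q_SQ[OF _ p54]) (use sum_kummer[where ?'a = rat] in simp)
  also have "\<dots> = T2 * V * (fact n / pochhammer (1/4) (Suc n)) * P / 4 * SQ (of_nat n + 1/4)"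
    unfolding V hn f54 z54 by (simp add: power2_eq_square mult_ac)
  also have "\<dots> = m * (t * T2 * V * X * SQ (of_nat n + 1/4))"
    unfolding X cm using P_nonzero by simp
  finally have Q: "(\<Sum>k\<le>n. (-1)^k * (half_choose k)\<^sup>2) = m * (t * T2 * V * X * SQ (of_nat n + 1/4))" .
  have tQ: "tri (t * T2 * V * X * SQ (of_nat n + 1/4)) 1 0 (- e / 16 - W / 8)"
    by (rule tri_eqI[OF tri_mult[OF tri_mult[OF tri_mult[OF tri_mult[OF t T2] V(2)] X(2)] tri_SQ]]) (simp_all add: power2_eq_square field_simps)
  have "tri (t * Y * X * SE (1/4) + t * T2 * V * X * SQ (of_nat n + 1/4)) 2 0 (- e / 8)"
    by (rule tri_eqI[OF tri_add[OF tE tQ]]) simp_all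
  then have "pcong 3 (t * Y * X * SE (1/4) + t * T2 * V * X * SQ (of_nat n + 1/4)) (2 - P\<^sup>2 * e / 8)"
    unfolding tri_def by (simp add: mult.commute)
  then show ?thesis unfolding E Q distrib_left[symmetric] by (intro pcong_cmult) auto
qed

text \<open>The factors are not centred at a multiple of p, so they are split in halves: the first M
  are (4 i - 1)/4, handled by reflection, and the last M are (4 i - 2 + p)/4. The perturbations have
  opposite first digits. No factor p occurs, so a factor p is left over in the linear series and
  precision p^2 suffices for \<open>Z\<close>.\<close>

lemma pochhammer_three_quarters:
  obtains Z where "fact n / pochhammer (3/4) n = 2 ^ n * (-1) ^ M / (m * Z)" "Z \<in> punit" "pcong 2 Z 1"
proof -
  define A where "A = (\<Prod>i=1..M. 1 + P * (- 1 / of_nat (4 * i - 2)))"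
  define B where "B = (\<Prod>i=1..M. 1 + P * (1 / of_nat (4 * i - 2)))"
  have u: "1 / of_nat (4 * i - 2) \<in> pint" if "i \<in> {1..M}" for i
    by (rule pint_inverse_small; use that in auto)
  have u': "- 1 / of_nat (4 * i - 2) \<in> pint" if "i \<in> {1..M}" for i
    using pint_minus[OF u[OF that]] by simp
  have A: "tri A 1 (\<Sum>i=1..M. - 1 / of_nat (4 * i - 2)) (((\<Sum>i=1..M. - 1 / of_nat (4 * i - 2))\<^sup>2 - (\<Sum>i=1..M. (- 1 / of_nat (4 * i - 2))\<^sup>2)) / 2)"
    unfolding A_def by (rule tri_prod) (use u' in auto)
  have B: "tri B 1 (\<Sum>i=1..M. 1 / of_nat (4 * i - 2)) (((\<Sum>i=1..M. 1 / of_nat (4 * i - 2))\<^sup>2 - (\<Sum>i=1..M. (1 / of_nat (4 * i - 2))\<^sup>2)) / 2)"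
    unfolding B_def by (rule tri_prod) (use u in auto)
  have AB: "pcong 2 (A * B) 1"
    using tri_pcong_2[OF tri_mult[OF A B]] by (simp add: sum_negf)
  have ABu: "A * B \<in> punit"
    by (rule punit_pcong[of 1 _ 1]) (use AB in \<open>simp_all add: eval_nat_numeral\<close>)
  have pm: "pochhammer (3/4 :: rat) M = (\<Prod>i=1..M. of_nat (4 * i - 1)) / 4 ^ M"
  proof -
    have "pochhammer (3/4 :: rat) M = (\<Prod>i=1..M. of_nat (4 * i - 1) / 4)"
      unfolding pochhammer_prod
      by (rule prod.reindex_bij_witness[of _ "\<lambda>i. i - 1" "\<lambda>i. i + 1"]) (auto simp: of_nat_diff)
    then show ?thesis by (simp add: prod_dividef)
  qed
  have pr: "pochhammer (3/4 + of_nat M :: rat) M = (fact n / fact M) * B / 4 ^ M"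
  proof -
    have "pochhammer (3/4 + of_nat M :: rat) M = (\<Prod>i=1..M. of_nat (4 * i - 2) * (1 + P * (1 / of_nat (4 * i - 2))) / 4)"
      unfolding pochhammer_prod
    proof (rule prod.reindex_bij_witness[of _ "\<lambda>i. i - 1" "\<lambda>i. i + 1"])
      fix i assume "i \<in> {0..<M}"
      have "(of_nat (4 * (i + 1) - 2) :: rat) \<noteq> 0" by (subst of_nat_eq_0_iff) simp
      moreover have "z * (1 + P * (1 / z)) = z + P" if "z \<noteq> 0" for z using that by (simp add: distrib_left)
      ultimately have "of_nat (4 * (i + 1) - 2) * (1 + P * (1 / of_nat (4 * (i + 1) - 2))) / 4 = (of_nat (4 * (i + 1) - 2) + P) / 4"
        by presburger
      also have "\<dots> = 3/4 + of_nat M + of_nat i"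
        using P_eq(1) by (simp add: of_nat_diff field_simps)
      finally show "of_nat (4 * (i + 1) - 2) * (1 + P * (1 / of_nat (4 * (i + 1) - 2))) / 4 = 3/4 + of_nat M + of_nat i" .
    qed auto
    also have "\<dots> = (\<Prod>i=1..M. of_nat (4 * i - 2)) * B / 4 ^ M"
      unfolding B_def by (simp add: prod_dividef prod.distrib)
    finally show ?thesis unfolding prod_four_minus_two n_eq .
  qed
  have p4: "(4 :: rat) ^ n = 4 ^ M * 4 ^ M" by (simp add: n_eq mult_2 power_add)
  have "pochhammer (3/4 :: rat) n = pochhammer (3/4) M * pochhammer (3/4 + of_nat M) M"
    using pochhammer_product[of M n "3/4 :: rat"] by (simp add: n_eq)
  also have "\<dots> = (-1) ^ M * (fact n / fact M)\<^sup>2 * (A * B) / 4 ^ n"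
    unfolding pm pr prod_four_minus_one A_def[symmetric] p4
    by (simp add: power2_eq_square mult_ac)
  finally have q: "pochhammer (3/4 :: rat) n = (-1) ^ M * (fact n / fact M)\<^sup>2 * (A * B) / 4 ^ n" .
  have "(4 :: rat) ^ n = 2 ^ n * 2 ^ n" by (simp flip: power_mult_distrib)
  then have "fact n / pochhammer (3/4) n = 2 ^ n * (-1) ^ M / (m * (A * B))"
    unfolding q m_def c_fact by (cases "even M") (simp_all add: power2_eq_square)
  then show ?thesis using that ABu AB by blast
qed

text \<open>Supplies an unspecified third digit, so that the product rules for \<open>tri\<close>
  also serve quantities known only modulo p^2.\<close>

lemma tri_of_pcong_2:
  assumes "pcong 2 x (a + b * P)" "a \<in> pint" "b \<in> pint"
  obtains d where "tri x a b d"
proof -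
  obtain d where "d \<in> pint" "x = a + b * P + P\<^sup>2 * d" using assms(1) by (rule pcongE)
  then have "tri x a b d" using assms by (intro triI) auto
  then show ?thesis by (rule that)
qed

lemma G_pcong_1: "pcong 1 z z' \<Longrightarrow> z' \<in> pint \<Longrightarrow> pcong 1 (G z) (G z')"
  unfolding G_def
  by (intro pcong_sum pcong_cmult pcong_gbinomial pint_divide punit_small) (auto simp: n_eq)

lemma pint_G: "z \<in> pint \<Longrightarrow> G z \<in> pint"
  unfolding G_def by (intro pint_sum pint_mult pint_gbinomial pint_divide punit_small) (auto simp: n_eq)

lemma pcong_P_absorb: "pcong 2 r (g + P * s) \<Longrightarrow> s \<in> pint \<Longrightarrow> pcong 1 r g"
  by (rule pcong_trans[OF pcong_weaken[of 2]]) (auto intro: pcongI[of _ _ _ s])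

text \<open>The arguments -3/4 and n - 1/4 of \<open>G\<close> differ by p/2, so both sums have the
  same value of \<open>G\<close> modulo p in their second digit, once with factor 1/2 and once with
  -1/2. That value need not be known.\<close>

lemma tri_SE_SQ_three_quarters:
  obtains g d d' where "tri (SE (3/4)) 1 g d" "tri (SQ (of_nat n - 1/4)) 1 (- g) d'"
proof -
  have y: "3/4 \<in> pint" "- (3/4) \<in> pint" by auto
  have z: "of_nat n - 1/4 \<in> pint" by auto
  obtain r where r: "SE (3/4) = 1 + P * (r / 2)"
    "pcong 2 r (G (- (3/4)) + P * (1/2 * (\<Sum>j=1..n. (-1)^j / of_nat j * (- (3/4) gchoose j) * (\<Sum>i<j. 1 / of_nat i))))"
    by (rule SE_pcong[OF y(1)])
  have r1: "pcong 1 r (G (- (3/4)))"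
    by (rule pcong_P_absorb[OF r(2)])
       (intro pint_mult pint_sum pint_sum_inverse pint_gbinomial y pint_halves pint_divide punit_small; auto simp: n_eq)
  obtain r' where r': "SQ (of_nat n - 1/4) = 1 + P * (- r' / 2)"
    "pcong 2 r' (G (of_nat n - 1/4) + P * (1/2 * (\<Sum>i=1..n. (-1)^i / of_nat i * (of_nat n - 1/4 gchoose i) * (1 / of_nat i - (\<Sum>j<i. 1 / (of_nat n - of_nat j))))))"
    by (rule SQ_pcong[OF z])
  have hi: "1 / of_nat i - (\<Sum>j<i. 1 / (of_nat n - of_nat j)) \<in> pint" if "i \<in> {1..n}" for i
    using that punit_n_diff by (intro pint_divide pint_diff pint_inverse_small pint_sum) (auto simp: n_eq)
  have "(-1)^i / of_nat i * (of_nat n - 1/4 gchoose i) * (1 / of_nat i - (\<Sum>j<i. 1 / (of_nat n - of_nat j))) \<in> pint"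
    if "i \<in> {1..n}" for i
  proof (intro pint_mult[OF pint_mult hi] that)
    show "(-1)^i / of_nat i \<in> pint" using that by (intro pint_divide punit_small) (auto simp: n_eq)
    show "(of_nat n - 1/4 gchoose i) \<in> pint" using that z by (intro pint_gbinomial) (auto simp: n_eq)
  qed
  then have "pcong 1 r' (G (of_nat n - 1/4))"
    by (intro pcong_P_absorb[OF r'(2)] pint_mult[OF pint_halves(1)] pint_sum)
  also have "pcong 1 (G (of_nat n - 1/4)) (G (- (3/4)))"
  proof (rule G_pcong_1)
    show "pcong 1 (of_nat n - 1/4) (- (3/4))"
      by (rule pcongI[of _ _ _ "1/2"]) (use P_eq(2) in \<open>auto simp: field_simps\<close>)
  qed (rule y)
  finally have r'1: "pcong 1 r' (G (- (3/4)))" .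
  have g: "G (- (3/4)) \<in> pint" by (rule pint_G[OF y(2)])
  have "pcong 2 (P * (1/2) * r) (P * (1/2) * G (- (3/4)))" using r1 by (rule pcong_P_scale) auto
  from pcong_add[OF pcong_refl[of 2 1] this]
  have 1: "pcong 2 (SE (3/4)) (1 + G (- (3/4)) / 2 * P)" unfolding r(1) by (simp add: mult_ac)
  have "pcong 2 (P * (- (1/2)) * r') (P * (- (1/2)) * G (- (3/4)))" using r'1 by (rule pcong_P_scale) auto
  from pcong_add[OF pcong_refl[of 2 1] this]
  have 2: "pcong 2 (SQ (of_nat n - 1/4)) (1 + - (G (- (3/4)) / 2) * P)" unfolding r'(1) by (simp add: mult_ac)
  obtain d where "tri (SE (3/4)) 1 (G (- (3/4)) / 2) d" by (rule tri_of_pcong_2[OF 1]) (use g in auto)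
  moreover obtain d' where "tri (SQ (of_nat n - 1/4)) 1 (- (G (- (3/4)) / 2)) d'" by (rule tri_of_pcong_2[OF 2]) (use g in auto)
  ultimately show ?thesis by (rule that)
qed

text \<open>Both series have the prefactor p/m, so only two digits matter; the g terms cancel
  between the series and the H terms against those of \<open>t\<close>.\<close>

lemma odd_part:
  "pcong 3 ((\<Sum>k\<le>2 * n. (2 * of_nat k + 1) * (half_choose k)\<^sup>2 * 2 ^ k) + (\<Sum>k\<le>n. (4 * of_nat k + 1) * (-1)^k * (half_choose k)\<^sup>2)) (2 * P / m)"
proof -
  obtain V where V: "pochhammer (1/2) p = P / 2 * (fact n)\<^sup>2 * V" "tri V 1 0 0" by (rule half_pochhammer)
  obtain Y where Y: "pochhammer (1/2) p / fact (2 * n) = P / 2 * Y" "tri Y 1 H (H\<^sup>2 / 2)" by (rule half_pochhammer_over_fact)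
  obtain Z where Z: "fact n / pochhammer (3/4) n = 2 ^ n * (-1) ^ M / (m * Z)" "Z \<in> punit" "pcong 2 Z 1" by (rule pochhammer_three_quarters)
  define t :: rat where "t = 2 ^ n * (-1) ^ M"
  have t: "tri t 1 (- H / 4) (H\<^sup>2 / 32)" unfolding t_def by (rule tri_two_power_sign)
  obtain T2 where hn: "pochhammer (1/2 :: rat) n = fact n * T2" and T2: "tri T2 1 (- H / 2) (H\<^sup>2 / 8)" by (rule half_pochhammer_n)
  obtain g d d' where g: "tri (SE (3/4)) 1 g d" "tri (SQ (of_nat n - 1/4)) 1 (- g) d'" by (rule tri_SE_SQ_three_quarters)
  have p34: "pochhammer (3/4 :: rat) k \<noteq> 0" for k
    using pochhammer_of_nat_div_neq_0[of 3 4 k, where ?'a = rat] by simp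
  \<comment> \<open>The extra factor of the symbol of 3/4 cancels the factor 2 p + 1 by which the
    symbol of 3/2 exceeds that of 1/2.\<close>
  have "3/4 + of_nat n = (2 * P + 1) / 4" using P_eq(2) by (simp add: field_simps)
  then have f34: "pochhammer (3/4 :: rat) (Suc n) = pochhammer (3/4) n * ((2 * P + 1) / 4)"
    unfolding pochhammer_Suc by simp
  have P1: "2 * P + 1 \<noteq> 0" using p34[of "Suc n"] unfolding f34 by auto
  have "(\<Sum>k\<le>2 * n. (2 * of_nat k + 1) * (half_choose k)\<^sup>2 * 2 ^ k) = (\<Sum>k\<le>2 * n. (- 1/2 gchoose k) * 2 ^ k * (- (2 * (3/4 :: rat)) gchoose k))"
    unfolding minus_half_products(2)[symmetric] by (simp add: mult_ac)
  also have "\<dots> = pochhammer (3/2) p / (2 * fact (2 * n)) * (fact n / pochhammer (3/4) (Suc n)) * SE (3/4)"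
    by (subst sum_E_SE) auto
  also have "\<dots> = 2 * (pochhammer (1/2) p / fact (2 * n)) * (fact n / pochhammer (3/4) n) * SE (3/4)"
  proof -
    have "(w * h) / (2 * f) * (F / (q * (w / 4))) * S = 2 * (h / f) * (F / q) * S" if "w \<noteq> 0" for w h f F q S :: rat
      using that by simp
    from this[OF P1] show ?thesis unfolding pochhammer_three_halves f34 .
  qed
  also have "\<dots> = P / m * (t * (1 / Z) * (Y * SE (3/4)))"
    unfolding Y Z t_def by simp
  finally have E: "(\<Sum>k\<le>2 * n. (2 * of_nat k + 1) * (half_choose k)\<^sup>2 * 2 ^ k) = P / m * (t * (1 / Z) * (Y * SE (3/4)))" .
  have z34: "of_nat n + 3/4 - 1 = (of_nat n - 1/4 :: rat)" by simp
  have "(\<Sum>k\<le>n. (4 * of_nat k + 1) * (-1)^k * (half_choose k)\<^sup>2)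
      = 2 * pochhammer (1/2) n * pochhammer (1/2) p / ((fact n)\<^sup>2 * pochhammer (3/4) n) * SQ (of_nat n + 3/4 - 1)"
    by (rule sum_Q_SQ[OF _ p34]) (use sum_very_well_poised[where ?'a = rat] in simp)
  also have "\<dots> = P * (fact n / pochhammer (3/4) n) * (T2 * V * SQ (of_nat n - 1/4))"
    unfolding V hn z34 by (simp add: power2_eq_square mult_ac)
  also have "\<dots> = P / m * (t * (1 / Z) * (T2 * V * SQ (of_nat n - 1/4)))"
    unfolding Z t_def by simp
  finally have Q: "(\<Sum>k\<le>n. (4 * of_nat k + 1) * (-1)^k * (half_choose k)\<^sup>2) = P / m * (t * (1 / Z) * (T2 * V * SQ (of_nat n - 1/4)))" .
  have "pcong 2 (1 / Z) (1 + 0 * P)" using pcong_inverse[OF Z(3,2)] by auto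
  then obtain dz where tz: "tri (1 / Z) 1 0 dz" by (rule tri_of_pcong_2) auto
  note tt = tri_mult[OF tri_mult[OF t tz] tri_add[OF tri_mult[OF Y(2) g(1)] tri_mult[OF tri_mult[OF T2 V(2)] g(2)]]]
  have "pcong 2 (t * (1 / Z) * (Y * SE (3/4) + T2 * V * SQ (of_nat n - 1/4))) 2"
    using tri_pcong_2[OF tt] by (rule pcong_eq_trans) (simp add: field_simps)
  from pcong_P_mult[OF this, of 1]
  have "pcong 3 (P * (t * (1 / Z) * (Y * SE (3/4) + T2 * V * SQ (of_nat n - 1/4)))) (P * 2)"
    by (simp add: eval_nat_numeral)
  from pcong_divide[OF this punit_m]
  have "pcong 3 (P / m * (t * (1 / Z) * (Y * SE (3/4) + T2 * V * SQ (of_nat n - 1/4)))) (2 * P / m)"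
    by (simp add: mult.commute)
  then show ?thesis unfolding E Q by (simp only: distrib_left)
qed

end

section \<open>The Jacobsthal sum\<close>

text \<open>With r entries equal to -1 the sum is the cardinality minus 2 r, and modulo 4 the number
  -2 r is (-1)^r - 1.\<close>

lemma sum_signs_mod_4:
  fixes f :: "'b \<Rightarrow> int"
  assumes "finite I" "\<And>i. i \<in> I \<Longrightarrow> f i = 1 \<or> f i = - 1"
  shows "[sum f I = int (card I) + prod f I - 1] (mod 4)"
proof -
  have "(prod f I = 1 \<or> prod f I = - 1) \<and> [sum f I = int (card I) + prod f I - 1] (mod 4)"
    using assms
  proof (induction I rule: finite_induct)
    case (insert i I)
    then have IH: "prod f I = 1 \<or> prod f I = - 1" "[sum f I = int (card I) + prod f I - 1] (mod 4)" by auto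
    have "[sum f I + f i = int (card I) + prod f I - 1 + f i] (mod 4)" using IH(2) by (rule cong_add) simp
    also have "[int (card I) + prod f I - 1 + f i = int (card I) + 1 + f i * prod f I - 1] (mod 4)"
      using IH(1) insert.prems[of i] by (auto simp: cong_iff_dvd_diff)
    finally have "[sum f I + f i = int (card I) + 1 + f i * prod f I - 1] (mod 4)" .
    moreover have "f i = 1 \<or> f i = - 1" using insert.prems by auto
    ultimately show ?case using IH(1) insert.hyps cong_trans by (auto simp: add_ac)
  qed simp
  then show ?thesis by blast
qed

context quarter_prime
begin

section \<open>Legendre symbols and their correlations\<close>

abbreviation leg :: "int \<Rightarrow> int" where "leg a \<equiv> Legendre a (int p)"

lemma p_gt_2: "p > 2" using p_eq M_pos by simp

lemma prime_int_p: "prime (int p)" using prime_p by simp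

lemma p_minus_1_half: "(p - 1) div 2 = n" by (simp add: p_eq_n)

lemma leg_euler: "[leg a = a ^ n] (mod int p)"
  using euler_criterion[OF prime_p p_gt_2, of a] unfolding p_minus_1_half .

lemma leg_cong: "[a = b] (mod int p) \<Longrightarrow> leg a = leg b"
proof -
  assume ab: "[a = b] (mod int p)"
  have "[x = a] (mod int p) \<longleftrightarrow> [x = b] (mod int p)" for x
    using ab cong_trans cong_sym by blast
  moreover from this[of 0] have "[a = 0] (mod int p) \<longleftrightarrow> [b = 0] (mod int p)" by (simp add: cong_sym_eq)
  ultimately show ?thesis by (simp add: Legendre_def QuadRes_def)
qed

lemma leg_values: "leg a = 0 \<or> leg a = 1 \<or> leg a = - 1"
  by (simp add: Legendre_def)

lemma leg_eq_0_iff: "leg a = 0 \<longleftrightarrow> int p dvd a"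
  by (simp add: Legendre_def cong_0_iff)

lemma small_cong_eq: "[a = b] (mod int p) \<Longrightarrow> \<bar>a\<bar> \<le> 1 \<Longrightarrow> \<bar>b\<bar> \<le> 1 \<Longrightarrow> a = b"
proof (rule ccontr)
  assume *: "[a = b] (mod int p)" "\<bar>a\<bar> \<le> 1" "\<bar>b\<bar> \<le> 1" "a \<noteq> b"
  then have "int p \<le> \<bar>a - b\<bar>" by (intro zdvd_imp_le) (auto simp: cong_iff_dvd_diff)
  then show False using * p_gt_2 by linarith
qed

lemma leg_mult: "leg (a * b) = leg a * leg b"
proof (rule small_cong_eq)
  have "[leg (a * b) = a ^ n * b ^ n] (mod int p)" using leg_euler[of "a * b"] by (simp add: power_mult_distrib)
  also have "[a ^ n * b ^ n = leg a * leg b] (mod int p)" by (intro cong_mult cong_sym[OF leg_euler])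
  finally show "[leg (a * b) = leg a * leg b] (mod int p)" .
qed (use leg_values[of a] leg_values[of b] leg_values[of "a * b"] in auto)

lemma leg_square: "\<not> int p dvd a \<Longrightarrow> leg (a * a) = 1"
  unfolding leg_mult using leg_values[of a] leg_eq_0_iff[of a] by auto

lemma leg_1 [simp]: "leg 1 = 1"
  using leg_square[of 1] p_gt_2 by (simp add: zdvd1_eq)

lemma leg_minus_1: "leg (- 1) = 1"
proof (rule small_cong_eq)
  show "[leg (- 1) = 1] (mod int p)" using leg_euler[of "- 1"] by (simp add: n_eq)
qed (use leg_values[of "- 1"] in auto)

lemma leg_minus: "leg (- a) = leg a"
  using leg_mult[of "- 1" a] leg_minus_1 by simp

lemma leg_prod: "finite I \<Longrightarrow> leg (\<Prod>i\<in>I. f i) = (\<Prod>i\<in>I. leg (f i))"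
  by (induction I rule: finite_induct) (simp_all add: leg_mult)

lemma sum_residues_reindex:
  fixes f g :: "int \<Rightarrow> int"
  assumes A: "A \<subseteq> {0..<int p}" and f: "\<And>x y. [x = y] (mod int p) \<Longrightarrow> f x = f y"
    and g: "\<And>x. x \<in> A \<Longrightarrow> g x mod int p \<in> A" and inj: "\<And>x y. x \<in> A \<Longrightarrow> y \<in> A \<Longrightarrow> [g x = g y] (mod int p) \<Longrightarrow> [x = y] (mod int p)"
  shows "(\<Sum>x\<in>A. f (g x)) = (\<Sum>x\<in>A. f x)"
proof -
  have inj': "inj_on (\<lambda>x. g x mod int p) A"
  proof (rule inj_onI)
    fix x y assume xy: "x \<in> A" "y \<in> A" "g x mod int p = g y mod int p"
    from xy(3) have "[g x = g y] (mod int p)" by (simp only: cong_def)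
    then have "[x = y] (mod int p)" by (rule inj[OF xy(1,2)])
    moreover have "x \<in> {0..<int p}" "y \<in> {0..<int p}" using xy A by auto
    ultimately show "x = y" by (simp add: cong_def)
  qed
  have "finite A" using A finite_subset by blast
  then have "(\<lambda>x. g x mod int p) ` A = A" using g inj' by (intro endo_inj_surj) auto
  then have "(\<Sum>x\<in>A. f x) = (\<Sum>x\<in>(\<lambda>x. g x mod int p) ` A. f x)" by simp
  also have "\<dots> = (\<Sum>x\<in>A. f (g x mod int p))" by (simp add: sum.reindex[OF inj'])
  also have "\<dots> = (\<Sum>x\<in>A. f (g x))" by (intro sum.cong refl f) (simp add: cong_def)
  finally show ?thesis by simp
qed

abbreviation R :: "int set" where "R \<equiv> {1..<int p}"

lemma R_not_dvd: "x \<in> R \<Longrightarrow> \<not> int p dvd x"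
  using zdvd_imp_le[of "int p" x] by auto

lemma mod_in_R: "\<not> int p dvd x \<Longrightarrow> x mod int p \<in> R"
  using pos_mod_bound[of "int p" x] pos_mod_sign[of "int p" x] p_gt_2 by (auto simp: dvd_eq_mod_eq_0 order.order_iff_strict)

lemma cong_cancel: "[b * x = b * y] (mod int p) \<Longrightarrow> \<not> int p dvd b \<Longrightarrow> [x = y] (mod int p)"
  using prime_int_p by (metis cong_iff_dvd_diff prime_dvd_mult_iff right_diff_distrib)

lemma sum_R_scale:
  assumes "\<And>x y. [x = y] (mod int p) \<Longrightarrow> f x = f y" "\<not> int p dvd b"
  shows "(\<Sum>x\<in>R. f (b * x)) = (\<Sum>x\<in>R. f x :: int)"
proof (rule sum_residues_reindex)
  fix x assume "x \<in> R"
  then show "b * x mod int p \<in> R"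
    using assms(2) R_not_dvd prime_int_p by (intro mod_in_R) (simp add: prime_dvd_mult_iff)
qed (use assms in \<open>auto intro: cong_cancel\<close>)

lemma exists_primroot:
  obtains g where "\<And>j. [int g ^ j = 1] (mod int p) \<longleftrightarrow> (4 * M) dvd j" "\<not> int p dvd int g"
proof -
  obtain g where g: "residue_primroot p g" using prime_primitive_root_exists[OF prime_gt_1_nat[OF prime_p]] prime_p by blast
  have "totient p = 4 * M" by (subst totient_prime[OF prime_p]) (simp add: p_eq)
  with g have o: "coprime p g" "ord p g = 4 * M" by (auto simp: residue_primroot_def)
  show ?thesis
  proof (rule that)
    fix j show "[int g ^ j = 1] (mod int p) \<longleftrightarrow> (4 * M) dvd j"
      unfolding o(2)[symmetric] ord_divides[symmetric] using cong_int_iff[of "g ^ j" 1 p] by simp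
  next
    show "\<not> int p dvd int g" using o(1) prime_p by (metis coprime_common_divisor dvd_refl int_dvd_int_iff not_prime_unit)
  qed
qed

lemma exists_nonresidue:
  obtains r where "leg r = - 1"
proof -
  obtain g where g: "\<And>j. [int g ^ j = 1] (mod int p) \<longleftrightarrow> (4 * M) dvd j" "\<not> int p dvd int g" by (rule exists_primroot) blast
  have "\<not> 4 * M dvd n" using M_pos by (auto simp: n_eq dest: dvd_imp_le)
  then have "leg (int g) \<noteq> 1" using g(1)[of n] leg_euler[of "int g"] by (metis cong_sym)
  then have "leg (int g) = - 1" using leg_values[of "int g"] leg_eq_0_iff[of "int g"] g(2) by auto
  then show ?thesis by (rule that)
qed

lemma sum_leg_R: "(\<Sum>x\<in>R. leg x) = 0"
proof -
  obtain r where r: "leg r = - 1" by (rule exists_nonresidue)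
  then have "\<not> int p dvd r" using leg_eq_0_iff[of r] by auto
  from sum_R_scale[of leg, OF leg_cong this] have "(\<Sum>x\<in>R. leg (r * x)) = (\<Sum>x\<in>R. leg x)" .
  then show ?thesis by (simp add: leg_mult r sum_negf)
qed

lemma R_insert: "{0..<int p} = insert 0 R"
  using p_gt_2 by auto

lemma sum_leg_shift: "(\<Sum>x\<in>{0..<int p}. leg (x + b)) = 0"
proof -
  have "(\<Sum>x\<in>{0..<int p}. leg (x + b)) = (\<Sum>x\<in>{0..<int p}. leg x)"
    by (rule sum_residues_reindex) (use p_gt_2 in \<open>auto intro: leg_cong simp: cong_add_rcancel\<close>)
  then show ?thesis unfolding R_insert by (simp add: sum_leg_R leg_eq_0_iff)
qed

text \<open>The power p - 2 is inversion modulo p by Fermat, hence a permutation of the nonzero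
  residues.\<close>

lemma sum_R_inverse:
  assumes f: "\<And>x y. [x = y] (mod int p) \<Longrightarrow> f x = f y"
  shows "(\<Sum>x\<in>R. f (x ^ (p - 2))) = (\<Sum>x\<in>R. f x :: int)" and "x \<in> R \<Longrightarrow> [x * x ^ (p - 2) = 1] (mod int p)"
proof -
  have inv: "[x * x ^ (p - 2) = 1] (mod int p)" if "x \<in> R" for x
  proof -
    have "x * x ^ (p - 2) = x ^ (p - 1)" using p_gt_2 by (simp flip: power_Suc add: Suc_diff_Suc numeral_2_eq_2)
    moreover have "[nat x ^ (p - 1) = 1] (mod p)"
      using that by (intro fermat_theorem prime_p) (auto dest!: dvd_imp_le)
    then have "[int (nat x) ^ (p - 1) = 1] (mod int p)" using cong_int_iff[of "nat x ^ (p - 1)" 1 p] by simp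
    ultimately show ?thesis using that by simp
  qed
  show "x \<in> R \<Longrightarrow> [x * x ^ (p - 2) = 1] (mod int p)" by (rule inv)
  show "(\<Sum>x\<in>R. f (x ^ (p - 2))) = (\<Sum>x\<in>R. f x)"
  proof (rule sum_residues_reindex)
    fix x y assume xy: "x \<in> R" "y \<in> R" "[x ^ (p - 2) = y ^ (p - 2)] (mod int p)"
    have "[x * 1 = x * (y * y ^ (p - 2))] (mod int p)" using cong_sym[OF inv[OF xy(2)]] by (rule cong_scalar_left)
    also have "[x * (y * y ^ (p - 2)) = y * (x * x ^ (p - 2))] (mod int p)"
      using cong_scalar_left[OF cong_sym[OF xy(3)], of "x * y"] by (simp add: mult_ac)
    also have "[y * (x * x ^ (p - 2)) = y * 1] (mod int p)" using inv[OF xy(1)] by (rule cong_scalar_left)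
    finally show "[x = y] (mod int p)" by simp
  next
    fix x assume "x \<in> R"
    then show "x ^ (p - 2) mod int p \<in> R"
      using R_not_dvd prime_int_p prime_dvd_power by (intro mod_in_R) blast
  qed (use f in auto)
qed

text \<open>After a shift the summand is the symbol of a (a + d), which equals that of 1 + d/a. If d
  is nonzero, 1 + d/a runs through all residues except 1, whose symbols sum to -1.\<close>

lemma sum_leg_product:
  "(\<Sum>a\<in>{0..<int p}. leg (a - r) * leg (a - s)) = (if [r = s] (mod int p) then int p - 1 else - 1)"
proof -
  define d where "d = r - s"
  have "(\<Sum>a\<in>{0..<int p}. leg (a - r) * leg (a - s)) = (\<Sum>a\<in>{0..<int p}. leg (a + r - r) * leg (a + r - s))"
    by (rule sum_residues_reindex[symmetric, of _ "\<lambda>a. leg (a - r) * leg (a - s)" "\<lambda>a. a + r"])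
       (use p_gt_2 in \<open>auto intro!: arg_cong2[of _ _ _ _ "(*)"] leg_cong cong_diff simp: cong_add_rcancel\<close>)
  also have "\<dots> = (\<Sum>a\<in>R. leg a * leg (a + d))"
    unfolding R_insert by (simp add: d_def add_diff_eq leg_eq_0_iff)
  also have "\<dots> = (if [r = s] (mod int p) then int p - 1 else - 1)"
  proof (cases "[r = s] (mod int p)")
    case True
    then have "leg (a + d) = leg a" for a
      by (intro leg_cong) (auto simp: d_def cong_iff_dvd_diff)
    then have "(\<Sum>a\<in>R. leg a * leg (a + d)) = (\<Sum>a\<in>R. 1)"
      using leg_square R_not_dvd by (intro sum.cong refl) (simp add: leg_mult[symmetric])
    then show ?thesis using True p_gt_2 by simp
  next
    case False
    then have d: "\<not> int p dvd d" by (simp add: d_def cong_iff_dvd_diff)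
    have per: "leg (1 + d * x) = leg (1 + d * y)" if "[x = y] (mod int p)" for x y
      using that by (intro leg_cong cong_add cong_mult) auto
    have "(\<Sum>a\<in>R. leg a * leg (a + d)) = (\<Sum>a\<in>R. leg (1 + d * a ^ (p - 2)))"
    proof (intro sum.cong refl)
      fix a assume a: "a \<in> R"
      have "[a + d * 1 = a + d * (a * a ^ (p - 2))] (mod int p)"
        using sum_R_inverse(2)[of leg, OF leg_cong a] by (intro cong_add cong_scalar_left) (auto intro: cong_sym)
      then have "leg (a + d) = leg (a * (1 + d * a ^ (p - 2)))" by (intro leg_cong) (simp add: algebra_simps)
      then show "leg a * leg (a + d) = leg (1 + d * a ^ (p - 2))"
        using leg_square[OF R_not_dvd[OF a]] by (simp add: leg_mult)
    qed
    also have "\<dots> = (\<Sum>a\<in>R. leg (1 + d * a))" by (rule sum_R_inverse(1)) (rule per)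
    also have "\<dots> = (\<Sum>a\<in>R. leg (1 + a))"
      by (rule sum_R_scale[of "\<lambda>a. leg (1 + a)"]) (use d in \<open>auto intro!: leg_cong simp: cong_add_lcancel\<close>)
    also have "\<dots> = - 1"
      using sum_leg_shift[of 1] unfolding R_insert by (simp add: add.commute)
    finally show ?thesis using False by simp
  qed
  finally show ?thesis .
qed

section \<open>Norm of the Jacobsthal sum\<close>

text \<open>The character sum of a u - u^3, that is, minus the Frobenius trace of v^2 = a u - u^3.
  The parameter a is there for the second moment; only a = 1 is wanted in the end.\<close>

definition J :: "int \<Rightarrow> int" where "J a = (\<Sum>u\<in>R. leg u * leg (a - u * u))"

lemma J_cong: "[a = b] (mod int p) \<Longrightarrow> J a = J b"
  unfolding J_def by (intro sum.cong refl arg_cong2[of _ _ _ _ "(*)"] leg_cong cong_diff) auto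

text \<open>Substituting b u for u. Up to sign, \<open>J\<close> therefore depends only on the class
  of its argument modulo squares.\<close>

lemma J_scale: "\<not> int p dvd b \<Longrightarrow> J (a * (b * b)) = leg b * J a"
proof -
  assume b: "\<not> int p dvd b"
  have "J (a * (b * b)) = (\<Sum>u\<in>R. leg (b * u) * leg (a * (b * b) - (b * u) * (b * u)))"
    unfolding J_def
    by (rule sum_R_scale[symmetric, of "\<lambda>u. leg u * leg (a * (b * b) - u * u)"])
       (use b in \<open>auto intro!: arg_cong2[of _ _ _ _ "(*)"] leg_cong cong_diff cong_mult\<close>)
  also have "\<dots> = (\<Sum>u\<in>R. leg b * (leg u * leg (a - u * u)))"
  proof (intro sum.cong refl)
    fix u
    have "a * (b * b) - (b * u) * (b * u) = (b * b) * (a - u * u)" by (simp add: algebra_simps)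
    then show "leg (b * u) * leg (a * (b * b) - (b * u) * (b * u)) = leg b * (leg u * leg (a - u * u))"
      using leg_square[OF b] by (simp add: leg_mult mult_ac)
  qed
  finally show ?thesis by (simp add: J_def sum_distrib_left)
qed

lemma sum_R_square_cong:
  assumes x: "x \<in> R"
  shows "(\<Sum>y\<in>R. leg x * leg y * (if [x * x = y * y] (mod int p) then int p else 0)) = 2 * int p"
proof -
  have iff: "[x * x = y * y] (mod int p) \<longleftrightarrow> y = x \<or> y = int p - x" if y: "y \<in> R" for y
  proof
    assume "[x * x = y * y] (mod int p)"
    then have "int p dvd (x - y) * (x + y)" by (simp add: cong_iff_dvd_diff algebra_simps)
    then consider "int p dvd x - y" | "int p dvd x + y" using prime_int_p prime_dvd_mult_iff by blast
    then show "y = x \<or> y = int p - x"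
    proof cases
      case 1
      then have "[x = y] (mod int p)" by (simp add: cong_iff_dvd_diff)
      then show ?thesis using x y by (simp add: cong_def)
    next
      case 2
      then have "[y = int p - x] (mod int p)" by (simp add: cong_iff_dvd_diff algebra_simps)
      then have "y = int p - x" using x y by (intro cong_less_imp_eq_int) auto
      then show ?thesis ..
    qed
  next
    assume "y = x \<or> y = int p - x"
    then show "[x * x = y * y] (mod int p)"
    proof
      assume y: "y = int p - x"
      have "x * x - y * y = int p * (2 * x - int p)" unfolding y by (simp add: algebra_simps)
      then show ?thesis by (simp add: cong_iff_dvd_diff)
    qed simp
  qed
  have ne: "x \<noteq> int p - x" by (simp add: p_eq) presburger
  have lx: "leg (int p - x) = leg x"
  proof -
    have "[int p - x = - x] (mod int p)" by (simp add: cong_iff_dvd_diff)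
    then show ?thesis using leg_cong leg_minus by metis
  qed
  have "(\<Sum>y\<in>R. leg x * leg y * (if [x * x = y * y] (mod int p) then int p else 0))
      = (\<Sum>y\<in>{x, int p - x}. leg x * leg y * int p)"
    using x by (intro sum.mono_neutral_cong_right) (auto simp: iff)
  also have "\<dots> = 2 * (leg (x * x) * int p)" using ne lx by (simp add: leg_mult)
  finally show ?thesis using leg_square[OF R_not_dvd[OF x]] by simp
qed

text \<open>Expanding the square and summing over a first leaves, by \<open>sum_leg_product\<close>,
  the pairs with x^2 = y^2, that is y = x or y = -x. The constant parts form a product of vanishing
  character sums.\<close>

lemma sum_J_squares: "(\<Sum>a\<in>R. (J a)\<^sup>2) = 2 * int p * (int p - 1)"
proof -
  have "J 0 = (\<Sum>u\<in>R. leg u)"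
    unfolding J_def using leg_square[OF R_not_dvd] by (intro sum.cong refl) (simp add: leg_minus)
  then have J0: "J 0 = 0" using sum_leg_R by simp
  have "(\<Sum>a\<in>R. (J a)\<^sup>2) = (\<Sum>a\<in>{0..<int p}. (J a)\<^sup>2)"
    unfolding R_insert using J0 by simp
  also have "\<dots> = (\<Sum>a\<in>{0..<int p}. \<Sum>x\<in>R. \<Sum>y\<in>R. leg x * leg y * (leg (a - x * x) * leg (a - y * y)))"
    by (simp add: J_def power2_eq_square sum_product mult_ac)
  also have "\<dots> = (\<Sum>x\<in>R. \<Sum>a\<in>{0..<int p}. \<Sum>y\<in>R. leg x * leg y * (leg (a - x * x) * leg (a - y * y)))"
    by (rule sum.swap)
  also have "\<dots> = (\<Sum>x\<in>R. \<Sum>y\<in>R. \<Sum>a\<in>{0..<int p}. leg x * leg y * (leg (a - x * x) * leg (a - y * y)))"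
    by (rule sum.cong[OF refl]) (rule sum.swap)
  also have "\<dots> = (\<Sum>x\<in>R. \<Sum>y\<in>R. leg x * leg y * (if [x * x = y * y] (mod int p) then int p else 0) - leg x * leg y)"
    unfolding sum_distrib_left[symmetric] sum_leg_product by (intro sum.cong refl) (simp add: right_diff_distrib)
  also have "\<dots> = (\<Sum>x\<in>R. 2 * int p) - (\<Sum>x\<in>R. leg x * (\<Sum>y\<in>R. leg y))"
    unfolding sum_subtractf sum_distrib_left[symmetric]
    by (intro arg_cong2[of _ _ _ _ "(-)"] sum.cong refl) (use sum_R_square_cong in \<open>auto simp: sum_distrib_left mult.assoc\<close>)
  also have "\<dots> = 2 * int p * (int p - 1)" using p_gt_2 by (simp add: sum_leg_R)
  finally show ?thesis .
qed

text \<open>The square of \<open>J\<close> takes one value on residues and one on nonresidues, and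
  each class contains half of the nonzero elements; the second moment then gives the sum of the two
  values.\<close>

lemma J_norm:
  assumes r: "leg r = - 1"
  shows "(J 1)\<^sup>2 + (J r)\<^sup>2 = 4 * int p"
proof -
  have sq: "(leg b)\<^sup>2 = 1" if "\<not> int p dvd b" for b
    using leg_square[OF that] by (simp add: leg_mult power2_eq_square)
  have rd: "\<not> int p dvd r" using r leg_eq_0_iff[of r] by auto
  have root: "\<exists>b. \<not> int p dvd b \<and> [a = b * b] (mod int p)" if "leg a = 1" for a
  proof -
    have "QuadRes (int p) a" using that by (auto simp: Legendre_def split: if_splits)
    then obtain b where b: "[b * b = a] (mod int p)" by (auto simp: QuadRes_def power2_eq_square)
    have "\<not> int p dvd b" using that leg_cong[OF b] leg_eq_0_iff[of "b * b"] by auto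
    then show ?thesis using b cong_sym by blast
  qed
  \<comment> \<open>Both cases in one formula, so that summing over a needs only
    \<open>sum_leg_R\<close>.\<close>
  have J: "2 * (J a)\<^sup>2 = (J 1)\<^sup>2 * (1 + leg a) + (J r)\<^sup>2 * (1 - leg a)" if a: "a \<in> R" for a
  proof -
    have "leg a = 1 \<or> leg a = - 1" using leg_values[of a] leg_eq_0_iff[of a] R_not_dvd[OF a] by auto
    then show ?thesis
    proof
      assume 1: "leg a = 1"
      then obtain b where b: "\<not> int p dvd b" "[a = b * b] (mod int p)" using root by blast
      have "(J a)\<^sup>2 = (J 1)\<^sup>2" using J_cong[OF b(2)] J_scale[OF b(1), of 1] sq[OF b(1)] by (simp add: power_mult_distrib)
      then show ?thesis using 1 by simp
    next
      assume 1: "leg a = - 1"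
      then have "leg (a * r) = 1" using r by (simp add: leg_mult)
      then obtain b where b: "\<not> int p dvd b" "[a * r = b * b] (mod int p)" using root by blast
      have "[a * (r * r) = r * (b * b)] (mod int p)" using cong_scalar_left[OF b(2), of r] by (simp add: mult_ac)
      then have "leg r * J a = leg b * J r" using J_cong J_scale[OF b(1), of r] J_scale[OF rd, of a] by simp
      then have "(leg r * J a)\<^sup>2 = (leg b * J r)\<^sup>2" by simp
      then have "(J a)\<^sup>2 = (J r)\<^sup>2" using sq[OF b(1)] sq[OF rd] by (simp add: power_mult_distrib)
      then show ?thesis using 1 by simp
    qed
  qed
  have "2 * (2 * int p * (int p - 1)) = (\<Sum>a\<in>R. 2 * (J a)\<^sup>2)" by (simp only: sum_J_squares flip: sum_distrib_left)
  also have "\<dots> = (\<Sum>a\<in>R. ((J 1)\<^sup>2 + (J r)\<^sup>2) + ((J 1)\<^sup>2 - (J r)\<^sup>2) * leg a)"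
    using J by (intro sum.cong refl) (simp add: algebra_simps)
  also have "\<dots> = (int p - 1) * ((J 1)\<^sup>2 + (J r)\<^sup>2)"
    using p_gt_2 by (simp add: sum.distrib sum_leg_R flip: sum_distrib_left)
  finally have "(int p - 1) * (4 * int p) = (int p - 1) * ((J 1)\<^sup>2 + (J r)\<^sup>2)" by (simp add: algebra_simps)
  then show ?thesis using p_gt_2 by simp
qed

text \<open>u and p - u contribute equally because -1 is a square modulo p.\<close>

lemma J_half: "J a = 2 * (\<Sum>u\<in>{1..int n}. leg u * leg (a - u * u))"
proof -
  have "R = {1..int n} \<union> {int n + 1..<int p}" by (auto simp: p_eq_n)
  then have "J a = (\<Sum>u\<in>{1..int n}. leg u * leg (a - u * u)) + (\<Sum>u\<in>{int n + 1..<int p}. leg u * leg (a - u * u))"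
    unfolding J_def by (simp only:) (subst sum.union_disjoint, auto)
  also have "(\<Sum>u\<in>{int n + 1..<int p}. leg u * leg (a - u * u)) = (\<Sum>u\<in>{1..int n}. leg u * leg (a - u * u))"
  proof (rule sum.reindex_bij_witness[of _ "\<lambda>u. int p - u" "\<lambda>u. int p - u"])
    fix u
    have "[int p - u = - u] (mod int p)" by (simp add: cong_iff_dvd_diff)
    then have "leg (int p - u) = leg u" "[(int p - u) * (int p - u) = (- u) * (- u)] (mod int p)"
      using leg_cong leg_minus cong_mult by metis+
    moreover from this(2) have "leg (a - (int p - u) * (int p - u)) = leg (a - u * u)"
      by (intro leg_cong cong_diff) auto
    ultimately show "leg (int p - u) * leg (a - (int p - u) * (int p - u)) = leg u * leg (a - u * u)" by simp
  qed (auto simp: p_eq_n)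
  finally show ?thesis by simp
qed

end

text \<open>The prime q divides A x - B y or A x + B y. That number is odd, hence nonzero, so its
  absolute value is at least q; as q^2 is the sum of its square and the square of a companion form,
  the companion vanishes.\<close>

lemma sum_two_squares_unique:
  fixes A B x y :: int
  assumes p: "prime q" "q = A\<^sup>2 + B\<^sup>2" "q = x\<^sup>2 + y\<^sup>2" and par: "odd A" "even B" "odd x" "even y"
  shows "A\<^sup>2 = x\<^sup>2"
proof -
  have q0: "q > 0" using p(1) by (simp add: prime_gt_0_int)
  have *: "A\<^sup>2 = x\<^sup>2" if y: "q = x\<^sup>2 + y\<^sup>2" "even y" and dvd: "q dvd A * x - B * y" for y
  proof -
    have "odd (A * x - B * y)" using par y by simp
    then have "A * x - B * y \<noteq> 0" by (metis even_zero)
    then have "q \<le> \<bar>A * x - B * y\<bar>" using dvd q0 by (intro zdvd_imp_le) auto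
    then have "q\<^sup>2 \<le> \<bar>A * x - B * y\<bar>\<^sup>2" using q0 by (intro power_mono) auto
    moreover have "q\<^sup>2 = (A * x - B * y)\<^sup>2 + (A * y + B * x)\<^sup>2"
    proof -
      have "q\<^sup>2 = (A\<^sup>2 + B\<^sup>2) * (x\<^sup>2 + y\<^sup>2)" using p(2) y(1) by (simp add: power2_eq_square)
      then show ?thesis by (simp add: algebra_simps power2_eq_square)
    qed
    ultimately have "(A * y + B * x)\<^sup>2 \<le> 0" by simp
    then have "A * y = - (B * x)" by simp
    then have "A\<^sup>2 * y\<^sup>2 = B\<^sup>2 * x\<^sup>2" by (simp add: power_mult_distrib[symmetric])
    moreover have "y\<^sup>2 = q - x\<^sup>2" "B\<^sup>2 = q - A\<^sup>2" using p(2) y(1) by auto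
    ultimately have "A\<^sup>2 * q = x\<^sup>2 * q" by (simp add: algebra_simps)
    then show ?thesis using q0 by simp
  qed
  have "(A * x - B * y) * (A * x + B * y) = A\<^sup>2 * x\<^sup>2 - B\<^sup>2 * y\<^sup>2" by (simp add: algebra_simps power2_eq_square)
  also have "\<dots> = q * (A\<^sup>2 + x\<^sup>2 - q)"
  proof -
    have "y\<^sup>2 = q - x\<^sup>2" "B\<^sup>2 = q - A\<^sup>2" using p by auto
    then have "A\<^sup>2 * x\<^sup>2 - B\<^sup>2 * y\<^sup>2 = A\<^sup>2 * x\<^sup>2 - (q - A\<^sup>2) * (q - x\<^sup>2)" by (simp only:)
    then show ?thesis by (simp add: algebra_simps)
  qed
  finally have "q dvd (A * x - B * y) * (A * x + B * y)" by simp
  then have "q dvd A * x - B * y \<or> q dvd A * x + B * y" using p(1) by (simp add: prime_dvd_mult_iff)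
  then show ?thesis
  proof
    assume "q dvd A * x - B * y"
    then show ?thesis by (rule *[OF p(3) par(4)])
  next
    assume "q dvd A * x + B * y"
    then have "q dvd A * x - B * - y" by simp
    moreover have "q = x\<^sup>2 + (- y)\<^sup>2" "even (- y)" using p(3) par(4) by simp_all
    ultimately show ?thesis by (intro *[of "- y"])
  qed
qed

context quarter_prime
begin

section \<open>The sign of the Jacobsthal sum\<close>

lemma pcong_of_int_iff: "pcong k (of_int a) (of_int b) \<longleftrightarrow> [a = b] (mod int p ^ k)"
proof
  assume "pcong k (of_int a) (of_int b)"
  then obtain r where "r \<in> pint" and r: "(of_int a :: rat) = of_int b + P ^ k * r" by (rule pcongE)
  then obtain u v where uv: "r = of_int u / of_int v" "coprime v (int p)" by (auto simp: pint_def)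
  have "v \<noteq> 0" using not_coprime_0[OF uv(2)] .
  then have "(of_int ((a - b) * v) :: rat) = of_int (int p ^ k * u)"
    using r unfolding uv by (simp add: field_simps)
  then have "(a - b) * v = int p ^ k * u" by (simp only: of_int_eq_iff)
  then have "int p ^ k dvd (a - b) * v" by simp
  then have "int p ^ k dvd a - b" using uv(2) by (simp add: coprime_dvd_mult_left_iff coprime_commute)
  then show "[a = b] (mod int p ^ k)" by (simp add: cong_iff_dvd_diff)
next
  assume "[a = b] (mod int p ^ k)"
  then obtain d where "a - b = int p ^ k * d" by (auto simp: cong_iff_dvd_diff)
  then have "a = b + int p ^ k * d" by simp
  then show "pcong k (of_int a) (of_int b)" by (intro pcongI[of _ _ _ "of_int d"]) auto
qed

text \<open>The supplementary law for 2 is the first digit of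
  \<open>tri_two_power_sign\<close>.\<close>

lemma two_power_cong: "[2 ^ n = (-1) ^ M] (mod int p)"
proof -
  have "pcong 1 (2 ^ n * (-1) ^ M) 1" by (rule tri_pcong_1[OF tri_two_power_sign])
  then have "[2 ^ n * (-1) ^ M = 1] (mod int p)" using pcong_of_int_iff[of 1 "2 ^ n * (-1) ^ M" 1] by simp
  then have "[2 ^ n * (-1) ^ M * (-1) ^ M = 1 * (-1) ^ M] (mod int p)" by (rule cong_scalar_right)
  then show ?thesis by (cases "even M") simp_all
qed

lemma leg_2: "leg 2 = (-1) ^ M"
proof (rule small_cong_eq)
  show "[leg 2 = (-1) ^ M] (mod int p)" using leg_euler two_power_cong by (rule cong_trans)
qed (use leg_values[of 2] in auto)

text \<open>Moving factors one at a time from one factorial to the other, with n + k + 1 = -(n - k)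
  modulo p, ends at (2 n)! = (p - 1)!, which is -1 by Wilson's theorem.\<close>

lemma fact_n_square: "[fact n * fact n = - 1] (mod int p)"
proof -
  have "[fact (n + k) * fact (n - k) = (-1) ^ k * (fact n * fact n)] (mod int p)" if "k \<le> n" for k
    using that
  proof (induction k)
    case (Suc k)
    have "n - k = Suc (n - Suc k)" using Suc.prems by simp
    then have f: "(fact (n - k) :: int) = int (n - k) * fact (n - Suc k)" by (metis fact_Suc of_nat_fact of_nat_mult int_ops(7))
    have "[int (n + Suc k) = - int (n - k)] (mod int p)"
      using Suc.prems by (simp add: cong_iff_dvd_diff p_eq_n of_nat_diff)
    then have "[int (n + Suc k) * (fact (n + k) * fact (n - Suc k)) = - int (n - k) * (fact (n + k) * fact (n - Suc k))] (mod int p)"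
      by (rule cong_scalar_right)
    also have "- int (n - k) * (fact (n + k) * fact (n - Suc k)) = - 1 * (fact (n + k) * fact (n - k))"
      by (simp add: f mult_ac)
    also have "[- 1 * (fact (n + k) * fact (n - k)) = - 1 * ((-1) ^ k * (fact n * fact n))] (mod int p)"
      using Suc by (intro cong_scalar_left) simp
    finally show ?case by (simp add: mult.assoc)
  qed simp
  from this[of n] have "[fact (2 * n) = fact n * fact n] (mod int p)" by (simp add: mult_2 n_eq)
  moreover have "[fact (2 * n) = - 1] (mod int p)"
    using wilson_theorem[OF prime_p] by (simp add: p_eq_n)
  ultimately show ?thesis using cong_sym cong_trans by blast
qed

text \<open>The product is k! (k - 1)! (k + 1)!/2; the factor 2 k on the left clears the
  denominators.\<close>

lemma prod_three_consecutive:
  "k \<ge> 1 \<Longrightarrow> 2 * int k * (\<Prod>u\<in>{2..int k}. u * ((u - 1) * (u + 1))) = fact k ^ 3 * (int k + 1)"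
proof (induction k rule: dec_induct)
  case (step k)
  have "{2..int (Suc k)} = insert (int k + 1) {2..int k}" using step by auto
  then have "2 * int (Suc k) * (\<Prod>u\<in>{2..int (Suc k)}. u * ((u - 1) * (u + 1)))
     = (int k + 1)\<^sup>2 * (int k + 2) * (2 * int k * (\<Prod>u\<in>{2..int k}. u * ((u - 1) * (u + 1))))"
    by (simp add: power2_eq_square algebra_simps)
  also have "\<dots> = fact (Suc k) ^ 3 * (int (Suc k) + 1)"
    unfolding step.IH by (simp add: power2_eq_square power3_eq_cube algebra_simps)
  finally show ?case .
qed simp

text \<open>The term u = 1 is zero and the other n - 1 terms are signs, so modulo 4 only their
  product is needed. By multiplicativity it is one symbol of a product of factorials, which turns
  out to be 1.\<close>

lemma half_J_mod_4: "[(\<Sum>u\<in>{1..int n}. leg u * leg (1 - u * u)) = int n - 1] (mod 4)"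
proof -
  have nd: "\<not> int p dvd a" if "0 < a" "a < int p" for a using that by (auto dest!: zdvd_imp_le)
  have s: "leg u * leg (1 - u * u) = leg (u * ((u - 1) * (u + 1)))" for u
  proof -
    have "1 - u * u = - ((u - 1) * (u + 1))" by (simp add: algebra_simps)
    then show ?thesis by (simp add: leg_minus leg_mult)
  qed
  have pm: "leg a = 1 \<or> leg a = - 1" if "\<not> int p dvd a" for a
    using leg_values[of a] leg_eq_0_iff[of a] that by auto
  have fnd: "\<not> int p dvd fact n"
    using prime_dvd_fact_iff[OF prime_p, of n] p_eq_n by (metis int_dvd_int_iff less_add_same_cancel1 mult_2 not_le of_nat_fact add.commute less_Suc_eq_le Suc_eq_plus1 trans_le_add1 le_refl)
  have n0: "n > 0" using M_pos n_eq by simp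
  have l2n: "leg (2 * int n) = 1"
  proof -
    have "2 * int n - - 1 = int p" by (simp add: p_eq_n)
    then have "[2 * int n = - 1] (mod int p)" unfolding cong_iff_dvd_diff by (simp only: dvd_refl)
    then show ?thesis using leg_cong leg_minus_1 by simp
  qed
  have l2n1: "leg 2 * leg (int n + 1) = 1"
  proof -
    have "2 * (int n + 1) - 1 = int p" by (simp add: p_eq_n)
    then have "[2 * (int n + 1) = 1] (mod int p)" unfolding cong_iff_dvd_diff by (simp only: dvd_refl)
    then show ?thesis using leg_cong leg_mult leg_1 by metis
  qed
  \<comment> \<open>Since n! squares to -1, (1 + n!)^2 = 2 n! modulo p, an explicit square
    root.\<close>
  have l2f: "leg (2 * fact n) = 1"
  proof -
    have "[(1 + fact n) * (1 + fact n) = 2 * fact n] (mod int p)"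
      using fact_n_square by (simp add: algebra_simps cong_iff_dvd_diff)
    moreover have "\<not> int p dvd 1 + fact n"
    proof
      assume "int p dvd 1 + fact n"
      then have "int p dvd 2 * fact n" using calculation by (metis cong_dvd_iff dvd_mult)
      then show False using fnd nd[of 2] p_gt_2 prime_int_p by (simp add: prime_dvd_mult_iff)
    qed
    ultimately show ?thesis using leg_square leg_cong by metis
  qed
  define X where "X = (\<Prod>u\<in>{2..int n}. u * ((u - 1) * (u + 1)))"
  have "leg (2 * int n * X) = leg (fact n ^ 3 * (int n + 1))"
    using prod_three_consecutive[of n] n0 by (simp add: X_def)
  then have "leg X = leg (fact n) * leg (fact n) * leg (fact n) * leg (int n + 1)"
    using l2n unfolding leg_mult[of "2 * int n" X] by (simp add: leg_mult power3_eq_cube)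
  also have "leg (fact n) * leg (fact n) = 1" using leg_square[OF fnd] by (simp add: leg_mult)
  also have "leg (int n + 1) = leg 2" using l2n1 leg_values[of 2] leg_values[of "int n + 1"] by auto
  finally have X: "leg X = 1" using l2f by (simp add: leg_mult mult.commute)
  have I: "{1..int n} = insert 1 {2..int n}" using n0 by auto
  have "(\<Sum>u\<in>{1..int n}. leg u * leg (1 - u * u)) = (\<Sum>u\<in>{2..int n}. leg (u * ((u - 1) * (u + 1))))"
    unfolding I s by (subst sum.insert) (auto simp: leg_eq_0_iff)
  also have "[\<dots> = int (card {2..int n}) + (\<Prod>u\<in>{2..int n}. leg (u * ((u - 1) * (u + 1)))) - 1] (mod 4)"
  proof (rule sum_signs_mod_4)
    fix u assume u: "u \<in> {2..int n}"
    then show "leg (u * ((u - 1) * (u + 1))) = 1 \<or> leg (u * ((u - 1) * (u + 1))) = - 1"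
      using prime_int_p nd[of u] nd[of "u - 1"] nd[of "u + 1"] by (intro pm) (auto simp: prime_dvd_mult_iff p_eq_n)
  qed simp
  also have "(\<Prod>u\<in>{2..int n}. leg (u * ((u - 1) * (u + 1)))) = 1"
    using X by (simp add: X_def leg_prod)
  finally show ?thesis using n0 by simp
qed

text \<open>Half of \<open>J 1\<close> is an odd A with p = A^2 + B^2, so A is x up to sign. The
  sign follows by comparing A = 2 M - 1 with x = 1 modulo 4.\<close>

lemma J_1_eq:
  assumes xy: "int p = x\<^sup>2 + y\<^sup>2" "4 dvd x - 1" "even y"
  shows "J 1 = - (2 * leg 2 * x)"
proof -
  obtain r where r: "leg r = - 1" by (rule exists_nonresidue)
  define A where "A = (\<Sum>u\<in>{1..int n}. leg u * leg (1 - u * u))"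
  define B where "B = (\<Sum>u\<in>{1..int n}. leg u * leg (r - u * u))"
  have J: "J 1 = 2 * A" "J r = 2 * B" unfolding A_def B_def by (rule J_half)+
  have pAB: "int p = A\<^sup>2 + B\<^sup>2" using J_norm[OF r] unfolding J by (simp add: power_mult_distrib)
  have A4: "[A = 2 * int M - 1] (mod 4)" using half_J_mod_4 by (simp add: A_def n_eq)
  have oddA: "odd A" using A4 by (simp add: cong_iff_dvd_diff) presburger
  have oddx: "odd x" using xy(2) by presburger
  have "odd (A\<^sup>2 + B\<^sup>2)" unfolding pAB[symmetric] by (simp add: p_eq)
  then have "even B" using oddA by simp
  then have "A\<^sup>2 = x\<^sup>2" using sum_two_squares_unique[OF prime_int_p pAB xy(1)] oddA oddx xy(3) by simp
  then have "x = A \<or> x = - A" by (simp add: power2_eq_iff) auto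
  have "x = - (leg 2 * A)"
  proof (cases "even M")
    case True
    then have "4 dvd A + 1" using A4 by (auto simp: cong_iff_dvd_diff elim!: evenE) presburger
    then show ?thesis using True \<open>x = A \<or> x = - A\<close> xy(2) by (simp add: leg_2) presburger
  next
    case False
    then have "4 dvd A - 1" using A4 by (auto simp: cong_iff_dvd_diff elim!: oddE) presburger
    then show ?thesis using False \<open>x = A \<or> x = - A\<close> xy(2) by (simp add: leg_2) presburger
  qed
  moreover have "leg 2 * leg 2 = 1" by (simp add: leg_2 flip: power_add)
  ultimately show ?thesis unfolding J by (simp add: mult.assoc[symmetric])
qed

section \<open>Teichmueller representatives\<close>

text \<open>The cofactor of a - b in a^p - b^p has p terms, all congruent to b^(p-1) modulo p, so it
  contributes one more factor p.\<close>

lemma cong_power_p: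
  assumes "[a = b] (mod int p ^ Suc k)"
  shows "[a ^ p = b ^ p] (mod int p ^ Suc (Suc k))"
proof -
  have d: "int p ^ Suc k dvd a - b" using assms by (simp add: cong_iff_dvd_diff)
  then have ab: "[a = b] (mod int p)" by (simp add: cong_iff_dvd_diff) (metis dvd_mult_left)
  have "[(\<Sum>i<p. b ^ (p - Suc i) * a ^ i) = (\<Sum>i<p. b ^ (p - 1))] (mod int p)"
  proof (intro cong_sum)
    fix i assume i: "i \<in> {..<p}"
    have "[b ^ (p - Suc i) * a ^ i = b ^ (p - Suc i) * b ^ i] (mod int p)" using ab by (intro cong_scalar_left cong_pow)
    also have "b ^ (p - Suc i) * b ^ i = b ^ (p - 1)" using i by (simp flip: power_add)
    finally show "[b ^ (p - Suc i) * a ^ i = b ^ (p - 1)] (mod int p)" .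
  qed
  moreover have "int p dvd (\<Sum>i<p. b ^ (p - 1))" by simp
  ultimately have "int p dvd (\<Sum>i<p. b ^ (p - Suc i) * a ^ i)" using cong_dvd_iff by blast
  with d have "int p ^ Suc k * int p dvd (a - b) * (\<Sum>i<p. b ^ (p - Suc i) * a ^ i)" by (rule mult_dvd_mono)
  then show ?thesis by (simp add: cong_iff_dvd_diff power_diff_sumr2 mult.commute)
qed

text \<open>An integer approximation of the Teichmueller lift: two p-th powers raise the precision
  from p to p^3, so modulo p^3 the value depends only on the residue of u.\<close>

definition teich :: "int \<Rightarrow> int" where "teich u = u ^ (p\<^sup>2)"

lemma teich_cong: "[a = b] (mod int p) \<Longrightarrow> [teich a = teich b] (mod int p ^ 3)"
proof -
  assume "[a = b] (mod int p)"
  then have "[a = b] (mod int p ^ Suc 0)" by simp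
  then have "[(a ^ p) ^ p = (b ^ p) ^ p] (mod int p ^ Suc (Suc (Suc 0)))" by (intro cong_power_p)
  then show ?thesis unfolding teich_def power2_eq_square power_mult numeral_3_eq_3 .
qed

lemma teich_mult: "teich (a * b) = teich a * teich b"
  by (simp add: teich_def power_mult_distrib)

lemma teich_power: "teich (a ^ j) = teich a ^ j"
  by (simp add: teich_def power_mult[symmetric] mult.commute)

lemma teich_1 [simp]: "teich 1 = 1" by (simp add: teich_def)

lemma teich_self: "u \<in> R \<Longrightarrow> [teich u = u] (mod int p)"
proof -
  assume u: "u \<in> R"
  have "p = Suc (Suc (p - 2))" using p_gt_2 by simp
  then have "u ^ p = u * (u * u ^ (p - 2))" by (metis power_Suc)
  also have "[u * (u * u ^ (p - 2)) = u * 1] (mod int p)"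
    using sum_R_inverse(2)[of leg, OF leg_cong u] by (rule cong_scalar_left)
  finally have 1: "[u ^ p = u] (mod int p)" by simp
  have "[(u ^ p) ^ p = u ^ p] (mod int p)" using 1 by (rule cong_pow)
  then show ?thesis using 1 cong_trans unfolding teich_def power2_eq_square power_mult by blast
qed

text \<open>Orthogonality of characters modulo p^3. Multiplying u by a primitive root g permutes the
  residues and scales the sum by \<open>teich g\<close> to the power j; that factor minus 1 is
  congruent to g^j - 1, which is prime to p unless 4 M divides j.\<close>

lemma teich_power_sum:
  "[(\<Sum>u\<in>R. teich u ^ j) = (if 4 * M dvd j then 4 * int M else 0)] (mod int p ^ 3)"
proof (cases "4 * M dvd j")
  case True
  have "[(\<Sum>u\<in>R. teich u ^ j) = (\<Sum>u\<in>R. 1)] (mod int p ^ 3)"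
  proof (intro cong_sum)
    fix u assume u: "u \<in> R"
    have "4 * M = Suc (p - 2)" using p_gt_2 by (simp add: p_eq)
    then have "[u ^ (4 * M) = 1] (mod int p)" using sum_R_inverse(2)[of leg, OF leg_cong u] by simp
    moreover obtain i where "j = 4 * M * i" using True by blast
    ultimately have "[u ^ j = 1 ^ i] (mod int p)" by (simp only: power_mult) (rule cong_pow)
    then have "[teich (u ^ j) = teich 1] (mod int p ^ 3)" by (intro teich_cong) simp
    then show "[teich u ^ j = 1] (mod int p ^ 3)" by (simp add: teich_power)
  qed
  then show ?thesis using True by (simp add: p_eq)
next
  case False
  obtain g where g: "\<And>j. [int g ^ j = 1] (mod int p) \<longleftrightarrow> (4 * M) dvd j" "\<not> int p dvd int g" by (rule exists_primroot) blast
  define f where "f u = teich u ^ j mod int p ^ 3" for u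
  have f: "[(\<Sum>u\<in>R. h u) = (\<Sum>u\<in>R. h u mod int p ^ 3)] (mod int p ^ 3)" for h
    by (intro cong_sum) (simp add: cong_def)
  have "(\<Sum>u\<in>R. f (int g * u)) = (\<Sum>u\<in>R. f u)"
  proof (rule sum_R_scale[OF _ g(2)])
    fix x y assume "[x = y] (mod int p)"
    then have "[teich x ^ j = teich y ^ j] (mod int p ^ 3)" by (intro cong_pow teich_cong)
    then show "f x = f y" by (simp add: f_def cong_def)
  qed
  then have eq: "(\<Sum>u\<in>R. teich (int g * u) ^ j mod int p ^ 3) = (\<Sum>u\<in>R. teich u ^ j mod int p ^ 3)"
    by (simp only: f_def)
  have "[(\<Sum>u\<in>R. teich (int g * u) ^ j) = (\<Sum>u\<in>R. teich (int g * u) ^ j mod int p ^ 3)] (mod int p ^ 3)" by (rule f)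
  also note eq
  also have "[(\<Sum>u\<in>R. teich u ^ j mod int p ^ 3) = (\<Sum>u\<in>R. teich u ^ j)] (mod int p ^ 3)" by (rule cong_sym[OF f])
  finally have "[(\<Sum>u\<in>R. teich (int g * u) ^ j) = (\<Sum>u\<in>R. teich u ^ j)] (mod int p ^ 3)" .
  then have "[teich (int g) ^ j * (\<Sum>u\<in>R. teich u ^ j) = (\<Sum>u\<in>R. teich u ^ j)] (mod int p ^ 3)"
    by (simp add: teich_mult power_mult_distrib sum_distrib_left)
  then have "int p ^ 3 dvd (teich (int g) ^ j - 1) * (\<Sum>u\<in>R. teich u ^ j)"
    by (simp add: cong_iff_dvd_diff algebra_simps)
  moreover have "\<not> int p dvd teich (int g) ^ j - 1"
  proof
    assume "int p dvd teich (int g) ^ j - 1"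
    then have 1: "[teich (int g) ^ j = 1] (mod int p)" by (simp add: cong_iff_dvd_diff)
    have gR: "int g mod int p \<in> R" using g(2) by (rule mod_in_R)
    have c: "[int g = int g mod int p] (mod int p)" by (simp add: cong_def)
    have "[teich (int g) = teich (int g mod int p)] (mod int p)"
      using c unfolding teich_def by (rule cong_pow)
    also have "[teich (int g mod int p) = int g mod int p] (mod int p)" by (rule teich_self[OF gR])
    also have "[int g mod int p = int g] (mod int p)" using c by (rule cong_sym)
    finally have "[teich (int g) ^ j = int g ^ j] (mod int p)" by (rule cong_pow)
    then have "[int g ^ j = 1] (mod int p)" using 1 cong_sym cong_trans by blast
    then show False using g(1) False by simp
  qed
  then have "coprime (int p ^ 3) (teich (int g) ^ j - 1)"
    using prime_int_p by (intro coprime_power_left_iff[THEN iffD2] disjI1 prime_imp_coprime)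
  ultimately have "int p ^ 3 dvd (\<Sum>u\<in>R. teich u ^ j)" by (simp add: coprime_dvd_mult_right_iff)
  then show ?thesis using False by (simp add: cong_0_iff)
qed

text \<open>The right-hand side interpolates \<open>w = f\<^sup>n \<mapsto> \<plusminus>1\<close> to third order: it differs from
  \<open>8 L\<close> by \<open>(w - L)\<^sup>3 (3 w\<^sup>2 + 9 L w + 8)\<close> when \<open>L\<^sup>2 = 1\<close>.\<close>

lemma leg_interpolation:
  assumes f: "\<not> int p dvd f"
  shows "[8 * leg f = 15 * f ^ n - 10 * f ^ (3 * n) + 3 * f ^ (5 * n)] (mod int p ^ 3)"
proof -
  define w where "w = f ^ n"
  define L where "L = leg f"
  have L: "L = 1 \<or> L = - 1" using leg_values[of f] leg_eq_0_iff[of f] f by (auto simp: L_def)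
  have "int p dvd w - L" using cong_sym[OF leg_euler[of f]] by (simp add: w_def L_def cong_iff_dvd_diff)
  then have "int p ^ 3 dvd (w - L) ^ 3" by (rule dvd_power_same)
  then have "int p ^ 3 dvd (w - L) ^ 3 * (3 * w\<^sup>2 + 9 * L * w + 8)" by (rule dvd_mult2)
  also have "(w - L) ^ 3 * (3 * w\<^sup>2 + 9 * L * w + 8) = 15 * w - 10 * w ^ 3 + 3 * w ^ 5 - 8 * L"
    using L by (auto simp: power2_eq_square eval_nat_numeral algebra_simps)
  finally have "[15 * w - 10 * w ^ 3 + 3 * w ^ 5 = 8 * L] (mod int p ^ 3)" by (simp add: cong_iff_dvd_diff)
  then show ?thesis
    by (simp add: w_def L_def power_mult[symmetric] mult.commute cong_sym_eq)
qed

text \<open>After binomial expansion only exponents n + 2 j divisible by 4 M = 2 n survive, that is,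
  j an odd multiple of M; all these j have the sign (-1)^M.\<close>

lemma teich_binomial_sum:
  "[(\<Sum>u\<in>R. teich u ^ n * (1 - (teich u)\<^sup>2) ^ (r * n)) = 4 * int M * (-1) ^ M * (\<Sum>l<r. int ((r * n) choose (M * (2 * l + 1))))] (mod int p ^ 3)"
proof -
  let ?N = "r * n"
  let ?w = "\<lambda>j. (-1) ^ j * int (?N choose j)"
  have 1: "(\<Sum>u\<in>R. teich u ^ n * (1 - (teich u)\<^sup>2) ^ ?N)
      = (\<Sum>u\<in>R. \<Sum>j\<le>?N. (-1) ^ j * int (?N choose j) * teich u ^ (n + 2 * j))"
  proof (intro sum.cong refl)
    fix u
    have m: "(- (teich u)\<^sup>2) ^ j = (-1) ^ j * teich u ^ (2 * j)" for j
      by (simp add: power_minus[of "(teich u)\<^sup>2"] flip: power_mult)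
    have "(1 - (teich u)\<^sup>2) ^ ?N = (\<Sum>j\<le>?N. int (?N choose j) * (- (teich u)\<^sup>2) ^ j)"
      using binomial_ring[of "- (teich u)\<^sup>2" 1 ?N] by simp
    also have "\<dots> = (\<Sum>j\<le>?N. (-1) ^ j * int (?N choose j) * teich u ^ (2 * j))"
      by (intro sum.cong refl) (simp add: m mult_ac)
    finally show "teich u ^ n * (1 - (teich u)\<^sup>2) ^ ?N = (\<Sum>j\<le>?N. (-1) ^ j * int (?N choose j) * teich u ^ (n + 2 * j))"
      by (simp add: sum_distrib_left power_add mult_ac)
  qed
  have 2: "(\<Sum>u\<in>R. \<Sum>j\<le>?N. ?w j * teich u ^ (n + 2 * j)) = (\<Sum>j\<le>?N. ?w j * (\<Sum>u\<in>R. teich u ^ (n + 2 * j)))"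
    by (subst sum.swap) (simp add: sum_distrib_left)
  have 3: "[(\<Sum>j\<le>?N. ?w j * (\<Sum>u\<in>R. teich u ^ (n + 2 * j))) = (\<Sum>j\<le>?N. (-1) ^ j * int (?N choose j) * (if 4 * M dvd n + 2 * j then 4 * int M else 0))] (mod int p ^ 3)"
    by (intro cong_sum cong_scalar_left teich_power_sum)
  have 4: "(\<Sum>j\<le>?N. (-1) ^ j * int (?N choose j) * (if 4 * M dvd n + 2 * j then 4 * int M else 0))
     = (\<Sum>j\<in>(\<lambda>l. M * (2 * l + 1)) ` {..<r}. (-1) ^ j * int (?N choose j) * (4 * int M))"
  proof (rule sum.mono_neutral_cong_right)
    show "(\<lambda>l. M * (2 * l + 1)) ` {..<r} \<subseteq> {..?N}"
    proof
      fix j assume "j \<in> (\<lambda>l. M * (2 * l + 1)) ` {..<r}"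
      then obtain l where l: "l < r" "j = M * (2 * l + 1)" by blast
      have "M * (2 * l + 1) \<le> M * (2 * r)" using l by (intro mult_le_mono2) simp
      then show "j \<in> {..?N}" using l by (simp add: n_eq mult_ac)
    qed
    have dvd: "4 * M dvd n + 2 * (M * (2 * l + 1))" for l
    proof -
      have "n + 2 * (M * (2 * l + 1)) = 4 * M * (l + 1)" by (simp add: n_eq algebra_simps)
      then show ?thesis by simp
    qed
    then show "(-1) ^ j * int (?N choose j) * (if 4 * M dvd n + 2 * j then 4 * int M else 0) = (-1) ^ j * int (?N choose j) * (4 * int M)"
      if "j \<in> (\<lambda>l. M * (2 * l + 1)) ` {..<r}" for j using that by auto
    show "\<forall>j\<in>{..?N} - (\<lambda>l. M * (2 * l + 1)) ` {..<r}. (-1) ^ j * int (?N choose j) * (if 4 * M dvd n + 2 * j then 4 * int M else 0) = 0"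
    proof
      fix j assume j: "j \<in> {..?N} - (\<lambda>l. M * (2 * l + 1)) ` {..<r}"
      have "\<not> 4 * M dvd n + 2 * j"
      proof
        assume "4 * M dvd n + 2 * j"
        then obtain k where "n + 2 * j = 4 * M * k" by blast
        then have k: "M + j = 2 * M * k" by (simp add: n_eq)
        then obtain l where l: "k = Suc l" using M_pos by (cases k) auto
        have jl: "j = M * (2 * l + 1)" using k by (simp add: l algebra_simps)
        have "M * (2 * l + 1) \<le> M * (2 * r)" using j by (simp add: jl n_eq mult_ac)
        then have "2 * l + 1 \<le> 2 * r" using nat_mult_le_cancel1[OF M_pos] by blast
        then have "l < r" by simp
        then show False using j jl by blast
      qed
      then show "(-1) ^ j * int (?N choose j) * (if 4 * M dvd n + 2 * j then 4 * int M else 0) = 0" by simp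
    qed
  qed simp
  have 5: "(\<Sum>j\<in>(\<lambda>l. M * (2 * l + 1)) ` {..<r}. ?w j * (4 * int M)) = (\<Sum>l<r. (-1) ^ (M * (2 * l + 1)) * int (?N choose (M * (2 * l + 1))) * (4 * int M))"
    by (subst sum.reindex) (use M_pos in \<open>auto intro!: inj_onI\<close>)
  have 6: "(\<Sum>l<r. ?w (M * (2 * l + 1)) * (4 * int M)) = 4 * int M * (-1) ^ M * (\<Sum>l<r. int (?N choose (M * (2 * l + 1))))"
    unfolding sum_distrib_left by (intro sum.cong refl) (cases "even M"; simp add: power_mult)
  show ?thesis
    unfolding 1 2 by (rule cong_trans[OF 3]) (simp only: 4 5 6 cong_refl)
qed

text \<open>The symbol of u is \<open>teich u ^ n\<close> modulo p^3, that of 1 - u^2 is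
  interpolated, and \<open>teich_binomial_sum\<close> is used with r = 1, 3, 5. Symmetry of the rows
  merges equal binomial coefficients.\<close>

lemma J_1_cong:
  "[8 * J 1 = 4 * int M * (-1) ^ M * (15 * int (n choose M) - 10 * (2 * int ((6 * M) choose M) + int ((6 * M) choose (3 * M)))
      + 3 * (2 * int ((10 * M) choose M) + 2 * int ((10 * M) choose (3 * M)) + int ((10 * M) choose (5 * M))))] (mod int p ^ 3)"
proof -
  define F where "F u = 1 - (teich u)\<^sup>2" for u
  have t: "[8 * (leg u * leg (1 - u * u)) = teich u ^ n * (15 * F u ^ n - 10 * F u ^ (3 * n) + 3 * F u ^ (5 * n))] (mod int p ^ 3)"
    if u: "u \<in> R" for u
  proof -
    have "leg u = 1 \<or> leg u = - 1" using leg_values[of u] leg_eq_0_iff[of u] R_not_dvd[OF u] by auto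
    \<comment> \<open>An odd power fixes the signs 1 and -1, so lifting Euler's criterion by
      \<open>teich\<close> makes it exact modulo p^3.\<close>
    moreover have "odd (p\<^sup>2)" by (simp add: p_eq)
    ultimately have "teich (leg u) = leg u" by (auto simp: teich_def)
    moreover have "[teich (leg u) = teich (u ^ n)] (mod int p ^ 3)" by (intro teich_cong leg_euler)
    ultimately have l: "[leg u = teich u ^ n] (mod int p ^ 3)" by (simp add: teich_power)
    have fc: "[1 - u * u = F u] (mod int p)"
      unfolding F_def power2_eq_square using teich_self[OF u] by (intro cong_diff cong_mult) (auto intro: cong_sym)
    have "[8 * leg (1 - u * u) = 15 * F u ^ n - 10 * F u ^ (3 * n) + 3 * F u ^ (5 * n)] (mod int p ^ 3)"
    proof (cases "int p dvd 1 - u * u")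
      case False
      then have "\<not> int p dvd F u" using fc cong_dvd_iff by blast
      from leg_interpolation[OF this] show ?thesis using leg_cong[OF fc] by simp
    next
      \<comment> \<open>For u = 1 and u = -1 modulo p the symbol is 0 and the interpolation does not
        apply, but then \<open>F u\<close> itself vanishes modulo p^3.\<close>
      case True
      then have "[u * u = 1] (mod int p)" by (simp add: cong_iff_dvd_diff dvd_diff_commute)
      from teich_cong[OF this] have "[F u = 0] (mod int p ^ 3)"
        by (simp add: F_def teich_mult power2_eq_square cong_iff_dvd_diff dvd_diff_commute)
      then have d: "int p ^ 3 dvd F u" by (simp add: cong_0_iff)
      have "int p ^ 3 dvd F u ^ k" if "k > 0" for k using d that by (metis dvd_power dvd_trans)
      then have "int p ^ 3 dvd 15 * F u ^ n - 10 * F u ^ (3 * n) + 3 * F u ^ (5 * n)"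
        using M_pos by (intro dvd_add dvd_diff dvd_mult) (auto simp: n_eq)
      moreover have "leg (1 - u * u) = 0" using True by (simp add: leg_eq_0_iff)
      ultimately show ?thesis by (simp add: cong_sym_eq[of 0] cong_0_iff)
    qed
    from cong_mult[OF l this] show ?thesis by (simp add: mult_ac)
  qed
  have s: "[(\<Sum>u\<in>R. teich u ^ n * F u ^ (r * n)) = 4 * int M * (-1) ^ M * (\<Sum>l<r. int ((r * n) choose (M * (2 * l + 1))))] (mod int p ^ 3)" for r
    unfolding F_def by (rule teich_binomial_sum)
  have s1: "[(\<Sum>u\<in>R. teich u ^ n * F u ^ n) = 4 * int M * (-1) ^ M * int (n choose M)] (mod int p ^ 3)"
    using s[of 1] by simp
  have sym: "(6 * M choose (5 * M)) = (6 * M choose M)" "(10 * M choose (9 * M)) = (10 * M choose M)" "(10 * M choose (7 * M)) = (10 * M choose (3 * M))"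
    using binomial_symmetric[of "5 * M" "6 * M"] binomial_symmetric[of "9 * M" "10 * M"] binomial_symmetric[of "7 * M" "10 * M"] by simp_all
  have lt3: "(\<Sum>l<3. h l) = h 0 + h 1 + h 2" for h :: "nat \<Rightarrow> int"
    by (simp add: eval_nat_numeral)
  have lt5: "(\<Sum>l<5. h l) = h 0 + h 1 + h 2 + h 3 + h 4" for h :: "nat \<Rightarrow> int"
    by (simp add: eval_nat_numeral)
  have ix: "M * (2 * 0 + 1) = M" "M * (2 * 1 + 1) = 3 * M" "M * (2 * 2 + 1) = 5 * M" "M * (2 * 3 + 1) = 7 * M" "M * (2 * 4 + 1) = 9 * M"
    by simp_all
  have e3: "3 * n = 6 * M" and e5: "5 * n = 10 * M" by (simp_all add: n_eq)
  have "(\<Sum>l<3. int ((3 * n) choose (M * (2 * l + 1)))) = 2 * int ((6 * M) choose M) + int ((6 * M) choose (3 * M))"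
    unfolding e3 lt3 ix sym by simp
  then have s3: "[(\<Sum>u\<in>R. teich u ^ n * F u ^ (3 * n)) = 4 * int M * (-1) ^ M * (2 * int ((6 * M) choose M) + int ((6 * M) choose (3 * M)))] (mod int p ^ 3)"
    using s[of 3] by simp
  have "(\<Sum>l<5. int ((5 * n) choose (M * (2 * l + 1)))) = 2 * int ((10 * M) choose M) + 2 * int ((10 * M) choose (3 * M)) + int ((10 * M) choose (5 * M))"
    unfolding e5 lt5 ix sym by simp
  then have s5: "[(\<Sum>u\<in>R. teich u ^ n * F u ^ (5 * n)) = 4 * int M * (-1) ^ M * (2 * int ((10 * M) choose M) + 2 * int ((10 * M) choose (3 * M)) + int ((10 * M) choose (5 * M)))] (mod int p ^ 3)"
    using s[of 5] by simp
  have "8 * J 1 = (\<Sum>u\<in>R. 8 * (leg u * leg (1 - u * u)))" by (simp add: J_def sum_distrib_left)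
  also have "[\<dots> = (\<Sum>u\<in>R. teich u ^ n * (15 * F u ^ n - 10 * F u ^ (3 * n) + 3 * F u ^ (5 * n)))] (mod int p ^ 3)"
    by (intro cong_sum t)
  also have "(\<Sum>u\<in>R. teich u ^ n * (15 * F u ^ n - 10 * F u ^ (3 * n) + 3 * F u ^ (5 * n)))
     = 15 * (\<Sum>u\<in>R. teich u ^ n * F u ^ n) - 10 * (\<Sum>u\<in>R. teich u ^ n * F u ^ (3 * n)) + 3 * (\<Sum>u\<in>R. teich u ^ n * F u ^ (5 * n))"
    by (simp add: sum_distrib_left sum.distrib sum_subtractf algebra_simps)
  also have "[\<dots> = 15 * (4 * int M * (-1) ^ M * int (n choose M))
      - 10 * (4 * int M * (-1) ^ M * (2 * int ((6 * M) choose M) + int ((6 * M) choose (3 * M))))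
      + 3 * (4 * int M * (-1) ^ M * (2 * int ((10 * M) choose M) + 2 * int ((10 * M) choose (3 * M)) + int ((10 * M) choose (5 * M))))] (mod int p ^ 3)"
    by (intro cong_add cong_diff cong_scalar_left s1 s3 s5)
  finally show ?thesis by (simp add: algebra_simps)
qed

section \<open>Binomial coefficients modulo \<open>p\<^sup>3\<close>\<close>

text \<open>Meant for y = p and y = 2 p: upper entries near n + p and n + 2 p are compared with C(n,
  M).\<close>

lemma gbinomial_M_shift: "(of_nat n + y gchoose M) = c * (\<Prod>k=M+1..n. 1 + y / of_nat k)" for y :: rat
proof -
  have f: "(\<Prod>k=M+1..n. of_nat k) = (fact n / fact M :: rat)"
  proof -
    have "(fact n :: rat) = fact M * (\<Prod>k=M+1..n. of_nat k)"
      using prod.ub_add_nat[of 1 M "\<lambda>k. of_nat k :: rat" M] by (simp add: fact_prod n_eq mult_2)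
    then show ?thesis by simp
  qed
  have "(of_nat n + y gchoose M) = (\<Prod>i<M. of_nat n + y - of_nat i) / fact M"
    by (simp add: gbinomial_prod_rev atLeast0LessThan)
  also have "(\<Prod>i<M. of_nat n + y - of_nat i) = (\<Prod>k=M+1..n. of_nat k + y)"
    by (rule prod.reindex_bij_witness[of _ "\<lambda>k. n - k" "\<lambda>i. n - i"]) (auto simp: n_eq of_nat_diff)
  also have "\<dots> = (\<Prod>k=M+1..n. of_nat k * (1 + y / of_nat k))"
    by (intro prod.cong refl) (auto simp: field_simps)
  also have "\<dots> = fact n / fact M * (\<Prod>k=M+1..n. 1 + y / of_nat k)"
    by (simp only: prod.distrib f)
  finally show ?thesis by (simp add: c_fact power2_eq_square)
qed

lemma prod_split_M:
  "(\<Prod>k=1..n. 1 + y / of_nat k) = (\<Prod>k=1..M. 1 + y / of_nat k) * (\<Prod>k=M+1..n. 1 + y / of_nat k)" for y :: rat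
  using prod.ub_add_nat[of 1 M "\<lambda>k. 1 + y / of_nat k" M] by (simp add: n_eq mult_2)

text \<open>Replaces H - K by -H/2; the error term of \<open>harmonic_K\<close> is carried into the
  third digit.\<close>

lemma tri_adjust_e:
  assumes "tri x 1 (a * (H - K)) d" "a \<in> pint" "pcong 1 d d'" "d' \<in> pint"
  shows "tri x 1 (- a * H / 2) (d' + a * e / 4)"
proof (rule tri_adjust1)
  show "tri x 1 (a * (H - K)) d'" using assms by (blast intro: tri_adjust)
  have "pcong 2 (a * (H - K)) (a * (H - (3/2 * H - e / 4 * P)))"
    using assms(2) by (intro pcong_cmult pcong_diff pcong_refl harmonic_K)
  then show "pcong 2 (a * (H - K)) (- a * H / 2 + P * (a * e / 4))"
    by (rule pcong_eq_trans) (simp add: field_simps)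
qed (use assms(2) in auto)

text \<open>The product over the upper half is the quotient of those up to n and up to M.\<close>

lemma tri_upper_quarter:
  assumes a: "a \<in> pint"
  shows "tri (\<Prod>k=M+1..n. 1 + P * (a / of_nat k)) 1 (- a * H / 2) (a\<^sup>2 * H\<^sup>2 / 8 + a\<^sup>2 * e / 2 + a * e / 4)"
proof -
  define A B D where "A = (\<Prod>k=M+1..n. 1 + P * (a / of_nat k))" and "B = (\<Prod>k=1..n. 1 + P * (a / of_nat k))"
    and "D = (\<Prod>k=1..M. 1 + P * (a / of_nat k))"
  have B: "tri B 1 (a * H) (a\<^sup>2 * H\<^sup>2 / 2)" unfolding B_def by (rule tri_prod_harmonic[OF a])
  have D: "tri D 1 (a * K) (a\<^sup>2 * (K\<^sup>2 - e) / 2)" unfolding D_def by (rule tri_prod_M[OF a])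
  have "D \<noteq> 0" using tri_pcong_1[OF D] punit_pcong[of 0 D 1] punit_nonzero by auto
  then have A: "A = B * (1 / D)"
    using prod_split_M[of "P * a"] by (simp add: A_def B_def D_def field_simps)
  have "tri A 1 (a * (H - K)) (a\<^sup>2 * ((H - K)\<^sup>2 + e) / 2)"
    unfolding A by (rule tri_eqI[OF tri_mult[OF B tri_inverse[OF D]]]) (simp_all add: field_simps power2_eq_square)
  moreover have "pcong 1 (a\<^sup>2 * ((H - K)\<^sup>2 + e) / 2) (a\<^sup>2 * ((H - 3/2 * H)\<^sup>2 + e) / 2)"
    using a by (intro pcong_divide pcong_cmult pcong_add pcong_refl pcong_power pcong_diff K_pcong_1) auto
  ultimately have "tri A 1 (- a * H / 2) (a\<^sup>2 * ((H - 3/2 * H)\<^sup>2 + e) / 2 + a * e / 4)"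
    using a by (intro tri_adjust_e) auto
  then show ?thesis unfolding A_def by (rule tri_eqI) (simp_all add: power2_eq_square field_simps)
qed

definition A1 :: rat where "A1 = (\<Prod>k=M+1..n. 1 + P * (1 / of_nat k))"
definition A2 :: rat where "A2 = (\<Prod>k=M+1..n. 1 + P * (2 / of_nat k))"

lemma tri_A1: "tri A1 1 (- H / 2) (H\<^sup>2 / 8 + 3/4 * e)"
  unfolding A1_def by (rule tri_eqI[OF tri_upper_quarter]) (auto simp: field_simps)

lemma tri_A2: "tri A2 1 (- H) (H\<^sup>2 / 2 + 5/2 * e)"
  unfolding A2_def by (rule tri_eqI[OF tri_upper_quarter]) (auto simp: field_simps)

lemma punit_one_plus: "b \<in> pint \<Longrightarrow> 1 + b * P \<in> punit"
  by (rule punit_pcong[of 0 _ 1]) (auto intro!: pcongI[of _ _ _ b])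

lemma tri_linear: "b \<in> pint \<Longrightarrow> tri (1 + b * P) 1 b 0"
  by (rule triI) auto

text \<open>6 M = n + p - 1: one absorption step from the upper entry n + p, whose factor supplies
  the linear terms in p.\<close>

lemma binomial_6_1: "2 * of_nat ((6 * M) choose M) = c * (A1 * ((1 + (- 5) * P) * (1 / (1 + (- 3) * P))))"
proof -
  define x where "x = of_nat n + P"
  have x: "x = (3 * P - 1) / 2" "x - of_nat M = (5 * P - 1) / 4"
    unfolding x_def using P_eq by (simp_all add: n_eq field_simps)
  have nz: "1 + (- 3) * P \<noteq> 0" by (rule punit_nonzero[OF punit_one_plus]) auto
  have "of_nat (6 * M) = x - 1" using P_eq by (simp add: x_def n_eq)
  then have b: "of_nat ((6 * M) choose M) = (x - 1 gchoose M)" by (simp only: binomial_gbinomial)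
  have "x * (x - 1 gchoose M) = (x - of_nat M) * (x gchoose M)" by (rule gbinomial_absorb_comp[symmetric])
  also have "(x gchoose M) = c * A1" unfolding x_def gbinomial_M_shift A1_def by simp
  finally have "(3 * P - 1) / 2 * (x - 1 gchoose M) = (5 * P - 1) / 4 * (c * A1)" unfolding x(2) unfolding x(1) .
  then have "(1 + (- 3) * P) * (2 * (x - 1 gchoose M)) = (1 + (- 5) * P) * (c * A1)" by (simp add: field_simps)
  then have "2 * (x - 1 gchoose M) = (1 + (- 5) * P) * (c * A1) / (1 + (- 3) * P)" 
    using nz by (metis nonzero_mult_div_cancel_left)
  then show ?thesis unfolding b by simp
qed

text \<open>10 M = n + 2 p - 2, so two absorption steps are needed.\<close>

lemma binomial_10_1:
  "2 * of_nat ((10 * M) choose M)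
     = c * (A2 * ((5 + (- 9) * P) * (1 + (- 9) * P) * (1 / (1 + (- (5/3)) * P)) * (1 / (1 + (- 5) * P)) / 6))"
proof -
  define x where "x = of_nat n + 2 * P"
  have x: "x = (5 * P - 1) / 2" "x - 1 = (5 * P - 3) / 2" "x - of_nat M = (9 * P - 1) / 4" "x - 1 - of_nat M = (9 * P - 5) / 4"
    unfolding x_def using P_eq by (simp_all add: n_eq field_simps)
  have nz: "1 + (- 5) * P \<noteq> 0" "1 + (- (5/3)) * P \<noteq> 0" by (rule punit_nonzero[OF punit_one_plus]; auto)+
  have "of_nat (10 * M) = x - 1 - 1" using P_eq by (simp add: x_def n_eq)
  then have b: "of_nat ((10 * M) choose M) = (x - 1 - 1 gchoose M)" by (simp only: binomial_gbinomial)
  have "x * (x - 1 gchoose M) = (x - of_nat M) * (x gchoose M)" by (rule gbinomial_absorb_comp[symmetric])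
  also have "(x gchoose M) = c * A2" unfolding x_def gbinomial_M_shift A2_def by (simp add: mult.commute)
  finally have 1: "(1 + (- 5) * P) * (2 * (x - 1 gchoose M)) = (1 + (- 9) * P) * (c * A2)"
    unfolding x(3) unfolding x(1) by (simp add: field_simps)
  have "(x - 1) * (x - 1 - 1 gchoose M) = (x - 1 - of_nat M) * (x - 1 gchoose M)" by (rule gbinomial_absorb_comp[symmetric])
  then have 2: "(1 + (- (5/3)) * P) * (6 * (x - 1 - 1 gchoose M)) = (5 + (- 9) * P) * (x - 1 gchoose M)"
    unfolding x(4) unfolding x(2) by (simp add: field_simps)
  have 3: "z = w / a" if "a * z = w" "a \<noteq> 0" for z w a :: rat using that by auto
  have "2 * (x - 1 gchoose M) = (1 + (- 9) * P) * (c * A2) / (1 + (- 5) * P)" by (rule 3[OF 1 nz(1)])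
  moreover have "6 * (x - 1 - 1 gchoose M) = (5 + (- 9) * P) * (x - 1 gchoose M) / (1 + (- (5/3)) * P)" by (rule 3[OF 2 nz(2)])
  moreover have "2 * z = a * y / b / 6" if "2 * w = y" "6 * z = a * w / b" for w y z a b :: rat
    using that by auto
  ultimately have "2 * (x - 1 - 1 gchoose M) = (5 + (- 9) * P) * ((1 + (- 9) * P) * (c * A2) / (1 + (- 5) * P)) / (1 + (- (5/3)) * P) / 6"
    by blast
  then show ?thesis unfolding b by (simp add: mult_ac)
qed

section \<open>Factorials near p and 2 p\<close>

lemma fact_add_prod: "(fact (q + k) :: rat) = fact q * (fact k * (\<Prod>i=1..k. 1 + of_nat q / of_nat i))" for q k :: nat
proof (induction k)
  case (Suc k)
  have "(of_nat (Suc k) :: rat) \<noteq> 0" by (rule of_nat_neq_0)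
  then have "(of_nat (q + Suc k) :: rat) = of_nat (Suc k) * (1 + of_nat q / of_nat (Suc k))"
    by (simp add: distrib_left del: of_nat_Suc)
  then show ?case using Suc by (simp add: mult_ac del: of_nat_Suc of_nat_add)
qed simp

lemma fact_diff_prod:
  "k < q \<Longrightarrow> (fact (q - 1) :: rat) = fact (q - 1 - k) * ((-1) ^ k * fact k * (\<Prod>i=1..k. 1 - of_nat q / of_nat i))" for q k :: nat
proof (induction k)
  case (Suc k)
  have "q - 1 - k = Suc (q - 1 - Suc k)" using Suc.prems by simp
  then have "(fact (q - 1 - k) :: rat) = of_nat (q - 1 - k) * fact (q - 1 - Suc k)" by (metis fact_Suc)
  moreover have "(of_nat (q - 1 - k) :: rat) = of_nat q - of_nat (Suc k)"
    using Suc.prems by (subst of_nat_diff[symmetric]) auto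
  moreover have "(of_nat q - of_nat (Suc k) :: rat) = - (of_nat (Suc k) * (1 - of_nat q / of_nat (Suc k)))"
    using of_nat_neq_0[of k, where ?'a = rat] by (simp only: right_diff_distrib mult_1_right nonzero_mult_div_cancel_left times_divide_eq_right minus_diff_eq not_False_eq_True)
  ultimately have "(fact (q - 1 - k) :: rat) = - (of_nat (Suc k) * (1 - of_nat q / of_nat (Suc k))) * fact (q - 1 - Suc k)" by simp
  moreover have "(fact (q - 1) :: rat) = fact (q - 1 - k) * ((-1) ^ k * fact k * (\<Prod>i=1..k. 1 - of_nat q / of_nat i))"
    using Suc by simp
  ultimately show ?case by (simp del: of_nat_Suc)
qed simp

definition B1 :: rat where "B1 = (\<Prod>k=1..n. 1 + P * (1 / of_nat k))"
definition B2 :: rat where "B2 = (\<Prod>k=1..n. 1 + P * (2 / of_nat k))"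
definition C1 :: rat where "C1 = (\<Prod>k=1..n. 1 + P * (- 1 / of_nat k))"
definition D1 :: rat where "D1 = (\<Prod>k=1..M. 1 + P * (1 / of_nat k))"
definition N1 :: rat where "N1 = (\<Prod>k=1..M. 1 + P * (- 1 / of_nat k))"
definition N2 :: rat where "N2 = (\<Prod>k=1..M. 1 + P * (- 2 / of_nat k))"

lemma tri_products:
  "tri B1 1 H (H\<^sup>2 / 2)" "tri B2 1 (2 * H) (2 * H\<^sup>2)" "tri (1 / C1) 1 H (H\<^sup>2 / 2)"
  "tri D1 1 K ((K\<^sup>2 - e) / 2)" "tri N1 1 (- K) ((K\<^sup>2 - e) / 2)" "tri N2 1 (- 2 * K) (2 * (K\<^sup>2 - e))"
proof -
  have i: "1 \<in> pint" "2 \<in> pint" "- 1 \<in> pint" "- 2 \<in> pint" by auto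
  show "tri B1 1 H (H\<^sup>2 / 2)" unfolding B1_def by (rule tri_eqI[OF tri_prod_harmonic[OF i(1)]]) auto
  show "tri B2 1 (2 * H) (2 * H\<^sup>2)" unfolding B2_def by (rule tri_eqI[OF tri_prod_harmonic[OF i(2)]]) auto
  show "tri (1 / C1) 1 H (H\<^sup>2 / 2)" unfolding C1_def
    by (rule tri_eqI[OF tri_inverse[OF tri_prod_harmonic[OF i(3)]]]) (auto simp: power2_eq_square)
  show "tri D1 1 K ((K\<^sup>2 - e) / 2)" unfolding D1_def by (rule tri_eqI[OF tri_prod_M[OF i(1)]]) auto
  show "tri N1 1 (- K) ((K\<^sup>2 - e) / 2)" unfolding N1_def by (rule tri_eqI[OF tri_prod_M[OF i(3)]]) auto
  show "tri N2 1 (- 2 * K) (2 * (K\<^sup>2 - e))" unfolding N2_def by (rule tri_eqI[OF tri_prod_M[OF i(4)]]) auto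
qed

lemma tri_nonzero: "tri x 1 a b \<Longrightarrow> x \<noteq> 0"
  using tri_pcong_1 punit_pcong[of 0 x 1] punit_nonzero by auto

lemma fact_facts:
  "(fact (p + n) :: rat) = fact p * (fact n * B1)"
  "(fact (2 * p + n) :: rat) = fact (2 * p) * (fact n * B2)"
  "(fact (p + M) :: rat) = fact p * (fact M * D1)"
  "(fact (4 * M) :: rat) = fact (3 * M) * ((-1) ^ M * fact M * N1)"
  "(fact (4 * M) :: rat) = (fact n)\<^sup>2 * C1"
  "(fact p :: rat) = P * fact (4 * M)"
  "(fact (2 * p) :: rat) = 2 * P * fact (2 * p - 1)"
  "(fact (2 * p - 1) :: rat) = fact (7 * M) * (- ((-1) ^ M) * fact M * N2 * (of_nat M + 1 - 2 * P))"
proof -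
  show "(fact (p + n) :: rat) = fact p * (fact n * B1)" unfolding fact_add_prod B1_def by simp
  show "(fact (2 * p + n) :: rat) = fact (2 * p) * (fact n * B2)" unfolding fact_add_prod B2_def by (simp add: mult.commute)
  show "(fact (p + M) :: rat) = fact p * (fact M * D1)" unfolding fact_add_prod D1_def by simp
  have "M < p" by (simp add: p_eq)
  from fact_diff_prod[OF this] show "(fact (4 * M) :: rat) = fact (3 * M) * ((-1) ^ M * fact M * N1)"
    unfolding N1_def by (simp add: p_eq)
  show "(fact (4 * M) :: rat) = (fact n)\<^sup>2 * C1" using fact_2n unfolding C1_def by (simp add: n_eq)
  have "p = Suc (4 * M)" by (simp add: p_eq)
  then show "(fact p :: rat) = P * fact (4 * M)" by (metis fact_Suc)
  have "2 * p = Suc (2 * p - 1)" by (simp add: p_eq)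
  then have "(fact (2 * p) :: rat) = of_nat (2 * p) * fact (2 * p - 1)" by (metis fact_Suc)
  then show "(fact (2 * p) :: rat) = 2 * P * fact (2 * p - 1)" by simp
  have "Suc M < 2 * p" by (simp add: p_eq)
  from fact_diff_prod[OF this]
  have "(fact (2 * p - 1) :: rat) = fact (2 * p - 1 - Suc M) * ((-1) ^ Suc M * fact (Suc M) * (\<Prod>i=1..Suc M. 1 - of_nat (2 * p) / of_nat i))" .
  also have "2 * p - 1 - Suc M = 7 * M" by (simp add: p_eq)
  also have "(\<Prod>i=1..Suc M. 1 - of_nat (2 * p) / of_nat i) = N2 * (1 - 2 * P / of_nat (Suc M))"
    unfolding N2_def by (simp add: mult_ac)
  also have "(-1) ^ Suc M * fact (Suc M) * (N2 * (1 - 2 * P / of_nat (Suc M))) = - ((-1) ^ M) * fact M * N2 * (of_nat (Suc M) * (1 - 2 * P / of_nat (Suc M)))"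
    by simp
  also have "of_nat (Suc M) * (1 - 2 * P / of_nat (Suc M)) = of_nat M + 1 - 2 * P"
    using of_nat_neq_0[of M, where ?'a = rat] by (simp add: right_diff_distrib del: of_nat_Suc)
  finally show "(fact (2 * p - 1) :: rat) = fact (7 * M) * (- ((-1) ^ M) * fact M * N2 * (of_nat M + 1 - 2 * P))" .
qed

text \<open>p divides (6 M)! once and not (3 M)!, so a factor p appears; writing (4 M)! through n!
  squared puts \<open>c\<close> into the denominator.\<close>

lemma binomial_6_3:
  "of_nat ((6 * M) choose (3 * M)) = P / c * (- 2 * ((1 / (1 + (- 3) * P)) * B1 * (N1 * N1) * (1 / C1)))"
proof -
  have nz: "1 + (- 3) * P \<noteq> 0" by (rule punit_nonzero[OF punit_one_plus]) auto
  have "p + n = Suc (6 * M)" by (simp add: p_eq n_eq)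
  then have "(fact (p + n) :: rat) = of_nat (6 * M + 1) * fact (6 * M)" by simp
  moreover have "(of_nat (6 * M + 1) :: rat) = - (1 + (- 3) * P) / 2" using P_eq(1) by (simp add: field_simps)
  ultimately have "fact p * (fact n * B1) = - (1 + (- 3) * P) / 2 * fact (6 * M)"
    unfolding fact_facts(1) by simp
  moreover have solve: "z = - 2 * y / w" if "y = - w / 2 * z" "w \<noteq> 0" for w y z :: rat
    unfolding that(1) using that(2) by simp
  ultimately have f6: "(fact (6 * M) :: rat) = - 2 * (fact p * (fact n * B1)) / (1 + (- 3) * P)"
    using nz by (intro solve)
  have "(fact (4 * M) :: rat) \<noteq> 0" by simp
  then have nz2: "N1 \<noteq> 0" unfolding fact_facts(4) by auto
  have f3: "(fact (3 * M) :: rat) = (-1) ^ M * fact (4 * M) / (fact M * N1)"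
    using nz2 unfolding fact_facts(4) by (cases "even M") simp_all
  have "of_nat ((6 * M) choose (3 * M)) = (fact (6 * M) / (fact (3 * M) * fact (3 * M)) :: rat)"
    by (subst binomial_fact) simp_all
  also have "\<dots> = - 2 * (P * fact (4 * M) * (fact n * B1)) / (1 + (- 3) * P) * (fact M * N1)\<^sup>2 / (fact (4 * M))\<^sup>2"
    unfolding f6 f3 fact_facts(6) by (cases "even M") (simp_all add: power2_eq_square)
  also have "\<dots> = - 2 * (P * (fact n * B1)) / (1 + (- 3) * P) * (fact M * N1)\<^sup>2 / fact (4 * M)"
    by (simp add: power2_eq_square)
  also have "\<dots> = P / c * (- 2 * ((1 / (1 + (- 3) * P)) * B1 * (N1 * N1) * (1 / C1)))"
    unfolding fact_facts(5) c_fact by (simp add: power2_eq_square mult_ac)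
  finally show ?thesis .
qed

lemma fact_10: "(fact (10 * M) :: rat) = 4 * (fact (2 * p) * (fact n * B2)) / (3 * (1 + (- 5) * P) * (1 + (- (5/3)) * P))"
proof -
  have nz: "1 + (- 5) * P \<noteq> 0" "1 + (- (5/3)) * P \<noteq> 0" by (rule punit_nonzero[OF punit_one_plus]; auto)+
  define u v where "u = 1 + (- 5) * P" and "v = 1 + (- (5/3)) * P"
  have uv: "u \<noteq> 0" "v \<noteq> 0" using nz by (simp_all add: u_def v_def)
  have "2 * p + n = Suc (Suc (10 * M))" by (simp add: p_eq n_eq)
  then have "(fact (2 * p + n) :: rat) = of_nat (10 * M + 2) * (of_nat (10 * M + 1) * fact (10 * M))" by simp
  moreover have "(of_nat (10 * M + 2) :: rat) = - u / 2" "(of_nat (10 * M + 1) :: rat) = - 3 * v / 2"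
    using P_eq(1) by (simp_all add: u_def v_def field_simps)
  ultimately have "(fact (2 * p + n) :: rat) = (- u / 2) * ((- 3 * v / 2) * fact (10 * M))" by simp
  then show ?thesis
    using uv unfolding fact_facts(2) u_def[symmetric] v_def[symmetric] by (simp add: field_simps)
qed

text \<open>(10 M)! contains the multiples p and 2 p, (7 M)! only p, and (3 M)! none, so one factor
  p remains. The linear factor 1 - 7 p/3 comes from 7 M = 2 p - 1 - (M + 1), one factor more than
  \<open>N2\<close> covers.\<close>

lemma binomial_10_3:
  "of_nat ((10 * M) choose (3 * M)) = P / c * (- 2 * ((1 + (- (7/3)) * P) * (1 / (1 + (- 5) * P)) * (1 / (1 + (- (5/3)) * P)) * B2 * (N1 * N2) * (1 / C1)))"
proof -
  define u v where "u = 1 + (- 5) * P" and "v = 1 + (- (5/3)) * P"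
  note f10 = fact_10[folded u_def v_def]
  define h where "h = 1 + (- (7/3)) * P"
  have m: "of_nat M + 1 - 2 * P = 3 * h / 4" using P_eq(1) by (simp add: h_def field_simps)
  have "(fact (4 * M) :: rat) \<noteq> 0" by simp
  then have nz2: "N1 \<noteq> 0" unfolding fact_facts(4) by auto
  have "(fact (2 * p - 1) :: rat) \<noteq> 0" by simp
  then have nz3: "N2 \<noteq> 0" "of_nat M + 1 - 2 * P \<noteq> 0" unfolding fact_facts(8) by auto
  have f3: "(fact (3 * M) :: rat) = (-1) ^ M * fact (4 * M) / (fact M * N1)"
    using nz2 unfolding fact_facts(4) by (cases "even M") simp_all
  have f7: "(fact (7 * M) :: rat) = - ((-1) ^ M) * fact (2 * p - 1) / (fact M * N2 * (of_nat M + 1 - 2 * P))"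
    using nz3 unfolding fact_facts(8) by (cases "even M") simp_all
  have "of_nat ((10 * M) choose (3 * M)) = (fact (10 * M) / (fact (3 * M) * fact (7 * M)) :: rat)"
    by (subst binomial_fact) simp_all
  also have "\<dots> = - (4 * (2 * P * fact (2 * p - 1) * (fact n * B2)) / (3 * u * v)) * (fact M * N1) * (fact M * N2 * (of_nat M + 1 - 2 * P)) / (fact (4 * M) * fact (2 * p - 1))"
    unfolding f10 f3 f7 fact_facts(7) by (cases "even M") simp_all
  also have "\<dots> = - (4 * (2 * P * (fact n * B2)) / (3 * u * v)) * (fact M * N1) * (fact M * N2 * (of_nat M + 1 - 2 * P)) / fact (4 * M)"
    by simp
  also have "\<dots> = P / c * (- 2 * (h * (1 / u) * (1 / v) * B2 * (N1 * N2) * (1 / C1)))"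
    unfolding fact_facts(5) c_fact m by (simp add: power2_eq_square mult_ac)
  finally show ?thesis unfolding u_def v_def h_def .
qed

text \<open>Wolstenholme's congruence, obtained by combining the expansions of 4^(p-1) and of the
  Pochhammer symbol of 1/2.\<close>

lemma central_binomial_p: "tri (of_nat ((2 * p) choose p)) 2 0 0"
proof -
  obtain Y where Y: "pochhammer (1/2) p / fact (2 * n) = P / 2 * Y" "tri Y 1 H (H\<^sup>2 / 2)" by (rule half_pochhammer_over_fact)
  define T :: rat where "T = 2 ^ (2 * n)"
  have T: "tri T 1 (- H / 2) (H\<^sup>2 / 8)" unfolding T_def by (rule tri_two_power)
  have "p = Suc (2 * n)" by (simp add: p_eq_n)
  then have "(fact p :: rat) = P * fact (2 * n)" by (metis fact_Suc)
  then have "half_choose p = Y / 2"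
    unfolding half_choose_eq_pochhammer using Y(1) P_nonzero by (simp add: field_simps)
  moreover have "(4 :: rat) ^ p = 4 * (T * T)"
    unfolding T_def p_eq_n by (simp add: power_mult flip: power_mult_distrib)
  ultimately have "of_nat ((2 * p) choose p) = 2 * (T * T * Y)"
    unfolding half_choose_def using tri_nonzero[OF T] by (simp add: field_simps)
  moreover have "tri (2 * (T * T * Y)) 2 0 0"
    by (rule tri_eqI[OF tri_cmult[OF _ tri_mult[OF tri_mult[OF T T] Y(2)]]]) (auto simp: field_simps power2_eq_square)
  ultimately show ?thesis by simp
qed

definition A3 :: rat where "A3 = B2 * (1 / (D1 * D1))"

lemma tri_A3: "tri A3 1 (- H) (H\<^sup>2 / 2 + 3/2 * e)"
proof -
  have DD: "tri (D1 * D1) 1 (2 * K) (2 * K\<^sup>2 - e)"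
    by (rule tri_eqI[OF tri_mult[OF tri_products(4) tri_products(4)]]) (simp_all add: power2_eq_square field_simps)
  have "tri A3 1 (2 * (H - K)) (2 * (H - K)\<^sup>2 + e)"
    unfolding A3_def by (rule tri_eqI[OF tri_mult[OF tri_products(2) tri_inverse[OF DD]]]) (simp_all add: power2_eq_square algebra_simps)
  moreover have "pcong 1 (2 * (H - K)\<^sup>2 + e) (2 * (H - 3/2 * H)\<^sup>2 + e)"
    by (intro pcong_add pcong_cmult pcong_power pcong_diff K_pcong_1 pcong_refl) auto
  ultimately have "tri A3 1 (- 2 * H / 2) (2 * (H - 3/2 * H)\<^sup>2 + e + 2 * e / 4)"
    by (intro tri_adjust_e) auto
  then show ?thesis by (rule tri_eqI) (simp_all add: power2_eq_square field_simps)
qed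

text \<open>The multiples p and 2 p in (10 M)! match the two factors p of the denominator; they are
  collected in the central binomial coefficient of p.\<close>

lemma binomial_10_5:
  "of_nat ((10 * M) choose (5 * M)) = c * (of_nat ((2 * p) choose p) * A3 * ((1 + (- 5) * P) * (1 / (1 + (- (5/3)) * P)) / 12))"
proof -
  define u v where "u = 1 + (- 5) * P" and "v = 1 + (- (5/3)) * P"
  have uv: "u \<noteq> 0" "v \<noteq> 0" unfolding u_def v_def by (rule punit_nonzero[OF punit_one_plus]; auto)+
  note f10 = fact_10[folded u_def v_def]
  have "p + M = Suc (5 * M)" by (simp add: p_eq)
  then have "(fact (p + M) :: rat) = of_nat (5 * M + 1) * fact (5 * M)" by simp
  moreover have "(of_nat (5 * M + 1) :: rat) = - u / 4" using P_eq(1) by (simp add: u_def field_simps)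
  ultimately have "(fact (p + M) :: rat) = - u / 4 * fact (5 * M)" by simp
  then have f5: "(fact (5 * M) :: rat) = - 4 * (fact p * (fact M * D1)) / u"
    using uv unfolding fact_facts(3) by (simp add: field_simps)
  have cb: "of_nat ((2 * p) choose p) = (fact (2 * p) / (fact p * fact p) :: rat)"
    by (subst binomial_fact) (simp_all add: mult_2)
  have "of_nat ((10 * M) choose (5 * M)) = (fact (10 * M) / (fact (5 * M) * fact (5 * M)) :: rat)"
    by (subst binomial_fact) simp_all
  also have "\<dots> = c * (of_nat ((2 * p) choose p) * A3 * (u * (1 / v) / 12))"
    unfolding f10 f5 cb c_fact A3_def using uv by (simp add: power2_eq_square mult_ac)
  finally show ?thesis unfolding u_def v_def .
qed

text \<open>The binomial coefficients fall into two kinds, c times a p-integral number and p/c times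
  a p-integral number; with the sign (-1)^M absorbed by \<open>t\<close>, they produce the terms in
  m and in p/m.\<close>

lemma J_1_pcong: "pcong 3 (of_int (J 1)) (- (m * (1 - P\<^sup>2 * e / 16) + P / m))"
proof -
  define t :: rat where "t = 2 ^ n * (-1) ^ M"
  have t: "tri t 1 (- H / 4) (H\<^sup>2 / 32)" unfolding t_def by (rule tri_two_power_sign)
  have t': "tri (1 / t) 1 (H / 4) (H\<^sup>2 / 32)"
    by (rule tri_eqI[OF tri_inverse[OF t]]) (simp_all add: power2_eq_square)
  have l3: "tri (1 / (1 + (- 3) * P)) 1 3 9" and l5: "tri (1 / (1 + (- 5) * P)) 1 5 25"
    and l53: "tri (1 / (1 + (- (5/3)) * P)) 1 (5/3) (25/9)"
    by (rule tri_eqI[OF tri_inverse[OF tri_linear]]; auto simp: power2_eq_square)+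
  have k5: "tri (1 + (- 5) * P) 1 (- 5) 0" and k9: "tri (1 + (- 9) * P) 1 (- 9) 0" and k73: "tri (1 + (- (7/3)) * P) 1 (- (7/3)) 0"
    by (rule tri_linear; auto)+
  have k59: "tri (5 + (- 9) * P) 5 (- 9) 0" by (rule triI) auto
  have i: "1/6 \<in> pint" "1/12 \<in> pint"
    using pint_divide[OF pint_numeral(3) punit_mult[OF punit_2 punit_3]] pint_divide[OF pint_numeral(3) punit_mult[OF punit_4 punit_3]] by simp_all
  define a1 where "a1 = A1 * ((1 + (- 5) * P) * (1 / (1 + (- 3) * P)))"
  define a2 where "a2 = A2 * ((5 + (- 9) * P) * (1 + (- 9) * P) * (1 / (1 + (- (5/3)) * P)) * (1 / (1 + (- 5) * P)) / 6)"
  define a3 where "a3 = of_nat ((2 * p) choose p) * A3 * ((1 + (- 5) * P) * (1 / (1 + (- (5/3)) * P)) / 12)"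
  define q1 where "q1 = (1 / (1 + (- 3) * P)) * B1 * (N1 * N1) * (1 / C1)"
  define q2 where "q2 = (1 + (- (7/3)) * P) * (1 / (1 + (- 5) * P)) * (1 / (1 + (- (5/3)) * P)) * B2 * (N1 * N2) * (1 / C1)"
  note ta1 = tri_mult[OF tri_A1 tri_mult[OF k5 l3]]
  have "a2 = 1/6 * (A2 * ((5 + (- 9) * P) * (1 + (- 9) * P) * (1 / (1 + (- (5/3)) * P)) * (1 / (1 + (- 5) * P))))" by (simp add: a2_def)
  note ta2 = tri_cmult[OF i(1) tri_mult[OF tri_A2 tri_mult[OF tri_mult[OF tri_mult[OF k59 k9] l53] l5]], folded this]
  have "a3 = 1/12 * (of_nat ((2 * p) choose p) * A3 * ((1 + (- 5) * P) * (1 / (1 + (- (5/3)) * P))))" by (simp add: a3_def)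
  note ta3 = tri_cmult[OF i(2) tri_mult[OF tri_mult[OF central_binomial_p tri_A3] tri_mult[OF k5 l53]], folded this]
  have P1: "tri (P - 1) (- 1) 1 0" by (rule triI) auto
  \<comment> \<open>The leading digits of \<open>a1\<close>, \<open>a2\<close>, \<open>a3\<close>
    are 1, 5/6, 1/6, giving 15 - 10 + 3 = 8; all terms in H cancel, and only e remains in the third
    digit.\<close>
  have "tri ((P - 1) * (t * (15 - 10 * a1 + 3 * (a2 + a3)))) (- 8) 0 (e / 2)"
    unfolding a1_def
    by (rule tri_eqI[OF tri_mult[OF P1 tri_mult[OF t tri_add[OF tri_diff[OF tri_const[of 15] tri_cmult[of 10, OF _ ta1]] tri_cmult[of 3, OF _ tri_add[OF ta2 ta3]]]]]])
       (auto simp: field_simps power2_eq_square)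
  then have 1: "pcong 3 ((P - 1) * (t * (15 - 10 * a1 + 3 * (a2 + a3)))) (- 8 + e / 2 * P\<^sup>2)"
    by (simp add: tri_def)
  have tq1: "tri q1 1 (3 + 2 * (H - K)) (9 + 6 * (H - K) + 2 * (H - K)\<^sup>2 - e)"
    unfolding q1_def by (rule tri_eqI[OF tri_mult[OF tri_mult[OF tri_mult[OF l3 tri_products(1)] tri_mult[OF tri_products(5) tri_products(5)]] tri_products(3)]])
      (simp_all add: field_simps power2_eq_square)
  \<comment> \<open>The third digit of \<open>q2\<close> is left open, since \<open>q2\<close>
    occurs multiplied by p.\<close>
  obtain d2 where tq2: "tri q2 1 (13/3 + 3 * (H - K)) d2"
    by (rule that, unfold q2_def, rule tri_eqI[OF tri_mult[OF tri_mult[OF tri_mult[OF tri_mult[OF tri_mult[OF k73 l5] l53] tri_products(2)] tri_mult[OF tri_products(5) tri_products(6)]] tri_products(3)] _ _ refl])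
      (simp_all add: field_simps)
  define S where "S = (P - 1) * ((1 / t) * (20 * q1 - 12 * q2))"
  have "pcong 2 S (- 8 + (- 4 * (H - K) - 2 * H) * P)"
    unfolding S_def
    by (rule pcong_eq_trans[OF tri_pcong_2[OF tri_mult[OF P1 tri_mult[OF t' tri_diff[OF tri_cmult[of 20, OF _ tq1] tri_cmult[of 12, OF _ tq2]]]]]])
      (auto simp: algebra_simps)
  also have "pcong 2 \<dots> (- 8 + 0)"
  proof (intro pcong_add pcong_refl)
    have "pcong 1 (- 4 * (H - K) - 2 * H) (- 4 * (H - 3/2 * H) - 2 * H)"
      by (intro pcong_diff pcong_cmult K_pcong_1 pcong_refl) auto
    from pcong_P_mult[OF this, of 1] show "pcong 2 ((- 4 * (H - K) - 2 * H) * P) 0"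
      by (simp add: mult.commute numeral_2_eq_2)
  qed
  finally have "pcong 3 (P * S) (P * - 8)" using pcong_P_mult[of 2 S "- 8" 1] by simp
  then have 2: "pcong 3 (P * S) (- 8 * P)" by (rule pcong_eq_trans) simp
  have s: "(-1) ^ M * c = m * t" "(-1) ^ M / c = 1 / (m * t)"
  proof -
    show *: "(-1) ^ M * c = m * t" unfolding t_def by (rule c_sign)
    have "(-1) ^ M / c = 1 / ((-1) ^ M * c)" by (cases "even M") simp_all
    then show "(-1) ^ M / c = 1 / (m * t)" unfolding * .
  qed
  have "pcong 3 (8 * of_int (J 1)) (of_int (4 * int M * (-1) ^ M * (15 * int (n choose M) - 10 * (2 * int ((6 * M) choose M) + int ((6 * M) choose (3 * M)))
      + 3 * (2 * int ((10 * M) choose M) + 2 * int ((10 * M) choose (3 * M)) + int ((10 * M) choose (5 * M))))))"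
    using J_1_cong unfolding pcong_of_int_iff[symmetric] by simp
  also have "of_int (4 * int M * (-1) ^ M * (15 * int (n choose M) - 10 * (2 * int ((6 * M) choose M) + int ((6 * M) choose (3 * M)))
      + 3 * (2 * int ((10 * M) choose M) + 2 * int ((10 * M) choose (3 * M)) + int ((10 * M) choose (5 * M)))))
    = (P - 1) * (-1) ^ M * (15 * c - 10 * (2 * of_nat ((6 * M) choose M) + of_nat ((6 * M) choose (3 * M)))
      + 3 * (2 * of_nat ((10 * M) choose M) + 2 * of_nat ((10 * M) choose (3 * M)) + of_nat ((10 * M) choose (5 * M))))"
    using P_eq(1) by (simp add: c_def)
  also have "\<dots> = (P - 1) * (-1) ^ M * (15 * c - 10 * (c * a1 + P / c * (- 2 * q1))
      + 3 * (c * a2 + 2 * (P / c * (- 2 * q2)) + c * a3))"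
    unfolding binomial_6_1 binomial_6_3 binomial_10_1 binomial_10_3 binomial_10_5 a1_def a2_def a3_def q1_def q2_def ..
  also have "\<dots> = ((-1) ^ M * c) * ((P - 1) * (15 - 10 * a1 + 3 * (a2 + a3))) + ((-1) ^ M / c) * (P * (P - 1) * (20 * q1 - 12 * q2))"
    by (simp add: algebra_simps add_divide_distrib diff_divide_distrib)
  also have "\<dots> = m * ((P - 1) * (t * (15 - 10 * a1 + 3 * (a2 + a3)))) + P * S / m"
    unfolding s S_def by (simp add: mult_ac)
  also have "pcong 3 \<dots> (m * (- 8 + e / 2 * P\<^sup>2) + (- 8 * P) / m)"
    using 1 2 by (intro pcong_add pcong_cmult pcong_divide) auto
  also have "\<dots> = 8 * (- (m * (1 - P\<^sup>2 * e / 16) + P / m))" by (simp add: algebra_simps)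
  finally show ?thesis
    by (rule pcong_cancel) (use punit_mult[OF punit_2 punit_4] in simp)
qed

text \<open>The reduced denominator returned by \<open>quotient_of\<close> divides every other
  denominator, in particular one prime to p.\<close>

lemma rat_cong_pow_of_pcong:
  assumes "pcong k a b"
  shows "rat_cong_pow a b (int p) k"
proof -
  from assms obtain r where r: "r \<in> pint" "a = b + P ^ k * r" by (rule pcongE)
  then have q: "(a - b) / of_int (int p ^ k) = r" using P_nonzero by simp
  obtain u v where uv: "r = of_int u / of_int v" "coprime v (int p)" using r(1) by (auto simp: pint_def)
  have v: "v \<noteq> 0" using uv(2) by (rule not_coprime_0)
  obtain s d where sd: "quotient_of r = (s, d)" by (cases "quotient_of r") auto
  have d: "d > 0" "coprime s d" "r = of_int s / of_int d"
    using quotient_of_denom_pos[OF sd] quotient_of_coprime[OF sd] quotient_of_div[OF sd] by auto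
  have "of_int (s * v) = (of_int (u * d) :: rat)" using uv(1) d v by (simp add: field_simps)
  then have "s * v = u * d" by (simp only: of_int_eq_iff)
  then have "d dvd s * v" by simp
  then have "d dvd v" using d(2) by (metis coprime_commute coprime_dvd_mult_right_iff)
  then have "coprime d (int p)" using uv(2) by (metis coprime_divisors dvd_refl)
  then show ?thesis unfolding rat_cong_pow_def q sd by simp
qed

lemma pcong_main_sum:
  "pcong 3 ((\<Sum>k=0..p-1. of_nat (k+1) * (of_nat ((2*k) choose k))\<^sup>2 / 8 ^ k)
     + (\<Sum>k=0..(p-1) div 2. of_nat (2*k+1) * (of_nat ((2*k) choose k))\<^sup>2 / (-16) ^ k))
    (- of_int (J 1))"
proof -
  have t8: "of_nat (k+1) * (of_nat ((2*k) choose k))\<^sup>2 / 8 ^ k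
     = 1/2 * ((half_choose k)\<^sup>2 * 2 ^ k + (2 * of_nat k + 1) * (half_choose k)\<^sup>2 * 2 ^ k :: rat)" for k
  proof -
    have "(4 ^ k)\<^sup>2 = (8 ^ k * 2 ^ k :: rat)"
      by (simp add: power2_eq_square flip: power_mult_distrib)
    then show ?thesis by (simp add: half_choose_def power_divide field_simps)
  qed
  have t16: "of_nat (2*k+1) * (of_nat ((2*k) choose k))\<^sup>2 / (-16) ^ k
     = 1/2 * ((-1) ^ k * (half_choose k)\<^sup>2 + (4 * of_nat k + 1) * (-1) ^ k * (half_choose k)\<^sup>2 :: rat)" for k
  proof -
    have "(-16 :: rat) ^ k = (-1) ^ k * (4 ^ k)\<^sup>2"
      by (simp add: power2_eq_square flip: power_mult_distrib)
    then show ?thesis by (cases "even k") (simp_all add: half_choose_def power_divide field_simps)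
  qed
  have *: "1/2 * (m * (2 - P\<^sup>2 * e / 8) + 2 * P / m) = - (- (m * (1 - P\<^sup>2 * e / 16) + P / m))"
    by (simp add: algebra_simps)
  have "(\<Sum>k=0..p-1. of_nat (k+1) * (of_nat ((2*k) choose k))\<^sup>2 / 8 ^ k)
     + (\<Sum>k=0..(p-1) div 2. of_nat (2*k+1) * (of_nat ((2*k) choose k))\<^sup>2 / (-16) ^ k)
    = 1/2 * (((\<Sum>k\<le>2*n. (half_choose k)\<^sup>2 * 2^k) + (\<Sum>k\<le>n. (-1)^k * (half_choose k)\<^sup>2))
     + ((\<Sum>k\<le>2*n. (2*of_nat k+1) * (half_choose k)\<^sup>2 * 2^k) + (\<Sum>k\<le>n. (4*of_nat k+1) * (-1)^k * (half_choose k)\<^sup>2)) :: rat)"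
    unfolding t8 t16 by (simp add: sum.distrib flip: sum_distrib_left sum_divide_distrib add: p_eq n_eq atLeast0AtMost add_divide_distrib)
  also have "pcong 3 \<dots> (1/2 * (m * (2 - P\<^sup>2 * e / 8) + 2 * P / m))"
    by (intro pcong_cmult pcong_add even_part odd_part) auto
  also have "pcong 3 (1/2 * (m * (2 - P\<^sup>2 * e / 8) + 2 * P / m)) (- of_int (J 1))"
    unfolding * by (intro pcong_minus pcong_sym[OF J_1_pcong])
  finally show ?thesis .
qed

end

theorem theorem1p2:
  fixes p :: nat and x y :: int
  assumes "prime p" and "odd p"
    and "int p = x\<^sup>2 + y\<^sup>2"
    and "(4::int) dvd (x - 1)" and "even y"
  shows "rat_cong_pow
    ((\<Sum>k=0..p-1. of_nat (k+1) * (of_nat ((2*k) choose k))\<^sup>2 / (8::rat) ^ k)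
     + (\<Sum>k=0..(p-1) div 2. of_nat (2*k+1) * (of_nat ((2*k) choose k))\<^sup>2 / (-16::rat) ^ k))
    (of_int (2 * Legendre 2 (int p) * x))
    (int p) 3"
proof -
  obtain a where a: "x - 1 = 4 * a" using assms(4) by auto
  obtain b where b: "y = 2 * b" using assms(5) by auto
  have "int p = 4 * (4 * a\<^sup>2 + 2 * a + b\<^sup>2) + 1"
  proof -
    have "x = 4 * a + 1" using a by simp
    then show ?thesis unfolding assms(3) b by (simp add: power2_eq_square algebra_simps)
  qed
  \<comment> \<open>This is where \<open>quarter_prime\<close> comes from: the parity conditions on
    x and y force p to be 1 modulo 4.\<close>
  then have "int p mod 4 = 1" by presburger
  then have "p mod 4 = 1" by presburger
  then have "p = 4 * (p div 4) + 1" by (metis div_mult_mod_eq mult.commute)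
  then interpret quarter_prime p "p div 4" "2 * (p div 4)"
    using assms(1) by unfold_locales auto
  have "pcong 3 ((\<Sum>k=0..p-1. of_nat (k+1) * (of_nat ((2*k) choose k))\<^sup>2 / 8 ^ k)
     + (\<Sum>k=0..(p-1) div 2. of_nat (2*k+1) * (of_nat ((2*k) choose k))\<^sup>2 / (-16) ^ k))
    (of_int (2 * Legendre 2 (int p) * x))"
    using pcong_main_sum J_1_eq[OF assms(3,4,5)] by simp
  then show ?thesis by (rule rat_cong_pow_of_pcong)
qed

end
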